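(* Let $z=(z_n)$ and $w=(w_n)$ be vectors in $\overline{B}_{\ell_\infty}$. Then $$\|\delta_z-\delta_w\|=\sup_{n\in\mathbb N}\|\delta_{z_n}-\delta_{w_n}\|.$$ Moreover, if $\mathbb N_0=\{n\in\mathbb N \mid z_n\neq w_n\}$, then $$\rho(\delta_z,\delta_w)=\sup_{n\in\mathbb N}\rho(\delta_{z_n},\delta_{w_n})=\sup_{n\in\mathbb N_0}\left|\frac{z_n-w_n}{1-\overline{z_n}w_n}\right|$$ (a supremum over the empty set being $0$). Hence, given $z=(z_n)\in\overline{B}_{\ell_\infty}$, $$\mathcal{GP}(\delta_z)=\bigcup_{0<r<1}\{\delta_w \mid w=(w_n)\in\overline B_{\ell_\infty},\ w_n=z_n\ \text{if}\ |z_n|=1,\ \text{and}\ w_n\in\mathcal D_r(z_n)\ \text{if}\ |z_n|<1\}.$$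
   Context: $c_0$ is the complex Banach space of null sequences, with bidual $\ell_\infty$; $B_{c_0}$ is its open unit ball and $\overline B_{\ell_\infty}$ is the closed unit ball of $\ell_\infty$. $\mathcal A_u(B_{c_0})$ is the Banach algebra (sup norm) of holomorphic, uniformly continuous functions $f\colon B_{c_0}\to\mathbb C$. Each such $f$ is a uniform limit on $B_{c_0}$ of polynomials in elements of $c_0^*=\ell_1$ and has a canonical extension $\tilde f$ to $\overline B_{\ell_\infty}$, which is its unique weak-star ($w(\ell_\infty,\ell_1)$) continuous extension. For $z\in\overline B_{\ell_\infty}$, $\delta_z(f)=\tilde f(z)$. $\mathcal M(\mathcal A_u(B_{c_0}))$ denotes the set of nonzero $\mathbb C$-valued algebra homomorphisms on $\mathcal A_u(B_{c_0})$; it equals $\{\delta_z \mid z\in\overline B_{\ell_\infty}\}$. For a uniform algebra $\mathcal A$ and homomorphisms $\varphi,\psi\in\mathcal M(\mathcal A)$: $\|\varphi-\psi\|=\sup_{\|f\|\le1}|\varphi(f)-\psi(f)|$ (Gleason metric), $\rho(\varphi,\psi)=\sup\{|\varphi(f)| \mid f\in\mathcal A,\ \|f\|\le 1,\ \psi(f)=0\}$ (pseudo-hyperbolic distance), and the Gleason part of $\varphi$ is $\mathcal{GP}(\varphi)=\{\psi\in\mathcal M(\mathcal A) \mid \rho(\varphi,\psi)<1\}$. Here $\delta_z,\delta_w$ are in $\mathcal M(\mathcal A_u(B_{c_0}))$, while for $\lambda\in\overline{\mathbb D}$, $\delta_\lambda$ is evaluation at $\lambda$ on the disc algebra $\mathcal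 A(\mathbb D)$ ($=\mathcal A_u(\mathbb D)$), $\mathbb D$ being the open unit disc of $\mathbb C$. For $\lambda\in\mathbb D$ and $0<r<1$, $\mathcal D_r(\lambda)=\{\mu\in\mathbb D \mid |\frac{\lambda-\mu}{1-\overline\lambda\mu}|<r\}$. *)

theory Defs
  imports "HOL-Analysis.Analysis" "HOL-Library.FuncSet"
begin

text \<open>Since \<^typ>\<open>nat\<close> is discrete, \<^typ>\<open>nat \<Rightarrow>\<^sub>C complex\<close> is the space of all bounded
  complex sequences with the supremum norm. The type \<open>c0\<close> is its closed subspace of null
  sequences; the representation function is the canonical embedding into the bidual.\<close>

type_synonym linf = "nat \<Rightarrow>\<^sub>C complex"

typedef c0 = "{x :: linf. apply_bcontfun x \<longlonglongrightarrow> 0}"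
  morphisms linf_of_c0 Abs_c0
  by (rule exI[of _ 0]) simp

setup_lifting type_definition_c0

lemma linf_scaleC_aux: "(\<lambda>n. c * apply_bcontfun x n) \<in> bcontfun" for c :: complex and x :: linf
proof -
  have "norm (c * apply_bcontfun x n) \<le> norm c * norm x" for n
    by (simp add: norm_mult mult_left_mono norm_bounded)
  then show ?thesis
    by (intro bcontfun_normI[where b = "norm c * norm x"]) auto
qed

definition linf_scaleC :: "complex \<Rightarrow> linf \<Rightarrow> linf" where
  "linf_scaleC c x = Bcontfun (\<lambda>n. c * apply_bcontfun x n)"

lemma apply_linf_scaleC [simp]: "apply_bcontfun (linf_scaleC c x) n = c * apply_bcontfun x n"
  unfolding linf_scaleC_def by (simp add: Bcontfun_inverse linf_scaleC_aux)

instantiation c0 :: real_vector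
begin

lift_definition zero_c0 :: c0 is 0 by simp
lift_definition plus_c0 :: "c0 \<Rightarrow> c0 \<Rightarrow> c0" is "(+)"
  unfolding plus_bcontfun.rep_eq by (rule tendsto_add_zero)
lift_definition minus_c0 :: "c0 \<Rightarrow> c0 \<Rightarrow> c0" is "(-)"
  unfolding minus_bcontfun.rep_eq using tendsto_diff[where a = 0 and b = 0] by simp
lift_definition uminus_c0 :: "c0 \<Rightarrow> c0" is uminus
  unfolding uminus_bcontfun.rep_eq using tendsto_minus[where a = 0] by simp
lift_definition scaleR_c0 :: "real \<Rightarrow> c0 \<Rightarrow> c0" is scaleR
  unfolding scaleR_bcontfun.rep_eq
  using tendsto_scaleR[OF tendsto_const, where b = 0] by simp

instance
proof
  fix x y z :: c0 and a b :: real
  show "x + y + z = x + (y + z)" by transfer (rule add.assoc)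
  show "x + y = y + x" by transfer (rule add.commute)
  show "0 + x = x" by transfer (rule add_0)
  show "- x + x = 0" by transfer (rule left_minus)
  show "x - y = x + - y" by transfer (rule diff_conv_add_uminus)
  show "a *\<^sub>R (x + y) = a *\<^sub>R x + a *\<^sub>R y" by transfer (rule scaleR_add_right)
  show "(a + b) *\<^sub>R x = a *\<^sub>R x + b *\<^sub>R x" by transfer (rule scaleR_add_left)
  show "a *\<^sub>R b *\<^sub>R x = (a * b) *\<^sub>R x" by transfer (rule scaleR_scaleR)
  show "1 *\<^sub>R x = x" by transfer (rule scaleR_one)
qed

end

instantiation c0 :: real_normed_vector
begin

lift_definition norm_c0 :: "c0 \<Rightarrow> real" is norm .
lift_definition dist_c0 :: "c0 \<Rightarrow> c0 \<Rightarrow> real" is dist .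
lift_definition sgn_c0 :: "c0 \<Rightarrow> c0" is sgn
  unfolding sgn_bcontfun_def scaleR_bcontfun.rep_eq
  using tendsto_scaleR[OF tendsto_const, where b = 0] by simp
definition uniformity_c0 :: "(c0 \<times> c0) filter" where
  "uniformity_c0 = (INF e\<in>{0<..}. principal {(x, y). dist x y < e})"
definition open_c0 :: "c0 set \<Rightarrow> bool" where
  "open_c0 S = (\<forall>x\<in>S. \<forall>\<^sub>F (x', y) in uniformity. x' = x \<longrightarrow> y \<in> S)"

instance
proof
  fix x y :: c0 and a :: real
  show "dist x y = norm (x - y)" by transfer (rule dist_norm)
  show "norm x = 0 \<longleftrightarrow> x = 0" by transfer (rule norm_eq_zero)
  show "norm (x + y) \<le> norm x + norm y" by transfer (rule norm_triangle_ineq)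
  show "norm (a *\<^sub>R x) = \<bar>a\<bar> * norm x" by transfer (rule norm_scaleR)
  show "sgn x = x /\<^sub>R norm x" by transfer (rule sgn_div_norm)
qed (rule uniformity_c0_def open_c0_def)+

end

lift_definition c0_scaleC :: "complex \<Rightarrow> c0 \<Rightarrow> c0" is linf_scaleC
proof -
  fix c :: complex and x :: linf
  assume "apply_bcontfun x \<longlonglongrightarrow> 0"
  then have "(\<lambda>n. c * apply_bcontfun x n) \<longlonglongrightarrow> 0"
    by (rule tendsto_mult_right_zero)
  moreover have "apply_bcontfun (linf_scaleC c x) = (\<lambda>n. c * apply_bcontfun x n)"
    by (rule ext) simp
  ultimately show "apply_bcontfun (linf_scaleC c x) \<longlonglongrightarrow> 0" by simp
qed

text \<open>The library shows completeness of \<open>bcontfun\<close> only over a metric space, which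
  \<^typ>\<open>nat\<close> is not an instance of.\<close>

lemma linf_Cauchy_convergent:
  fixes X :: "nat \<Rightarrow> linf"
  assumes "Cauchy X"
  shows "\<exists>l. X \<longlonglongrightarrow> l"
proof -
  have "\<forall>e>0. \<exists>N. \<forall>m n k. N \<le> m \<and> N \<le> n \<and> True \<longrightarrow>
      dist (apply_bcontfun (X m) k) (apply_bcontfun (X n) k) < e"
    using assms dist_fun_lt_imp_dist_val_lt unfolding Cauchy_def by meson
  then obtain g where "\<forall>e>0. \<exists>N. \<forall>n k. N \<le> n \<and> True \<longrightarrow>
      dist (apply_bcontfun (X n) k) (g k) < e"
    using uniformly_convergent_eq_cauchy[of "\<lambda>_. True" "\<lambda>n. apply_bcontfun (X n)"]
    by auto
  then have "uniform_limit UNIV (\<lambda>n. apply_bcontfun (X n)) g sequentially"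
    unfolding uniform_limit_sequentially_iff by simp
  from uniform_limit_bcontfunE[OF this sequentially_bot]
  show ?thesis by metis
qed

instance c0 :: banach
proof
  fix X :: "nat \<Rightarrow> c0"
  assume X: "Cauchy X"
  have dist_rep: "dist (linf_of_c0 x) (linf_of_c0 y) = dist x y" for x y
    by transfer simp
  have "Cauchy (\<lambda>n. linf_of_c0 (X n))"
    using X unfolding Cauchy_def dist_rep .
  then obtain l where l: "(\<lambda>n. linf_of_c0 (X n)) \<longlonglongrightarrow> l"
    using linf_Cauchy_convergent by blast
  have "apply_bcontfun l \<longlonglongrightarrow> 0"
  proof (rule tendstoI)
    fix e :: real assume "0 < e"
    then have "\<forall>\<^sub>F n in sequentially. dist (linf_of_c0 (X n)) l < e / 2"
      by (intro tendstoD[OF l]) simp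
    then obtain N where N: "dist (linf_of_c0 (X N)) l < e / 2"
      unfolding eventually_sequentially by auto
    have "apply_bcontfun (linf_of_c0 (X N)) \<longlonglongrightarrow> 0"
      using linf_of_c0 by blast
    then have "\<forall>\<^sub>F k in sequentially. dist (apply_bcontfun (linf_of_c0 (X N)) k) 0 < e / 2"
      using \<open>0 < e\<close> by (intro tendstoD) auto
    then show "\<forall>\<^sub>F k in sequentially. dist (apply_bcontfun l k) 0 < e"
    proof eventually_elim
      case (elim k)
      then show ?case
        using dist_bounded[of "linf_of_c0 (X N)" k l] N
          dist_triangle2[of "apply_bcontfun l k" 0 "apply_bcontfun (linf_of_c0 (X N)) k"]
          dist_triangle[of "apply_bcontfun l k" 0 "apply_bcontfun (linf_of_c0 (X N)) k"]
        by (simp add: dist_commute)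
    qed
  qed
  then have "linf_of_c0 (Abs_c0 l) = l"
    by (simp add: Abs_c0_inverse)
  then have "X \<longlonglongrightarrow> Abs_c0 l"
    using l unfolding tendsto_iff dist_rep[symmetric] by simp
  then show "convergent X"
    by (auto simp: convergent_def)
qed

text \<open>An algebra \<open>A\<close> of bounded functions on a set \<open>X\<close>, with pointwise operations and the
  supremum norm. Its elements are functions extensional on \<open>X\<close>, and homomorphisms are
  functions extensional on \<open>A\<close>, so that equality of either is equality on the domain.\<close>

definition sup_norm :: "'a set \<Rightarrow> ('a \<Rightarrow> complex) \<Rightarrow> real" where
  "sup_norm X f = (SUP x\<in>X. cmod (f x))"

definition characters :: "'a set \<Rightarrow> ('a \<Rightarrow> complex) set \<Rightarrow> (('a \<Rightarrow> complex) \<Rightarrow> complex) set" where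
  "characters X A = {\<phi> \<in> extensional A.
     (\<exists>f\<in>A. \<phi> f \<noteq> 0) \<and>
     (\<forall>f\<in>A. \<forall>g\<in>A. \<phi> (\<lambda>x\<in>X. f x + g x) = \<phi> f + \<phi> g) \<and>
     (\<forall>c. \<forall>f\<in>A. \<phi> (\<lambda>x\<in>X. c * f x) = c * \<phi> f) \<and>
     (\<forall>f\<in>A. \<forall>g\<in>A. \<phi> (\<lambda>x\<in>X. f x * g x) = \<phi> f * \<phi> g)}"

definition gleason_dist ::
  "'a set \<Rightarrow> ('a \<Rightarrow> complex) set \<Rightarrow> (('a \<Rightarrow> complex) \<Rightarrow> complex) \<Rightarrow> (('a \<Rightarrow> complex) \<Rightarrow> complex) \<Rightarrow> real" where
  "gleason_dist X A \<phi> \<psi> = (SUP f \<in> {f \<in> A. sup_norm X f \<le> 1}. cmod (\<phi> f - \<psi> f))"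

definition pseudohyp_dist ::
  "'a set \<Rightarrow> ('a \<Rightarrow> complex) set \<Rightarrow> (('a \<Rightarrow> complex) \<Rightarrow> complex) \<Rightarrow> (('a \<Rightarrow> complex) \<Rightarrow> complex) \<Rightarrow> real" where
  "pseudohyp_dist X A \<phi> \<psi> = (SUP f \<in> {f \<in> A. sup_norm X f \<le> 1 \<and> \<psi> f = 0}. cmod (\<phi> f))"

definition gleason_part ::
  "'a set \<Rightarrow> ('a \<Rightarrow> complex) set \<Rightarrow> (('a \<Rightarrow> complex) \<Rightarrow> complex) \<Rightarrow> (('a \<Rightarrow> complex) \<Rightarrow> complex) set" where
  "gleason_part X A \<phi> = {\<psi> \<in> characters X A. pseudohyp_dist X A \<phi> \<psi> < 1}"

definition holomorphic_c0 :: "(c0 \<Rightarrow> complex) \<Rightarrow> c0 set \<Rightarrow> bool" where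
  "holomorphic_c0 f S \<longleftrightarrow>
     (\<forall>x\<in>S. \<exists>L. (f has_derivative L) (at x) \<and> (\<forall>c h. L (c0_scaleC c h) = c * L h))"

definition Au_c0 :: "(c0 \<Rightarrow> complex) set" where
  "Au_c0 = {f \<in> extensional (ball 0 1).
     holomorphic_c0 f (ball 0 1) \<and> uniformly_continuous_on (ball 0 1) f}"

text \<open>The topology \<open>w(\<ell>\<^sub>\<infinity>, \<ell>\<^sub>1)\<close>: the coarsest one making every functional
  \<open>z \<mapsto> \<Sum>\<^sub>n a\<^sub>n z\<^sub>n\<close> with \<open>a\<close> absolutely summable continuous.\<close>

definition weak_star_linf :: "linf topology" where
  "weak_star_linf = topology_generated_by
     {{z. (\<Sum>n. a n * apply_bcontfun z n) \<in> U} | a U. summable (\<lambda>n. cmod (a n)) \<and> open U}"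

text \<open>The extension exists because the functions in \<open>Au_c0\<close> are uniform limits of polynomials
  in elements of \<open>\<ell>\<^sub>1\<close>, and it is unique because the open unit ball of \<open>c0\<close> is weak-star dense
  in the closed unit ball of the bidual.\<close>

definition ext_c0 :: "(c0 \<Rightarrow> complex) \<Rightarrow> linf \<Rightarrow> complex" where
  "ext_c0 f = (THE g. g \<in> extensional (cball 0 1) \<and>
     continuous_map (subtopology weak_star_linf (cball 0 1)) euclidean g \<and>
     (\<forall>x\<in>ball 0 1. g (linf_of_c0 x) = f x))"

definition delta_c0 :: "linf \<Rightarrow> (c0 \<Rightarrow> complex) \<Rightarrow> complex" where
  "delta_c0 z = (\<lambda>f\<in>Au_c0. ext_c0 f z)"

text \<open>As for \<open>c0\<close>, the elements are functions on the open unit disc; evaluation at a point of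
  the closed disc is evaluation of the unique continuous extension.\<close>

definition disc_algebra :: "(complex \<Rightarrow> complex) set" where
  "disc_algebra = {f \<in> extensional (ball 0 1).
     f holomorphic_on ball 0 1 \<and> uniformly_continuous_on (ball 0 1) f}"

definition ext_disc :: "(complex \<Rightarrow> complex) \<Rightarrow> complex \<Rightarrow> complex" where
  "ext_disc f = (THE g. g \<in> extensional (cball 0 1) \<and> continuous_on (cball 0 1) g \<and>
     (\<forall>x\<in>ball 0 1. g x = f x))"

definition delta_disc :: "complex \<Rightarrow> (complex \<Rightarrow> complex) \<Rightarrow> complex" where
  "delta_disc l = (\<lambda>f\<in>disc_algebra. ext_disc f l)"

definition pseudohyp_disc :: "real \<Rightarrow> complex \<Rightarrow> complex set" where
  "pseudohyp_disc r l = {m \<in> ball 0 1. cmod ((l - m) / (1 - cnj l * m)) < r}"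

abbreviation gleason_dist_c0 :: "linf \<Rightarrow> linf \<Rightarrow> real" where
  "gleason_dist_c0 z w \<equiv> gleason_dist (ball 0 1) Au_c0 (delta_c0 z) (delta_c0 w)"

abbreviation gleason_dist_disc :: "complex \<Rightarrow> complex \<Rightarrow> real" where
  "gleason_dist_disc l m \<equiv> gleason_dist (ball 0 1) disc_algebra (delta_disc l) (delta_disc m)"

abbreviation pseudohyp_dist_c0 :: "linf \<Rightarrow> linf \<Rightarrow> real" where
  "pseudohyp_dist_c0 z w \<equiv> pseudohyp_dist (ball 0 1) Au_c0 (delta_c0 z) (delta_c0 w)"

abbreviation pseudohyp_dist_disc :: "complex \<Rightarrow> complex \<Rightarrow> real" where
  "pseudohyp_dist_disc l m \<equiv> pseudohyp_dist (ball 0 1) disc_algebra (delta_disc l) (delta_disc m)"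

end

theory Submission
  imports Defs "HOL-Complex_Analysis.Complex_Analysis"
begin

text \<open>Rotating disjoint blocks of coordinates shows that a function in the algebra cannot keep
  oscillating in far directions from a fixed finitely supported point. Iterating Schwarz's lemma over
  consecutive blocks upgrades this to \<open>f \<circ> P\<^sub>N \<longlonglongrightarrow> f\<close> uniformly on the ball, where \<open>P\<^sub>N\<close> keeps the first
  \<open>N\<close> coordinates. Hence \<open>f\<close> has a weak-star continuous extension, namely the limit of the values at
  shrunk truncations, and polynomials in the coordinates are dense, so characters are determined by
  their values on the coordinates. For the distances, two points of a finite polydisc lie on an
  analytic disc whose parameters are the pair of coordinates that is farthest apart; composing with it
  turns a function on the polydisc into one on the disc. On the disc itself one has the Schwarz-Pick lemma, with
  \<open>(1 - cnj b x) / (1 - cnj b x + \<epsilon>)\<close> as near extremal functions when \<open>b\<close> is on the circle.\<close>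

section \<open>The space of null sequences\<close>

text \<open>Most of the work is the approximation through finitely many coordinates. Continuity in
  norm does not give it, since the tail of a point of the ball need not be small. What helps is that
  vectors with disjoint supports add without raising the sup norm: any number of blocks can be
  inserted and rotated inside the ball, while \<open>f\<close> stays bounded. This controls tails
  only beyond an index that depends on the head, so a gap is left between head and tail; Schwarz's
  lemma pays for the block in that gap with a factor below 1. The Gleason distance on the disc is
  never computed. Both distances need only be monotone under dilation, because truncated points must
  be shrunk into the open ball. For the pseudo-hyperbolic distance, the condition that
  \<open>f\<close> vanishes at \<open>w\<close> holds at shrunk points only in the limit and needs a
  correction. Characters are assumed neither continuous nor to be evaluations; both properties are
  derived.\<close>

abbreviation coord :: "c0 \<Rightarrow> nat \<Rightarrow> complex" where
  "coord x \<equiv> apply_bcontfun (linf_of_c0 x)"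

lemma coord_simps [simp]:
  "coord 0 n = 0"
  "coord (x + y) n = coord x n + coord y n"
  "coord (x - y) n = coord x n - coord y n"
  "coord (- x) n = - coord x n"
  "coord (t *\<^sub>R x) n = t *\<^sub>R coord x n"
  "coord (c0_scaleC c x) n = c * coord x n"
  by (simp_all add: zero_c0.rep_eq plus_c0.rep_eq minus_c0.rep_eq uminus_c0.rep_eq
      scaleR_c0.rep_eq c0_scaleC.rep_eq zero_bcontfun.rep_eq plus_bcontfun.rep_eq
      minus_bcontfun.rep_eq uminus_bcontfun.rep_eq)

lemma coord_sum [simp]: "coord (\<Sum>i\<in>I. f i) n = (\<Sum>i\<in>I. coord (f i) n)"
  by (induction I rule: infinite_finite_induct) auto

lemma c0_eqI: "(\<And>n. coord x n = coord y n) \<Longrightarrow> x = y"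
  by (metis apply_bcontfun_inject linf_of_c0_inject ext)

lemma coord_tendsto: "coord x \<longlonglongrightarrow> 0"
  using linf_of_c0 by blast

lemma coord_le_norm: "cmod (coord x n) \<le> norm x"
  by (simp add: norm_c0.rep_eq norm_bounded)

lemma c0_norm_le: "(\<And>n. cmod (coord x n) \<le> B) \<Longrightarrow> norm x \<le> B"
  by (simp add: norm_c0.rep_eq norm_bound)

definition c0_of_seq :: "(nat \<Rightarrow> complex) \<Rightarrow> c0" where
  "c0_of_seq a = Abs_c0 (Bcontfun a)"

lemma coord_c0_of_seq:
  assumes "a \<longlonglongrightarrow> 0"
  shows "coord (c0_of_seq a) = a"
proof -
  have "bounded (range a)"
    using assms by (rule convergent_imp_bounded)
  then have "a \<in> bcontfun"
    by (simp add: bcontfun_def continuous_on_def)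
  with assms show ?thesis
    by (simp add: c0_of_seq_def Abs_c0_inverse Bcontfun_inverse)
qed

text \<open>The argument is an arbitrary sequence, so that vectors of the bidual and tuples of
  scalar functions can be truncated as well.\<close>

definition trunc :: "nat \<Rightarrow> (nat \<Rightarrow> complex) \<Rightarrow> c0" where
  "trunc N a = c0_of_seq (\<lambda>n. if n < N then a n else 0)"

lemma coord_trunc [simp]: "coord (trunc N a) n = (if n < N then a n else 0)"
proof -
  have "(\<lambda>n. if n < N then a n else 0) \<longlonglongrightarrow> 0"
    by (rule tendsto_eventually) (auto simp: eventually_at_top_linorder intro!: exI[of _ N])
  then show ?thesis
    by (simp add: trunc_def coord_c0_of_seq)
qed

definition unit_c0 :: "nat \<Rightarrow> c0" where
  "unit_c0 k = trunc (Suc k) (\<lambda>n. if n = k then 1 else 0)"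

lemma coord_unit_c0 [simp]: "coord (unit_c0 k) n = (if n = k then 1 else 0)"
  by (simp add: unit_c0_def)

lemma trunc_eq_sum: "trunc N a = (\<Sum>k<N. c0_scaleC (a k) (unit_c0 k))"
  by (rule c0_eqI) (auto simp: if_distrib sum.delta cong: if_cong)

lemma norm_trunc_le: "(\<And>n. n < N \<Longrightarrow> cmod (a n) \<le> B) \<Longrightarrow> 0 \<le> B \<Longrightarrow> norm (trunc N a) \<le> B"
  by (rule c0_norm_le) simp

lemma norm_trunc_coord_le: "norm (trunc N (coord x)) \<le> norm x"
  by (rule norm_trunc_le) (auto simp: coord_le_norm)

lemma c0_scaleC_bilinear: "bounded_bilinear c0_scaleC"
proof
  show "\<exists>K. \<forall>a b. norm (c0_scaleC a b) \<le> norm a * norm b * K"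
    by (intro exI[of _ 1] allI c0_norm_le) (simp add: norm_mult coord_le_norm mult_left_mono)
qed (auto intro!: c0_eqI simp: algebra_simps)

lemma norm_c0_scaleC_le: "norm (c0_scaleC a b) \<le> cmod a * norm b"
  by (rule c0_norm_le) (simp add: norm_mult coord_le_norm mult_left_mono)

lemma trunc_tendsto: "(\<lambda>N. trunc N (coord x)) \<longlonglongrightarrow> x"
proof (rule tendstoI)
  fix e :: real assume "0 < e"
  then have "\<forall>\<^sub>F n in sequentially. dist (coord x n) 0 < e / 2"
    using coord_tendsto[of x] by (intro tendstoD) auto
  then obtain M where M: "\<And>n. n \<ge> M \<Longrightarrow> cmod (coord x n) < e / 2"
    by (auto simp: eventually_at_top_linorder)
  have "dist (trunc N (coord x)) x < e" if "N \<ge> M" for N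
  proof -
    have "norm (trunc N (coord x) - x) \<le> e / 2"
      by (rule c0_norm_le) (use M that \<open>0 < e\<close> in \<open>auto intro!: less_imp_le\<close>)
    with \<open>0 < e\<close> show ?thesis by (simp add: dist_norm)
  qed
  then show "\<forall>\<^sub>F N in sequentially. dist (trunc N (coord x)) x < e"
    by (auto simp: eventually_at_top_linorder)
qed

section \<open>Boundedness and restriction to complex lines\<close>

text \<open>The segment from 0 to \<open>x\<close> splits into a fixed number of steps shorter than
  the modulus of continuity for 1, and each step changes \<open>f\<close> by less than 1.\<close>

lemma Au_c0_bounded:
  assumes "f \<in> Au_c0"
  obtains M where "0 < M" "\<And>x. norm x < 1 \<Longrightarrow> cmod (f x) \<le> M"
proof -
  have "uniformly_continuous_on (ball 0 1) f"
    using assms by (simp add: Au_c0_def)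
  then obtain d where d: "d > 0"
    "\<And>x y. norm x < 1 \<Longrightarrow> norm y < 1 \<Longrightarrow> dist x y < d \<Longrightarrow> dist (f x) (f y) < 1"
    unfolding uniformly_continuous_on_def by (metis mem_ball_0 zero_less_one)
  obtain n :: nat where n: "1 / d < real n" using reals_Archimedean2 by blast
  then have npos: "0 < real n" using d(1) by (smt (verit) divide_pos_pos)
  have "cmod (f x) \<le> cmod (f 0) + n" if x: "norm x < 1" for x
  proof -
    have "cmod (f ((real k / n) *\<^sub>R x)) \<le> cmod (f 0) + k" if "k \<le> n" for k
      using that
    proof (induction k)
      case (Suc k)
      have b: "norm ((real j / n) *\<^sub>R x) < 1" if "j \<le> n" for j
      proof -
        have "norm ((real j / n) *\<^sub>R x) \<le> 1 * norm x"
          unfolding norm_scaleR using that npos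
          by (intro mult_right_mono) auto
        with x show ?thesis by simp
      qed
      have "dist ((real (Suc k) / n) *\<^sub>R x) ((real k / n) *\<^sub>R x) = norm ((1 / n) *\<^sub>R x)"
        unfolding dist_norm by (metis add_divide_distrib add_diff_cancel_right' of_nat_Suc scaleR_diff_left add.commute)
      also have "\<dots> < d"
      proof -
        have "norm x / n \<le> 1 / n" using x npos by (intro divide_right_mono) auto
        also have "1 / n < d" using n npos d(1) by (simp add: field_simps)
        finally show ?thesis by simp
      qed
      finally have "dist (f ((real (Suc k) / n) *\<^sub>R x)) (f ((real k / n) *\<^sub>R x)) < 1"
        using d(2)[OF b[of "Suc k"] b[of k]] Suc.prems by linarith
      then have "cmod (f ((real (Suc k) / n) *\<^sub>R x)) \<le> cmod (f ((real k / n) *\<^sub>R x)) + 1"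
        using norm_triangle_sub[of "f ((real (Suc k) / n) *\<^sub>R x)" "f ((real k / n) *\<^sub>R x)"]
        by (simp add: dist_norm)
      with Suc show ?case by simp
    qed simp
    from this[of n] npos show ?thesis by simp
  qed
  moreover have "0 < cmod (f 0) + n" using npos by (smt (verit) norm_ge_zero)
  ultimately show thesis by (rule that[rotated])
qed

text \<open>Complex linearity of the Frechet derivative makes the restriction to a complex line
  holomorphic in one variable, with derivative \<open>L b\<close>.\<close>

lemma Au_c0_slice_holomorphic:
  assumes f: "f \<in> Au_c0" and S: "\<And>t. t \<in> S \<Longrightarrow> norm (a + c0_scaleC t b) < 1"
  shows "(\<lambda>t. f (a + c0_scaleC t b)) holomorphic_on S"
proof (unfold holomorphic_on_def, intro ballI)
  fix t assume "t \<in> S"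
  then have "a + c0_scaleC t b \<in> ball 0 1" using S by simp
  with f obtain L where L: "(f has_derivative L) (at (a + c0_scaleC t b))"
    and lin: "\<And>c h. L (c0_scaleC c h) = c * L h"
    unfolding Au_c0_def holomorphic_c0_def by blast
  interpret bounded_bilinear c0_scaleC by (rule c0_scaleC_bilinear)
  have "((\<lambda>t. a + c0_scaleC t b) has_derivative (\<lambda>h. c0_scaleC h b)) (at t)"
    using bounded_linear.has_derivative[OF bounded_linear_left has_derivative_ident]
    by (auto intro!: derivative_eq_intros)
  from has_derivative_compose[OF this L]
  have "((\<lambda>t. f (a + c0_scaleC t b)) has_derivative (\<lambda>h. L b * h)) (at t)"
    by (simp add: lin mult.commute)
  then have "((\<lambda>t. f (a + c0_scaleC t b)) has_field_derivative L b) (at t)"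
    unfolding has_field_derivative_def .
  then show "(\<lambda>t. f (a + c0_scaleC t b)) field_differentiable at t within S"
    using field_differentiable_at_within field_differentiable_def by blast
qed

section \<open>Energy along circles\<close>

text \<open>Cauchy's formula on the unit circle: the contour element contributes 2 pi i u, so that
  the kernel becomes u / (u - w) with respect to normalised arc length.\<close>

lemma circle_average:
  assumes h: "h holomorphic_on cball 0 1" and w: "cmod w < 1"
  shows "((\<lambda>t. h (exp (2 * of_real pi * \<i> * of_real t)) *
      (exp (2 * of_real pi * \<i> * of_real t) / (exp (2 * of_real pi * \<i> * of_real t) - w)))
      has_integral h w) {0..1}"
proof -
  have "((\<lambda>u. h u / (u - w)) has_contour_integral (2 * of_real pi * \<i> * h w)) (circlepath 0 1)"
    using Cauchy_integral_circlepath_simple[of h 0 1 w] h w by simp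
  then have "((\<lambda>t. h (circlepath 0 1 t) / (circlepath 0 1 t - w) *
      vector_derivative (circlepath 0 1) (at t within {0..1})) has_integral
      (2 * of_real pi * \<i> * h w)) {0..1}"
    unfolding has_contour_integral_def .
  then have I: "((\<lambda>t. 1 / (2 * of_real pi * \<i>) * (h (circlepath 0 1 t) / (circlepath 0 1 t - w) *
      vector_derivative (circlepath 0 1) (at t within {0..1}))) has_integral
      1 / (2 * of_real pi * \<i>) * (2 * of_real pi * \<i> * h w)) {0..1}"
    by (rule has_integral_mult_right)
  have eq: "1 / (2 * of_real pi * \<i>) * (h (circlepath 0 1 t) / (circlepath 0 1 t - w) *
      vector_derivative (circlepath 0 1) (at t within {0..1})) =
      h (exp (2 * of_real pi * \<i> * of_real t)) *
      (exp (2 * of_real pi * \<i> * of_real t) / (exp (2 * of_real pi * \<i> * of_real t) - w))"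
    if "t \<in> {0..1}" for t :: real
  proof -
    have "vector_derivative (circlepath 0 1) (at t within {0..1}) =
        2 * of_real pi * \<i> * exp (2 * of_real pi * \<i> * of_real t)"
      using that vector_derivative_circlepath01[of t 0 1] by simp
    moreover have "circlepath 0 1 t = exp (2 * of_real pi * \<i> * of_real t)"
      by (simp add: circlepath)
    moreover have "1 / c * (a / b * (c * d)) = a * (d / b)" if "c \<noteq> 0" for a b c d :: complex
      using that by simp
    from this[of "2 * of_real pi * \<i>"]
    have "1 / (2 * of_real pi * \<i>) * (a / b * (2 * of_real pi * \<i> * d)) = a * (d / b)" for a b d :: complex
      by simp
    ultimately show ?thesis by metis
  qed
  have "1 / (2 * of_real pi * \<i>) * (2 * of_real pi * \<i> * h w) = h w" by simp
  with has_integral_eq[OF eq I] show ?thesis by metis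
qed

lemma circle_average_0:
  assumes h: "h holomorphic_on cball 0 1"
  shows "((\<lambda>t. h (exp (2 * of_real pi * \<i> * of_real t))) has_integral h 0) {0..1}"
  using circle_average[OF h, of 0] by simp

lemma holomorphic_continuous_on_circle:
  assumes h: "h holomorphic_on cball 0 1"
  shows "continuous_on {0..1} (\<lambda>t. h (exp (2 * of_real pi * \<i> * complex_of_real t)))"
proof (rule continuous_on_compose2[OF holomorphic_on_imp_continuous_on[OF h]])
  show "continuous_on {0..1} (\<lambda>t. exp (2 * of_real pi * \<i> * complex_of_real t))"
    by (intro continuous_intros)
qed auto

text \<open>Orthogonality splits the mean of |h|^2 into |h 0|^2 and the mean square deviation from
  \<open>h 0\<close>; Cauchy's formula bounds the deviation at \<open>\<rho>\<close> by that mean.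
  For \<open>\<rho> = 0\<close> only the mean value inequality for |h|^2 remains.\<close>

lemma circle_variance:
  assumes h: "h holomorphic_on cball 0 1" and \<rho>: "0 \<le> \<rho>" "\<rho> < 1"
  shows "(cmod (h 0))\<^sup>2 + (1 - \<rho>) * (cmod (h (of_real \<rho>) - h 0))\<^sup>2 \<le>
    integral {0..1} (\<lambda>t. (cmod (h (exp (2 * of_real pi * \<i> * of_real t))))\<^sup>2)"
proof -
  define u :: "real \<Rightarrow> complex" where "u t = exp (2 * of_real pi * \<i> * of_real t)" for t
  \<comment> \<open>The square is still holomorphic, and its modulus is the quantity to be
    averaged.\<close>
  define q where "q s = (h s - h 0)\<^sup>2" for s
  have q: "q holomorphic_on cball 0 1"
    unfolding q_def using h by (intro holomorphic_intros)
  have cmod_u: "cmod (u t) = 1" for t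
    by (simp add: u_def)
  have cont: "continuous_on {0..1} (\<lambda>t. h (u t))"
    using holomorphic_continuous_on_circle[OF h] by (simp add: u_def)
  let ?I = "integral {0..1} (\<lambda>t. (cmod (h (u t) - h 0))\<^sup>2)"
  have intble: "(\<lambda>t. (cmod (h (u t) - h 0))\<^sup>2) integrable_on {0..1}"
    by (intro integrable_continuous_interval continuous_intros cont)
  have cauchy: "((\<lambda>t. q (u t) * (u t / (u t - of_real \<rho>))) has_integral q (of_real \<rho>)) {0..1}"
    using circle_average[OF q, of "of_real \<rho>"] \<rho> by (simp add: u_def)
  have "cmod (integral {0..1} (\<lambda>t. q (u t) * (u t / (u t - of_real \<rho>)))) \<le>
    integral {0..1} (\<lambda>t. (cmod (h (u t) - h 0))\<^sup>2 * (1 / (1 - \<rho>)))"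
  proof (rule integral_norm_bound_integral)
    show "(\<lambda>t. q (u t) * (u t / (u t - of_real \<rho>))) integrable_on {0..1}"
      using cauchy by blast
    show "(\<lambda>t. (cmod (h (u t) - h 0))\<^sup>2 * (1 / (1 - \<rho>))) integrable_on {0..1}"
      by (intro integrable_continuous_interval continuous_intros cont)
    fix t
    have "1 - \<rho> \<le> cmod (u t - of_real \<rho>)"
      using norm_triangle_ineq2[of "u t" "of_real \<rho>"] cmod_u[of t] \<rho> by simp
    then have "1 / cmod (u t - of_real \<rho>) \<le> 1 / (1 - \<rho>)"
      using \<rho> by (intro divide_left_mono mult_pos_pos) auto
    then have "(cmod (h (u t) - h 0))\<^sup>2 * (1 / cmod (u t - of_real \<rho>))
        \<le> (cmod (h (u t) - h 0))\<^sup>2 * (1 / (1 - \<rho>))"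
      by (rule mult_left_mono) simp
    then show "cmod (q (u t) * (u t / (u t - of_real \<rho>))) \<le> (cmod (h (u t) - h 0))\<^sup>2 * (1 / (1 - \<rho>))"
      by (simp add: q_def norm_mult norm_divide norm_power cmod_u)
  qed
  then have "(cmod (h (of_real \<rho>) - h 0))\<^sup>2 \<le> ?I / (1 - \<rho>)"
    using cauchy by (simp add: integral_unique q_def norm_power)
  then have I: "(1 - \<rho>) * (cmod (h (of_real \<rho>) - h 0))\<^sup>2 \<le> ?I"
    using \<rho> by (simp add: pos_le_divide_eq mult.commute)
  have "((\<lambda>t. h (u t)) has_integral h 0) {0..1}"
    using circle_average_0[OF h] by (simp add: u_def)
  \<comment> \<open>The cross term integrates to zero because the mean of \<open>h\<close> over the
    circle is \<open>h 0\<close>.\<close>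
  then have "((\<lambda>t. 2 * Re (cnj (h 0) * (h (u t) - h 0))) has_integral
      2 * Re (cnj (h 0) * (h 0 - h 0))) {0..1}"
    by (intro has_integral_mult_right has_integral_Re has_integral_diff)
      (use has_integral_const_real[of "h 0" 0 1] in auto)
  then have "((\<lambda>t. (cmod (h 0))\<^sup>2 + 2 * Re (cnj (h 0) * (h (u t) - h 0)) + (cmod (h (u t) - h 0))\<^sup>2)
      has_integral (cmod (h 0))\<^sup>2 + 2 * Re (cnj (h 0) * (h 0 - h 0)) + ?I) {0..1}"
    by (intro has_integral_add integrable_integral intble)
      (use has_integral_const_real[of "(cmod (h 0))\<^sup>2" 0 1] in auto)
  moreover have "(cmod (h 0))\<^sup>2 + 2 * Re (cnj (h 0) * (h (u t) - h 0)) + (cmod (h (u t) - h 0))\<^sup>2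
      = (cmod (h (u t)))\<^sup>2" for t
    unfolding cmod_power2 by (simp add: power2_eq_square algebra_simps)
  ultimately have "integral {0..1} (\<lambda>t. (cmod (h (u t)))\<^sup>2) = (cmod (h 0))\<^sup>2 + ?I"
    by (simp add: integral_unique)
  with I show ?thesis
    unfolding u_def by simp
qed

text \<open>The left side is at most the circle mean of the right side, by
  \<open>circle_variance\<close> for \<open>h\<close> and by its case of parameter 0 for each
  \<open>g j\<close>; the maximum dominates the mean. One \<open>\<theta>\<close> has to serve all
  functions at once, hence the weighted sum.\<close>

lemma exists_energy_increment:
  assumes h: "h holomorphic_on cball 0 1" and g: "\<And>j. j \<in> J \<Longrightarrow> g j holomorphic_on cball 0 1"
    and J: "finite J" and \<rho>: "0 \<le> \<rho>" "\<rho> < 1" and \<kappa>: "0 \<le> \<kappa>"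
  obtains \<theta> where "cmod \<theta> = 1"
    "(cmod (h 0))\<^sup>2 + (1 - \<rho>) * (cmod (h (of_real \<rho>) - h 0))\<^sup>2 + \<kappa> * (\<Sum>j\<in>J. (cmod (g j 0))\<^sup>2)
      \<le> (cmod (h \<theta>))\<^sup>2 + \<kappa> * (\<Sum>j\<in>J. (cmod (g j \<theta>))\<^sup>2)"
proof -
  define u :: "real \<Rightarrow> complex" where "u t = exp (2 * of_real pi * \<i> * of_real t)" for t
  define E where "E \<theta> = (cmod (h \<theta>))\<^sup>2 + \<kappa> * (\<Sum>j\<in>J. (cmod (g j \<theta>))\<^sup>2)" for \<theta>
  define A where "A = (cmod (h 0))\<^sup>2 + (1 - \<rho>) * (cmod (h (of_real \<rho>) - h 0))\<^sup>2 + \<kappa> * (\<Sum>j\<in>J. (cmod (g j 0))\<^sup>2)"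
  have ch: "continuous_on {0..1} (\<lambda>t. h (u t))"
    using holomorphic_continuous_on_circle[OF h] by (simp add: u_def)
  have cg: "continuous_on {0..1} (\<lambda>t. g j (u t))" if "j \<in> J" for j
    using holomorphic_continuous_on_circle[OF g[OF that]] by (simp add: u_def)
  have cE: "continuous_on {0..1} (\<lambda>t. E (u t))"
    unfolding E_def using ch cg by (intro continuous_intros) auto
  have gJ: "(cmod (g j 0))\<^sup>2 \<le> integral {0..1} (\<lambda>t. (cmod (g j (u t)))\<^sup>2)" if "j \<in> J" for j
    using circle_variance[OF g[OF that], of 0] by (simp add: u_def)
  have ih: "(\<lambda>t. (cmod (h (u t)))\<^sup>2) integrable_on {0..1}"
    by (intro integrable_continuous_interval continuous_intros ch)
  have ig: "(\<lambda>t. (cmod (g j (u t)))\<^sup>2) integrable_on {0..1}" if "j \<in> J" for j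
    by (intro integrable_continuous_interval continuous_intros cg that)
  have "A \<le> integral {0..1} (\<lambda>t. (cmod (h (u t)))\<^sup>2) + \<kappa> * (\<Sum>j\<in>J. integral {0..1} (\<lambda>t. (cmod (g j (u t)))\<^sup>2))"
    unfolding A_def using circle_variance[OF h \<rho>] \<kappa> gJ
    by (intro add_mono mult_left_mono sum_mono) (auto simp: u_def)
  also have "\<dots> = integral {0..1} (\<lambda>t. E (u t))"
  proof -
    have "((\<lambda>t. E (u t)) has_integral integral {0..1} (\<lambda>t. (cmod (h (u t)))\<^sup>2)
        + \<kappa> * (\<Sum>j\<in>J. integral {0..1} (\<lambda>t. (cmod (g j (u t)))\<^sup>2))) {0..1}"
      unfolding E_def
      by (intro has_integral_add has_integral_mult_right has_integral_sum J integrable_integral ih ig)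
    then show ?thesis by (simp add: integral_unique)
  qed
  finally have A: "A \<le> integral {0..1} (\<lambda>t. E (u t))" .
  obtain t0 where t0: "t0 \<in> {0..1}" "\<And>t. t \<in> {0..1} \<Longrightarrow> E (u t) \<le> E (u t0)"
    using continuous_attains_sup[OF _ _ cE] by auto
  have "integral {0..1} (\<lambda>t. E (u t)) \<le> integral {0..1} (\<lambda>t::real. E (u t0))"
    using cE t0(2) by (intro integral_le integrable_continuous_interval) auto
  with A have "A \<le> E (u t0)" by simp
  then show thesis
    by (intro that[of "u t0"]) (auto simp: A_def E_def u_def)
qed

text \<open>Schwarz's lemma for a function that only nearly vanishes at 0: subtracting
  \<open>e 0\<close> enlarges the bound to \<open>A + \<eta>\<close>, rescaling puts the point 1 at
  \<open>\<rho>\<close>, and adding \<open>e 0\<close> back costs another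
  \<open>\<eta>\<close>.\<close>

lemma approx_Schwarz:
  assumes e: "e holomorphic_on ball 0 (1 / \<rho>)" and \<rho>: "0 < \<rho>" "\<rho> < 1"
    and A: "\<And>s. cmod s < 1 / \<rho> \<Longrightarrow> cmod (e s) \<le> A" and \<eta>: "cmod (e 0) \<le> \<eta>"
  shows "cmod (e 1) \<le> \<rho> * A + 2 * \<eta>"
proof -
  \<comment> \<open>A bound strictly above \<open>A + \<eta>\<close> makes the normalised function
    map into the open disc and avoids division by zero; it is lowered to \<open>A + \<eta>\<close>
    afterwards.\<close>
  have *: "cmod (e 1 - e 0) \<le> \<rho> * B" if B: "A + \<eta> < B" for B
  proof -
    have "0 \<le> A" "0 \<le> \<eta>"
      using order.trans[OF norm_ge_zero A[of 0]] order.trans[OF norm_ge_zero \<eta>] \<rho> by auto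
    with B have Bpos: "0 < B" by simp
    define F where "F z = (e (z / of_real \<rho>) - e 0) / of_real B" for z
    have sc: "cmod (z / of_real \<rho>) < 1 / \<rho>" if "cmod z < 1" for z
      using that \<rho> by (simp add: norm_divide divide_strict_right_mono)
    have "F holomorphic_on ball 0 1"
    proof -
      have "(e \<circ> (\<lambda>z. z / of_real \<rho>)) holomorphic_on ball 0 1"
        using \<rho> sc by (intro holomorphic_on_compose_gen[OF _ e]) (auto intro!: holomorphic_intros)
      then show ?thesis
        unfolding F_def comp_def using Bpos by (intro holomorphic_intros) auto
    qed
    moreover have "F 0 = 0" by (simp add: F_def)
    moreover have "cmod (F z) < 1" if "cmod z < 1" for z
    proof -
      have "cmod (e (z / of_real \<rho>) - e 0) \<le> A + \<eta>"
        using A[OF sc[OF that]] \<eta> norm_triangle_ineq4[of "e (z / of_real \<rho>)" "e 0"] by linarith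
      then show ?thesis
        using B Bpos by (simp add: F_def norm_divide)
    qed
    ultimately have "cmod (F (of_real \<rho>)) \<le> cmod (of_real \<rho>)"
      using \<rho> by (intro Schwarz_Lemma) auto
    then show ?thesis
      using \<rho> Bpos by (simp add: F_def norm_divide field_simps)
  qed
  have "cmod (e 1 - e 0) / \<rho> \<le> A + \<eta>"
  proof (rule dense_ge)
    fix B assume "A + \<eta> < B"
    from *[OF this] show "cmod (e 1 - e 0) / \<rho> \<le> B"
      using \<rho> by (simp add: pos_divide_le_eq mult.commute)
  qed
  then have "cmod (e 1 - e 0) \<le> \<rho> * (A + \<eta>)"
    using \<rho> by (simp add: pos_divide_le_eq mult.commute)
  also have "\<dots> \<le> \<rho> * A + \<eta>"
    using \<rho> \<eta> norm_ge_zero[of "e 0"] by (simp add: distrib_left mult_left_le_one_le del: norm_ge_zero)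
  finally show ?thesis
    using \<eta> norm_triangle_sub[of "e 1" "e 0"] by linarith
qed

section \<open>Uniform approximation by truncations\<close>

lemma norm_add_disjoint_le:
  assumes "\<And>n. coord x n = 0 \<or> coord y n = 0" "norm x \<le> B" "norm y \<le> B"
  shows "norm (x + y) \<le> B"
proof (rule c0_norm_le)
  fix n
  show "cmod (coord (x + y) n) \<le> B"
    using assms(1)[of n] order.trans[OF coord_le_norm[of x n] assms(2)]
      order.trans[OF coord_le_norm[of y n] assms(3)] by auto
qed

lemma Au_c0_uniformly_continuousD:
  assumes "f \<in> Au_c0" "0 < e"
  obtains d where "0 < d" "\<And>x y. norm x < 1 \<Longrightarrow> norm y < 1 \<Longrightarrow> norm (x - y) < d \<Longrightarrow> cmod (f x - f y) < e"
proof -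
  have "uniformly_continuous_on (ball 0 1) f"
    using assms by (simp add: Au_c0_def)
  with \<open>0 < e\<close> obtain d where d: "d > 0"
    "\<forall>x\<in>ball 0 1. \<forall>y\<in>ball 0 1. dist y x < d \<longrightarrow> dist (f y) (f x) < e"
    unfolding uniformly_continuous_on_def by meson
  show thesis
    by (rule that[OF d(1)]) (use d(2) in \<open>auto simp: dist_norm norm_minus_commute\<close>)
qed

text \<open>Truncating a bad far direction keeps a strict inequality, by uniform continuity. Bad
  directions can thus be taken finitely supported and placed one behind the other.\<close>

lemma far_block_exists:
  assumes f: "f \<in> Au_c0" and \<rho>: "0 < \<rho>" "\<rho> < 1" and c: "norm c \<le> \<rho>"
    and csupp: "\<And>n. K \<le> n \<Longrightarrow> coord c n = 0" and KL: "K \<le> L"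
    and z: "\<And>n. n < L \<Longrightarrow> coord z n = 0" "norm z \<le> \<rho>\<^sup>2" "\<delta> < cmod (f (c + z) - f c)"
  shows "\<exists>N y. L \<le> N \<and> (\<forall>n. n < L \<or> N \<le> n \<longrightarrow> coord y n = 0) \<and> norm y \<le> \<rho>\<^sup>2 \<and> \<delta> < cmod (f (c + y) - f c)"
proof -
  have \<rho>2: "\<rho>\<^sup>2 \<le> \<rho>" using \<rho> by (simp add: power2_eq_square mult_left_le)
  have lt1: "norm (c + y) < 1" if "\<And>n. n < L \<Longrightarrow> coord y n = 0" "norm y \<le> \<rho>\<^sup>2" for y
  proof -
    have "norm (c + y) \<le> \<rho>"
      using that csupp KL c \<rho>2 by (intro norm_add_disjoint_le) (auto, meson le_trans not_less)
    with \<rho> show ?thesis by simp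
  qed
  have "0 < cmod (f (c + z) - f c) - \<delta>" using z(3) by simp
  from Au_c0_uniformly_continuousD[OF f this] obtain d where d: "0 < d"
    "\<And>x y. norm x < 1 \<Longrightarrow> norm y < 1 \<Longrightarrow> norm (x - y) < d \<Longrightarrow> cmod (f x - f y) < cmod (f (c + z) - f c) - \<delta>"
    by metis
  have "\<forall>\<^sub>F N in sequentially. dist (trunc N (coord z)) z < d"
    using trunc_tendsto[of z] d(1) by (rule tendstoD)
  moreover have "\<forall>\<^sub>F N in sequentially. L \<le> N" by (rule eventually_ge_at_top)
  ultimately have "\<forall>\<^sub>F N in sequentially. L \<le> N \<and> dist (trunc N (coord z)) z < d"
    by eventually_elim simp
  then obtain N where N: "L \<le> N" "dist (trunc N (coord z)) z < d"
    by (auto simp: eventually_at_top_linorder)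
  let ?y = "trunc N (coord z)"
  have y: "n < L \<or> N \<le> n \<Longrightarrow> coord ?y n = 0" "norm ?y \<le> \<rho>\<^sup>2" for n
    using z(1,2) norm_trunc_coord_le[of N z] by auto
  have "cmod (f (c + z) - f (c + ?y)) < cmod (f (c + z) - f c) - \<delta>"
    using z y N(2) by (intro d(2) lt1) (auto simp: dist_norm norm_minus_commute)
  then have "\<delta> < cmod (f (c + ?y) - f c)"
    using norm_triangle_ineq[of "f (c + z) - f (c + ?y)" "f (c + ?y) - f c"] by simp
  with N y show ?thesis by blast
qed

text \<open>A bounded holomorphic function cannot oscillate by a fixed amount in infinitely many
  mutually disjoint directions: rotating the disjoint blocks \<open>y j\<close> one after the other increases
  \<open>\<bar>f z\<bar>\<^sup>2\<close> by the variance along each of them, and by subharmonicity the oscillation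
  in the directions not yet used can be kept.\<close>

lemma tail_continuity:
  assumes f: "f \<in> Au_c0" and \<rho>: "0 < \<rho>" "\<rho> < 1" and \<delta>: "0 < \<delta>" and c: "norm c \<le> \<rho>"
    and csupp: "\<And>n. K \<le> n \<Longrightarrow> coord c n = 0"
  shows "\<exists>L. \<forall>z. (\<forall>n<L. coord z n = 0) \<longrightarrow> norm z \<le> \<rho>\<^sup>2 \<longrightarrow> cmod (f (c + z) - f c) \<le> \<delta>"
proof (rule ccontr)
  assume neg: "\<not> ?thesis"
  have \<rho>2: "\<rho>\<^sup>2 \<le> \<rho>" using \<rho> by (simp add: power2_eq_square mult_left_le)
  have "\<exists>N y. L \<le> N \<and> (\<forall>n. n < L \<or> N \<le> n \<longrightarrow> coord y n = 0) \<and> norm y \<le> \<rho>\<^sup>2 \<and> \<delta> < cmod (f (c + y) - f c)"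
    if "K \<le> L" for L
  proof -
    obtain z where "\<forall>n<L. coord z n = 0" "norm z \<le> \<rho>\<^sup>2" "\<delta> < cmod (f (c + z) - f c)"
      using neg unfolding not_ex not_all not_imp not_le by blast
    then show ?thesis
      using far_block_exists[OF f \<rho> c csupp that, of z \<delta>] by blast
  qed
  then obtain N Y where NY: "\<And>L. K \<le> L \<Longrightarrow> L \<le> N L"
    "\<And>L n. K \<le> L \<Longrightarrow> n < L \<or> N L \<le> n \<Longrightarrow> coord (Y L) n = 0"
    "\<And>L. K \<le> L \<Longrightarrow> norm (Y L) \<le> \<rho>\<^sup>2" "\<And>L. K \<le> L \<Longrightarrow> \<delta> < cmod (f (c + Y L) - f c)"
    by metis
  \<comment> \<open>Block \<open>j\<close> occupies the coordinates from \<open>l j\<close> up to,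
    but excluding, \<open>l (Suc j)\<close>.\<close>
  define l where "l j = (N ^^ j) K" for j
  define y where "y j = Y (l j)" for j
  have l0: "l 0 = K" and lSuc: "l (Suc j) = N (l j)" for j
    by (simp_all add: l_def)
  have lK: "K \<le> l j" for j
    by (induction j) (auto simp: l0 lSuc intro: order.trans NY(1))
  have lmono: "i \<le> j \<Longrightarrow> l i \<le> l j" for i j
    by (rule lift_Suc_mono_le[of l]) (simp_all add: lSuc NY(1) lK)
  have ysupp: "n < l j \<or> l (Suc j) \<le> n \<Longrightarrow> coord (y j) n = 0" for j n
    unfolding y_def lSuc by (rule NY(2)[OF lK])
  have ynorm: "norm (y j) \<le> \<rho>\<^sup>2" and yosc: "\<delta> < cmod (f (c + y j) - f c)" for j
    unfolding y_def by (rule NY(3,4)[OF lK])+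
  obtain M where M: "0 < M" "\<And>x. norm x < 1 \<Longrightarrow> cmod (f x) \<le> M"
    using Au_c0_bounded[OF f] by blast
  \<comment> \<open>Invariant after \<open>i\<close> rotations: the first \<open>i\<close> blocks
    are absorbed in \<open>z\<close>, and their oscillation has been converted into size of
    \<open>f z\<close>. For \<open>i = m\<close> the sum is empty, so \<open>f z\<close> alone
    carries a bound growing with \<open>m\<close>.\<close>
  have energy: "\<exists>z. (\<forall>n\<ge>l i. coord z n = 0) \<and> norm z \<le> \<rho> \<and>
      (1 - \<rho>) * (real m * \<delta>\<^sup>2) \<le> (cmod (f z))\<^sup>2 + (1 - \<rho>) * (\<Sum>j\<in>{i..<m}. (cmod (f (z + y j) - f z))\<^sup>2)"
    if "i \<le> m" for i m
    using that
  proof (induction i)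
    case 0
    have "(\<Sum>j\<in>{0..<m}. \<delta>\<^sup>2) \<le> (\<Sum>j\<in>{0..<m}. (cmod (f (c + y j) - f c))\<^sup>2)"
      using yosc \<delta> by (intro sum_mono power_mono) (auto intro: less_imp_le)
    then have "(1 - \<rho>) * (real m * \<delta>\<^sup>2) \<le> (1 - \<rho>) * (\<Sum>j\<in>{0..<m}. (cmod (f (c + y j) - f c))\<^sup>2)"
      using \<rho> by (intro mult_left_mono) auto
    then show ?case
      using csupp c by (intro exI[of _ c]) (auto simp: l0 intro: add_increasing)
  next
    case (Suc i)
    then obtain z where z: "\<And>n. l i \<le> n \<Longrightarrow> coord z n = 0" "norm z \<le> \<rho>"
      and zE: "(1 - \<rho>) * (real m * \<delta>\<^sup>2) \<le> (cmod (f z))\<^sup>2 + (1 - \<rho>) * (\<Sum>j\<in>{i..<m}. (cmod (f (z + y j) - f z))\<^sup>2)"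
      by auto
    \<comment> \<open>Blocks of norm at most \<open>\<rho>\<^sup>2\<close> leave room for this
      rescaling: all parameters on the unit circle stay in the ball of radius \<open>\<rho>\<close>,
      and the parameter \<open>\<rho>\<close> gives back \<open>y i\<close>.\<close>
    define v where "v = c0_scaleC (1 / of_real \<rho>) (y i)"
    have vsupp: "n < l i \<or> l (Suc i) \<le> n \<Longrightarrow> coord v n = 0" for n
      using ysupp[of n i] by (auto simp: v_def)
    have "norm v \<le> \<rho>"
    proof -
      have "norm v \<le> (1 / \<rho>) * norm (y i)"
        unfolding v_def using norm_c0_scaleC_le[of "1 / of_real \<rho>" "y i"] \<rho> by (simp add: norm_divide)
      also have "\<dots> \<le> (1 / \<rho>) * \<rho>\<^sup>2" using ynorm \<rho> by (intro mult_left_mono) auto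
      finally show ?thesis using \<rho> by (simp add: power2_eq_square)
    qed
    then have sv: "norm (c0_scaleC s v) \<le> \<rho>" if "cmod s \<le> 1" for s
      using norm_c0_scaleC_le[of s v] mult_mono[OF that, of "norm v" \<rho>] by simp
    have zv: "norm (z + c0_scaleC s v) \<le> \<rho>" if "cmod s \<le> 1" for s
      using z vsupp sv[OF that] by (intro norm_add_disjoint_le) (auto, meson not_le)
    have zyv: "norm ((z + y j) + c0_scaleC s v) \<le> \<rho>" if s: "cmod s \<le> 1" and j: "i < j" for s j
    proof -
      have "coord (z + c0_scaleC s v) n = 0 \<or> coord (y j) n = 0" for n
        using z(1)[of n] vsupp[of n] ysupp[of n j] lmono[of i "Suc i"] lmono[of "Suc i" j] j
        by (cases "n < l (Suc i)") auto
      then have "norm ((z + c0_scaleC s v) + y j) \<le> \<rho>"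
        using zv[OF s] ynorm[of j] \<rho>2 by (rule norm_add_disjoint_le[OF _ _ order.trans])
      then show ?thesis by (simp add: add.commute add.left_commute)
    qed
    have hol: "(\<lambda>s. f (z + c0_scaleC s v)) holomorphic_on cball 0 1"
      by (intro Au_c0_slice_holomorphic[OF f]) (use zv \<rho> in \<open>fastforce\<close>)
    have hol2: "(\<lambda>s. f (z + y j + c0_scaleC s v) - f (z + c0_scaleC s v)) holomorphic_on cball 0 1"
      if "j \<in> {Suc i..<m}" for j
      by (intro holomorphic_on_diff hol Au_c0_slice_holomorphic[OF f])
        (use zyv[of _ j] \<rho> that in \<open>fastforce\<close>)
    obtain \<theta> where \<theta>: "cmod \<theta> = 1" and E:
      "(cmod (f (z + c0_scaleC 0 v)))\<^sup>2 +
        (1 - \<rho>) * (cmod (f (z + c0_scaleC (of_real \<rho>) v) - f (z + c0_scaleC 0 v)))\<^sup>2 +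
        (1 - \<rho>) * (\<Sum>j\<in>{Suc i..<m}. (cmod (f (z + y j + c0_scaleC 0 v) - f (z + c0_scaleC 0 v)))\<^sup>2)
      \<le> (cmod (f (z + c0_scaleC \<theta> v)))\<^sup>2 +
        (1 - \<rho>) * (\<Sum>j\<in>{Suc i..<m}. (cmod (f (z + y j + c0_scaleC \<theta> v) - f (z + c0_scaleC \<theta> v)))\<^sup>2)"
      by (rule exists_energy_increment[where h = "\<lambda>s. f (z + c0_scaleC s v)" and J = "{Suc i..<m}" and
            g = "\<lambda>j s. f (z + y j + c0_scaleC s v) - f (z + c0_scaleC s v)" and \<rho> = \<rho> and \<kappa> = "1 - \<rho>",
            OF hol hol2 _ _ _ _ that])
        (use \<rho> in auto)
    have v0: "c0_scaleC 0 v = 0" and v\<rho>: "c0_scaleC (of_real \<rho>) v = y i"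
      using \<rho> by (auto intro!: c0_eqI simp: v_def)
    have split: "(\<Sum>j\<in>{i..<m}. (cmod (f (z + y j) - f z))\<^sup>2) =
        (cmod (f (z + y i) - f z))\<^sup>2 + (\<Sum>j\<in>{Suc i..<m}. (cmod (f (z + y j) - f z))\<^sup>2)"
      using Suc.prems by (simp add: sum.atLeast_Suc_lessThan)
    have comm: "z + c0_scaleC \<theta> v + y j = z + y j + c0_scaleC \<theta> v" for j
      by (simp add: add.commute add.left_commute)
    have "coord (z + c0_scaleC \<theta> v) n = 0" if "l (Suc i) \<le> n" for n
      using z(1)[of n] vsupp[of n] lmono[of i "Suc i"] that by auto
    moreover have "norm (z + c0_scaleC \<theta> v) \<le> \<rho>"
      using zv \<theta> by simp
    moreover have "(1 - \<rho>) * (real m * \<delta>\<^sup>2) \<le> (cmod (f (z + c0_scaleC \<theta> v)))\<^sup>2 +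
        (1 - \<rho>) * (\<Sum>j\<in>{Suc i..<m}. (cmod (f (z + c0_scaleC \<theta> v + y j) - f (z + c0_scaleC \<theta> v)))\<^sup>2)"
    proof -
      note zE
      also have "(cmod (f z))\<^sup>2 + (1 - \<rho>) * (\<Sum>j\<in>{i..<m}. (cmod (f (z + y j) - f z))\<^sup>2) =
          (cmod (f z))\<^sup>2 + (1 - \<rho>) * (cmod (f (z + y i) - f z))\<^sup>2 +
          (1 - \<rho>) * (\<Sum>j\<in>{Suc i..<m}. (cmod (f (z + y j) - f z))\<^sup>2)"
        unfolding split by (simp only: distrib_left add.assoc)
      also note E[unfolded v0 v\<rho> add_0_right]
      finally show ?thesis unfolding comm .
    qed
    ultimately show ?case by blast
  qed
  obtain m :: nat where m: "M\<^sup>2 / ((1 - \<rho>) * \<delta>\<^sup>2) < real m"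
    using reals_Archimedean2 by blast
  obtain z where "norm z \<le> \<rho>" "(1 - \<rho>) * (real m * \<delta>\<^sup>2) \<le> (cmod (f z))\<^sup>2"
    using energy[of m m] by auto
  moreover from this have "(cmod (f z))\<^sup>2 \<le> M\<^sup>2"
    using M \<rho> by (intro power_mono) auto
  moreover have "M\<^sup>2 < (1 - \<rho>) * (real m * \<delta>\<^sup>2)"
    using m \<rho> \<delta> by (simp add: pos_divide_less_eq algebra_simps)
  ultimately show False by linarith
qed

text \<open>Each further coordinate multiplies the net by a finite net of a disc, and in the sup
  norm the mesh does not grow.\<close>

lemma finite_net_c0:
  assumes "0 \<le> \<rho>" "0 < \<eta>"
  shows "\<exists>F. finite F \<and> (\<forall>x\<in>F. norm x \<le> \<rho> \<and> (\<forall>n\<ge>K. coord x n = 0)) \<and>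
    (\<forall>c. norm c \<le> \<rho> \<longrightarrow> (\<forall>n\<ge>K. coord c n = 0) \<longrightarrow> (\<exists>x\<in>F. norm (c - x) \<le> \<eta>))"
proof (induction K)
  case 0
  have "c = 0" if "\<forall>n\<ge>0. coord c n = 0" for c :: c0
    using that by (intro c0_eqI) auto
  with assms show ?case by (intro exI[of _ "{0}"]) fastforce
next
  case (Suc K)
  then obtain F where F: "finite F" "\<And>x. x \<in> F \<Longrightarrow> norm x \<le> \<rho>" "\<And>x n. x \<in> F \<Longrightarrow> K \<le> n \<Longrightarrow> coord x n = 0"
    "\<And>c. norm c \<le> \<rho> \<Longrightarrow> (\<forall>n\<ge>K. coord c n = 0) \<Longrightarrow> \<exists>x\<in>F. norm (c - x) \<le> \<eta>"
    by metis
  have "seq_compact (cball (0::complex) \<rho>)"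
    using compact_cball compact_eq_seq_compact_metric by blast
  from seq_compact_imp_totally_bounded[OF this, rule_format, OF \<open>0 < \<eta>\<close>]
  obtain D where D: "finite D" "D \<subseteq> cball (0::complex) \<rho>" "cball 0 \<rho> \<subseteq> (\<Union>x\<in>D. ball x \<eta>)"
    by blast
  define G where "G = (\<lambda>(x, d). x + c0_scaleC d (unit_c0 K)) ` (F \<times> D)"
  have "finite G" unfolding G_def using F D by simp
  moreover have "norm x \<le> \<rho> \<and> (\<forall>n\<ge>Suc K. coord x n = 0)" if xG: "x \<in> G" for x
  proof -
    obtain y d where x: "x = y + c0_scaleC d (unit_c0 K)" "y \<in> F" "d \<in> D"
      using xG by (auto simp: G_def)
    have "norm (c0_scaleC d (unit_c0 K)) \<le> \<rho>"
      using D(2) x(3) \<open>0 \<le> \<rho>\<close> by (intro c0_norm_le) auto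
    then have "norm x \<le> \<rho>"
      unfolding x(1) using F(2,3)[OF x(2)] by (intro norm_add_disjoint_le) auto
    then show ?thesis using F(3)[OF x(2)] by (simp add: x(1))
  qed
  moreover have "\<exists>x\<in>G. norm (c - x) \<le> \<eta>" if c: "norm c \<le> \<rho>" "\<forall>n\<ge>Suc K. coord c n = 0" for c
  proof -
    obtain x where x: "x \<in> F" "norm (trunc K (coord c) - x) \<le> \<eta>"
      using F(4)[of "trunc K (coord c)"] norm_trunc_coord_le[of K c] c(1) by auto
    have "coord c K \<in> cball 0 \<rho>"
      using coord_le_norm[of c K] c(1) by simp
    with D(3) obtain d where d: "d \<in> D" "cmod (coord c K - d) < \<eta>"
      by (auto simp: dist_norm norm_minus_commute)
    have "norm (c - (x + c0_scaleC d (unit_c0 K))) \<le> \<eta>"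
    proof (rule c0_norm_le)
      fix n
      consider "n < K" | "n = K" | "Suc K \<le> n" by linarith
      then show "cmod (coord (c - (x + c0_scaleC d (unit_c0 K))) n) \<le> \<eta>"
      proof cases
        case 1
        then show ?thesis
          using order.trans[OF coord_le_norm[of "trunc K (coord c) - x" n] x(2)] by simp
      qed (use d F(3)[OF x(1)] c(2) \<open>0 < \<eta>\<close> in auto)
    qed
    then show ?thesis
      using x d by (auto simp: G_def)
  qed
  ultimately show ?case by blast
qed

text \<open>The index from \<open>tail_continuity\<close> depends on the head. A finite net of heads
  leaves finitely many indices, and uniform continuity carries the estimate from the net to every
  head.\<close>

lemma tail_continuity_uniform:
  assumes f: "f \<in> Au_c0" and \<rho>: "0 < \<rho>" "\<rho> < 1" and \<delta>: "0 < \<delta>"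
  shows "\<exists>L\<ge>K. \<forall>c z. norm c \<le> \<rho> \<longrightarrow> (\<forall>n\<ge>K. coord c n = 0) \<longrightarrow> (\<forall>n<L. coord z n = 0) \<longrightarrow>
    norm z \<le> \<rho>\<^sup>2 \<longrightarrow> cmod (f (c + z) - f c) \<le> \<delta>"
proof -
  have \<rho>2: "\<rho>\<^sup>2 \<le> \<rho>" using \<rho> by (simp add: power2_eq_square mult_left_le)
  have "0 < \<delta> / 3" using \<delta> by simp
  obtain d where d: "0 < d"
    "\<And>x y. norm x < 1 \<Longrightarrow> norm y < 1 \<Longrightarrow> norm (x - y) < d \<Longrightarrow> cmod (f x - f y) < \<delta> / 3"
    using Au_c0_uniformly_continuousD[OF f \<open>0 < \<delta> / 3\<close>] by metis
  obtain F where F: "finite F" "\<And>x. x \<in> F \<Longrightarrow> norm x \<le> \<rho>" "\<And>x n. x \<in> F \<Longrightarrow> K \<le> n \<Longrightarrow> coord x n = 0"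
    "\<And>c. norm c \<le> \<rho> \<Longrightarrow> (\<forall>n\<ge>K. coord c n = 0) \<Longrightarrow> \<exists>x\<in>F. norm (c - x) \<le> d / 2"
    using finite_net_c0[of \<rho> "d / 2" K] \<rho> d(1) by auto
  have "\<forall>x\<in>F. \<exists>L. \<forall>z. (\<forall>n<L. coord z n = 0) \<longrightarrow> norm z \<le> \<rho>\<^sup>2 \<longrightarrow> cmod (f (x + z) - f x) \<le> \<delta> / 3"
    using tail_continuity[OF f \<rho> \<open>0 < \<delta> / 3\<close>] F(2,3) by blast
  then obtain l where l: "\<And>x z. x \<in> F \<Longrightarrow> (\<forall>n<l x. coord z n = 0) \<Longrightarrow> norm z \<le> \<rho>\<^sup>2 \<Longrightarrow> cmod (f (x + z) - f x) \<le> \<delta> / 3"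
    by metis
  define L where "L = Max (insert K (l ` F))"
  have Ll: "l x \<le> L" if "x \<in> F" for x
    using F(1) that by (auto simp: L_def intro!: Max_ge)
  have LK: "K \<le> L" using F(1) by (auto simp: L_def intro!: Max_ge)
  have "cmod (f (c + z) - f c) \<le> \<delta>"
    if c: "norm c \<le> \<rho>" "\<forall>n\<ge>K. coord c n = 0" and z: "\<forall>n<L. coord z n = 0" "norm z \<le> \<rho>\<^sup>2" for c z
  proof -
    obtain x where x: "x \<in> F" "norm (c - x) \<le> d / 2"
      using F(4) c by blast
    have xz: "norm (u + z) < 1" if "norm u \<le> \<rho>" "\<forall>n\<ge>K. coord u n = 0" for u
    proof -
      have "norm (u + z) \<le> \<rho>"
        using that z \<rho>2 LK by (intro norm_add_disjoint_le) (auto, meson le_trans not_less)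
      with \<rho> show ?thesis by simp
    qed
    have "cmod (f (c + z) - f (x + z)) < \<delta> / 3"
      using c F(2,3) x d(1) by (intro d(2) xz) auto
    moreover have "cmod (f (x + z) - f x) \<le> \<delta> / 3"
      using x Ll[OF x(1)] z by (intro l) auto
    moreover have "cmod (f x - f c) < \<delta> / 3"
      using c F(2)[OF x(1)] x d(1) \<rho> by (intro d(2)) (auto simp: norm_minus_commute)
    moreover have "cmod (f (c + z) - f c) = cmod ((f (c + z) - f (x + z)) + (f (x + z) - f x) + (f x - f c))"
      by simp
    ultimately show ?thesis
      using norm_triangle_ineq[of "(f (c + z) - f (x + z)) + (f (x + z) - f x)" "f x - f c"]
        norm_triangle_ineq[of "f (c + z) - f (x + z)" "f (x + z) - f x"] by linarith
  qed
  with LK show ?thesis by blast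
qed


text \<open>One step of the induction gains a factor \<open>\<rho>\<close>: the truncation error, as a function of a
  scalar in front of the coordinates of \<open>x\<close> in \<open>[K, L)\<close>, nearly vanishes at \<open>0\<close> because what is then
  left of \<open>x\<close> is far out, so Schwarz's lemma applies.\<close>

lemma trunc_approx_geometric:
  assumes f: "f \<in> Au_c0" and \<rho>: "0 < \<rho>" "\<rho> < 1" and \<delta>: "0 < \<delta>"
    and M: "\<And>x. norm x < 1 \<Longrightarrow> cmod (f x) \<le> M"
  shows "\<exists>N\<ge>K. \<forall>c x. norm c \<le> \<rho> \<longrightarrow> (\<forall>n\<ge>K. coord c n = 0) \<longrightarrow> (\<forall>n<K. coord x n = 0) \<longrightarrow>
    norm x \<le> \<rho>\<^sup>2 \<longrightarrow> cmod (f (c + x) - f (c + trunc N (coord x))) \<le> 2 * M * \<rho> ^ h + 4 * \<delta> / (1 - \<rho>)"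
proof (induction h arbitrary: K)
  case 0
  have \<rho>2: "\<rho>\<^sup>2 \<le> \<rho>" using \<rho> by (simp add: power2_eq_square mult_left_le)
  have "cmod (f (c + x) - f (c + trunc K (coord x))) \<le> 2 * M * \<rho> ^ 0 + 4 * \<delta> / (1 - \<rho>)"
    if "norm c \<le> \<rho>" "\<forall>n\<ge>K. coord c n = 0" "\<forall>n<K. coord x n = 0" "norm x \<le> \<rho>\<^sup>2" for c x
  proof -
    have b: "norm (c + u) < 1" if "\<forall>n<K. coord u n = 0" "norm u \<le> \<rho>\<^sup>2" for u
    proof -
      have "norm (c + u) \<le> \<rho>"
        using that \<open>norm c \<le> \<rho>\<close> \<open>\<forall>n\<ge>K. coord c n = 0\<close> \<rho>2
        by (intro norm_add_disjoint_le) (auto, meson not_less)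
      with \<rho> show ?thesis by simp
    qed
    have "cmod (f (c + x)) \<le> M" "cmod (f (c + trunc K (coord x))) \<le> M"
      using that norm_trunc_coord_le[of K x] by (auto intro!: M b)
    moreover have "0 \<le> 4 * \<delta> / (1 - \<rho>)" using \<rho> \<delta> by simp
    ultimately show ?thesis
      using norm_triangle_ineq4[of "f (c + x)" "f (c + trunc K (coord x))"]
      unfolding power_0 mult_1_right by linarith
  qed
  then show ?case by blast
next
  case (Suc h)
  \<comment> \<open>The term \<open>4 * \<delta> / (1 - \<rho>)\<close> is the fixed point of the
    recursion sending \<open>A\<close> to \<open>\<rho> * A + 4 * \<delta>\<close>, which one
    Schwarz step produces; only the other term shrinks with \<open>h\<close>.\<close>
  define A where "A = 2 * M * \<rho> ^ h + 4 * \<delta> / (1 - \<rho>)"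
  have \<rho>2: "\<rho>\<^sup>2 \<le> \<rho>" using \<rho> by (simp add: power2_eq_square mult_left_le)
  obtain L where LK: "K \<le> L" and L: "\<And>c z. norm c \<le> \<rho> \<Longrightarrow> (\<forall>n\<ge>K. coord c n = 0) \<Longrightarrow>
      (\<forall>n<L. coord z n = 0) \<Longrightarrow> norm z \<le> \<rho>\<^sup>2 \<Longrightarrow> cmod (f (c + z) - f c) \<le> \<delta>"
    using tail_continuity_uniform[OF f \<rho> \<delta>, of K] by metis
  \<comment> \<open>The hypothesis is used at \<open>L\<close>, because the head \<open>c' s\<close>
    introduced below also contains the block from \<open>K\<close> to \<open>L\<close>.\<close>
  obtain N where NL: "L \<le> N" and N: "\<And>c x. norm c \<le> \<rho> \<Longrightarrow> (\<forall>n\<ge>L. coord c n = 0) \<Longrightarrow>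
      (\<forall>n<L. coord x n = 0) \<Longrightarrow> norm x \<le> \<rho>\<^sup>2 \<Longrightarrow> cmod (f (c + x) - f (c + trunc N (coord x))) \<le> A"
    using Suc.IH[of L] unfolding A_def by metis
  have "cmod (f (c + x) - f (c + trunc N (coord x))) \<le> 2 * M * \<rho> ^ Suc h + 4 * \<delta> / (1 - \<rho>)"
    if c: "norm c \<le> \<rho>" "\<forall>n\<ge>K. coord c n = 0" and x: "\<forall>n<K. coord x n = 0" "norm x \<le> \<rho>\<^sup>2" for c x
  proof -
    define x1 where "x1 = trunc L (coord x)"
    define x2 where "x2 = x - x1"
    define y2 where "y2 = trunc N (coord x2)"
    have x1: "norm x1 \<le> \<rho>\<^sup>2" "n < K \<or> L \<le> n \<Longrightarrow> coord x1 n = 0" for n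
      using x norm_trunc_coord_le[of L x] by (auto simp: x1_def)
    have "norm x2 \<le> norm x"
      unfolding x2_def x1_def by (rule c0_norm_le) (auto simp: coord_le_norm)
    with x have x2: "norm x2 \<le> \<rho>\<^sup>2" "n < L \<Longrightarrow> coord x2 n = 0" for n
      by (auto simp: x2_def x1_def)
    have y2: "norm y2 \<le> \<rho>\<^sup>2" "n < L \<Longrightarrow> coord y2 n = 0" for n
      using x2 norm_trunc_coord_le[of N x2] by (auto simp: y2_def)
    \<comment> \<open>Since the block has norm at most \<open>\<rho>\<^sup>2\<close>, the parameter
      may have modulus up to \<open>1 / \<rho>\<close>. The original point is the value at 1, which
      has relative radius \<open>\<rho>\<close> in that disc.\<close>
    define c' where "c' s = c + c0_scaleC s x1" for s
    have c': "norm (c' s) \<le> \<rho>" if "cmod s < 1 / \<rho>" for s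
    proof -
      have "norm (c0_scaleC s x1) \<le> 1 / \<rho> * \<rho>\<^sup>2"
        using norm_c0_scaleC_le[of s x1] mult_mono[of "cmod s" "1 / \<rho>" "norm x1" "\<rho>\<^sup>2"] that x1(1) \<rho> by simp
      then have "norm (c0_scaleC s x1) \<le> \<rho>" using \<rho> by (simp add: power2_eq_square)
      then show ?thesis
        unfolding c'_def using c x1(2) by (intro norm_add_disjoint_le) (auto, meson not_less)
    qed
    have c'supp: "\<forall>n\<ge>L. coord (c' s) n = 0" for s
      using c x1(2) LK by (auto simp: c'_def)
    have lt1: "norm (c' s + u) < 1"
      if "cmod s < 1 / \<rho>" "norm u \<le> \<rho>\<^sup>2" "\<And>n. n < L \<Longrightarrow> coord u n = 0" for s u
    proof -
      have "norm (c' s + u) \<le> \<rho>"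
        using c'[OF that(1)] c'supp that \<rho>2 by (intro norm_add_disjoint_le) (auto, meson not_less)
      with \<rho> show ?thesis by simp
    qed
    define e where "e s = f (c' s + x2) - f (c' s + y2)" for s
    have comm: "c' s + u = c + u + c0_scaleC s x1" for s u
      by (simp add: c'_def add.commute add.left_commute)
    have e_hol: "e holomorphic_on ball 0 (1 / \<rho>)"
      unfolding e_def comm
      by (intro holomorphic_on_diff Au_c0_slice_holomorphic[OF f])
        (use lt1[OF _ x2] lt1[OF _ y2] in \<open>auto simp: comm\<close>)
    have "cmod (e s) \<le> A" if "cmod s < 1 / \<rho>" for s
      unfolding e_def y2_def using c'[OF that] c'supp x2 by (intro N) auto
    \<comment> \<open>With the block switched off, both tails start at \<open>L\<close>, and each of
      them moves \<open>f\<close> by at most \<open>\<delta>\<close>.\<close>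
    moreover have "cmod (e 0) \<le> 2 * \<delta>"
    proof -
      have c'0: "c' 0 = c" by (intro c0_eqI) (simp add: c'_def)
      have "cmod (f (c + x2) - f c) \<le> \<delta>" "cmod (f (c + y2) - f c) \<le> \<delta>"
        using c x2 y2 by (auto intro!: L)
      then show ?thesis
        using norm_triangle_ineq4[of "f (c + x2) - f c" "f (c + y2) - f c"] by (simp add: e_def c'0)
    qed
    ultimately have "cmod (e 1) \<le> \<rho> * A + 2 * (2 * \<delta>)"
      by (intro approx_Schwarz[OF e_hol \<rho>])
    also have "\<rho> * A + 2 * (2 * \<delta>) = 2 * M * \<rho> ^ Suc h + 4 * \<delta> / (1 - \<rho>)"
      using \<rho> by (simp add: A_def field_simps)
    finally have "cmod (e 1) \<le> 2 * M * \<rho> ^ Suc h + 4 * \<delta> / (1 - \<rho>)" .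
    moreover have "c' 1 + x2 = c + x" "c' 1 + y2 = c + trunc N (coord x)"
      using NL by (auto intro!: c0_eqI simp: c'_def x2_def y2_def x1_def)
    ultimately show ?thesis by (simp add: e_def)
  qed
  then show ?case
    using LK NL order.trans by blast
qed

lemma Au_c0_trunc_uniform:
  assumes f: "f \<in> Au_c0" and \<epsilon>: "0 < \<epsilon>"
  shows "\<exists>N. \<forall>n\<ge>N. \<forall>x. norm x < 1 \<longrightarrow> cmod (f x - f (trunc n (coord x))) \<le> \<epsilon>"
proof -
  have "0 < \<epsilon> / 4" using \<epsilon> by simp
  from Au_c0_uniformly_continuousD[OF f this] obtain d where d: "0 < d"
    "\<And>x y. norm x < 1 \<Longrightarrow> norm y < 1 \<Longrightarrow> norm (x - y) < d \<Longrightarrow> cmod (f x - f y) < \<epsilon> / 4"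
    by metis
  \<comment> \<open>Chosen so that shrinking by \<open>\<rho>\<^sup>2\<close> moves points of the
    ball by less than \<open>d\<close>; the geometric estimate is available only at norm up to
    \<open>\<rho>\<^sup>2\<close>.\<close>
  define \<rho> where "\<rho> = 1 - min d 1 / 4"
  have \<rho>: "0 < \<rho>" "\<rho> < 1" using d(1) by (auto simp: \<rho>_def)
  have \<rho>d: "1 - \<rho>\<^sup>2 < d"
  proof -
    have "1 - \<rho>\<^sup>2 = (1 - \<rho>) * (1 + \<rho>)" by (simp add: power2_eq_square algebra_simps)
    also have "\<dots> \<le> (1 - \<rho>) * 2" using \<rho> by (intro mult_left_mono) auto
    also have "\<dots> < d" using d(1) by (simp add: \<rho>_def)
    finally show ?thesis .
  qed
  have \<rho>2: "0 \<le> \<rho>\<^sup>2" "\<rho>\<^sup>2 \<le> 1" using \<rho> by (auto simp: power_le_one)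
  obtain M where M: "0 < M" "\<And>x. norm x < 1 \<Longrightarrow> cmod (f x) \<le> M"
    using Au_c0_bounded[OF f] by blast
  define \<delta> where "\<delta> = \<epsilon> * (1 - \<rho>) / 32"
  have \<delta>: "0 < \<delta>" using \<epsilon> \<rho> by (simp add: \<delta>_def)
  have "(\<lambda>h. 2 * M * \<rho> ^ h) \<longlonglongrightarrow> 2 * M * 0"
    using \<rho> by (intro tendsto_intros LIMSEQ_power_zero) auto
  then have "\<forall>\<^sub>F h in sequentially. 2 * M * \<rho> ^ h < \<epsilon> / 8"
    using \<epsilon> by (intro order_tendstoD) auto
  then obtain h where h: "2 * M * \<rho> ^ h < \<epsilon> / 8"
    by (auto simp: eventually_at_top_linorder)
  have "4 * \<delta> / (1 - \<rho>) = \<epsilon> / 8"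
    using \<rho> unfolding \<delta>_def by (simp add: divide_eq_eq right_diff_distrib)
  with h have bound: "2 * M * \<rho> ^ h + 4 * \<delta> / (1 - \<rho>) \<le> \<epsilon> / 4" by linarith
  obtain N where N: "\<And>c x. norm c \<le> \<rho> \<Longrightarrow> (\<forall>n\<ge>0. coord c n = 0) \<Longrightarrow> (\<forall>n<0. coord x n = 0) \<Longrightarrow>
      norm x \<le> \<rho>\<^sup>2 \<Longrightarrow> cmod (f (c + x) - f (c + trunc N (coord x))) \<le> 2 * M * \<rho> ^ h + 4 * \<delta> / (1 - \<rho>)"
    using trunc_approx_geometric[OF f \<rho> \<delta> M(2), of 0 h] by blast
  have N': "cmod (f x - f (trunc N (coord x))) \<le> \<epsilon> / 4" if "norm x \<le> \<rho>\<^sup>2" for x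
    using order.trans[OF N[of 0 x] bound] that \<rho> by simp
  have "cmod (f x - f (trunc n (coord x))) \<le> \<epsilon>" if n: "N \<le> n" and x: "norm x < 1" for n x
  proof -
    define s where "s = \<rho>\<^sup>2"
    have shrink: "norm (s *\<^sub>R u) \<le> s" "cmod (f u - f (s *\<^sub>R u)) < \<epsilon> / 4" if u: "norm u < 1" for u
    proof -
      show 1: "norm (s *\<^sub>R u) \<le> s"
        using u \<rho>2 by (simp add: s_def mult_left_le)
      have "norm (s *\<^sub>R u) < 1"
        using u \<rho>2 mult_left_le_one_le[of "norm u" "\<rho>\<^sup>2"] by (simp add: s_def)
      moreover have "norm (u - s *\<^sub>R u) < d"
      proof -
        have "u - s *\<^sub>R u = (1 - s) *\<^sub>R u" by (simp add: scaleR_left_diff_distrib)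
        then have "norm (u - s *\<^sub>R u) = (1 - s) * norm u" using \<rho>2 by (simp add: s_def)
        also have "\<dots> \<le> 1 - s" using u \<rho>2 by (intro mult_left_le) (auto simp: s_def)
        finally show ?thesis using \<rho>d by (simp add: s_def)
      qed
      ultimately show "cmod (f u - f (s *\<^sub>R u)) < \<epsilon> / 4"
        using u by (intro d(2))
    qed
    define y where "y = trunc n (coord x)"
    have y: "norm y < 1" using norm_trunc_coord_le[of n x] x by (simp add: y_def)
    \<comment> \<open>For \<open>n\<close> at least \<open>N\<close>, the points \<open>x\<close>
      and \<open>y\<close> have the same truncation at \<open>N\<close>. Comparing both shrunk
      points with this common point makes one \<open>N\<close> serve all later
      \<open>n\<close>.\<close>
    have "trunc N (coord (s *\<^sub>R y)) = trunc N (coord (s *\<^sub>R x))"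
      using n by (intro c0_eqI) (auto simp: y_def)
    moreover have "cmod (f (s *\<^sub>R x) - f (trunc N (coord (s *\<^sub>R x)))) \<le> \<epsilon> / 4"
      "cmod (f (s *\<^sub>R y) - f (trunc N (coord (s *\<^sub>R y)))) \<le> \<epsilon> / 4"
      using N' shrink(1) x y by (simp_all add: s_def)
    moreover note shrink(2)[OF x] shrink(2)[OF y]
    ultimately show ?thesis
      using norm_triangle_ineq4[of "f x - f (s *\<^sub>R x)" "f y - f (s *\<^sub>R y)"]
        norm_triangle_ineq4[of "f (s *\<^sub>R x) - f (trunc N (coord (s *\<^sub>R x)))"
          "f (s *\<^sub>R y) - f (trunc N (coord (s *\<^sub>R x)))"]
        norm_triangle_ineq[of "(f x - f (s *\<^sub>R x)) - (f y - f (s *\<^sub>R y))" "f (s *\<^sub>R x) - f (s *\<^sub>R y)"]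
      unfolding y_def[symmetric] by (simp add: algebra_simps)
  qed
  then show ?thesis by blast
qed

section \<open>The weak-star extension\<close>

text \<open>For \<open>a\<close> bounded by 1 these points of the open ball converge weak-star to
  \<open>a\<close>: truncation gives a null sequence, and the factor, which is 0 for
  \<open>k = 0\<close>, moves coordinates of modulus 1 inside.\<close>

definition inner_pt :: "nat \<Rightarrow> (nat \<Rightarrow> complex) \<Rightarrow> c0" where
  "inner_pt k a = trunc k (\<lambda>n. of_real (1 - 1 / real (Suc k)) * a n)"

lemma coord_inner_pt [simp]:
  "coord (inner_pt k a) n = (if n < k then of_real (1 - 1 / real (Suc k)) * a n else 0)"
  by (simp add: inner_pt_def)

lemma shrink_factor: "0 \<le> 1 - 1 / real (Suc k)" "1 - 1 / real (Suc k) < 1"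
  by simp_all

lemma cmod_of_shrink_factor: "cmod (of_real (1 - 1 / real (Suc k))) = 1 - 1 / real (Suc k)"
  by (simp only: norm_of_real abs_of_nonneg[OF shrink_factor(1)])

lemma norm_inner_pt:
  assumes "\<And>n. cmod (a n) \<le> 1"
  shows "norm (inner_pt k a) < 1"
proof -
  have "norm (inner_pt k a) \<le> 1 - 1 / real (Suc k)"
    unfolding inner_pt_def
    by (intro norm_trunc_le)
      (use assms in \<open>simp_all only: norm_mult cmod_of_shrink_factor shrink_factor mult_left_le\<close>)
  then show ?thesis using shrink_factor(2) le_less_trans by blast
qed

lemma linf_cball_iff: "z \<in> cball 0 1 \<longleftrightarrow> (\<forall>n. cmod (apply_bcontfun z n) \<le> 1)" for z :: linf
proof
  assume z: "z \<in> cball 0 1"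
  then show "\<forall>n. cmod (apply_bcontfun z n) \<le> 1"
    using order.trans[OF norm_bounded] by auto
next
  assume "\<forall>n. cmod (apply_bcontfun z n) \<le> 1"
  then have "norm z \<le> 1" by (intro norm_bound) auto
  then show "z \<in> cball 0 1" by simp
qed

text \<open>After truncation at a fixed \<open>N\<close> the two points are multiples of one vector
  with nearly equal factors. The index does not depend on \<open>a\<close>, which later yields
  weak-star continuity of the limit.\<close>

lemma inner_pt_Cauchy:
  assumes f: "f \<in> Au_c0" and \<epsilon>: "0 < \<epsilon>"
  shows "\<exists>N. \<forall>j\<ge>N. \<forall>k\<ge>N. \<forall>a. (\<forall>n. cmod (a n) \<le> 1) \<longrightarrow> cmod (f (inner_pt j a) - f (inner_pt k a)) \<le> \<epsilon>"
proof -
  have "0 < \<epsilon> / 3" using \<epsilon> by simp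
  obtain N where N: "\<And>x. norm x < 1 \<Longrightarrow> cmod (f x - f (trunc N (coord x))) \<le> \<epsilon> / 3"
    using Au_c0_trunc_uniform[OF f \<open>0 < \<epsilon> / 3\<close>] by blast
  obtain d where d: "0 < d"
    "\<And>x y. norm x < 1 \<Longrightarrow> norm y < 1 \<Longrightarrow> norm (x - y) < d \<Longrightarrow> cmod (f x - f y) < \<epsilon> / 3"
    using Au_c0_uniformly_continuousD[OF f \<open>0 < \<epsilon> / 3\<close>] by metis
  obtain N1 :: nat where N1: "2 / d < real N1" using reals_Archimedean2 by blast
  have small: "1 / real (Suc k) < d / 2" if "N1 \<le> k" for k
  proof -
    have "2 / d < real (Suc k)" using N1 that by linarith
    then show ?thesis using d(1) by (simp add: field_simps)
  qed
  have "cmod (f (inner_pt j a) - f (inner_pt k a)) \<le> \<epsilon>"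
    if jk: "max N N1 \<le> j" "max N N1 \<le> k" and a: "\<forall>n. cmod (a n) \<le> 1" for j k a
  proof -
    let ?x = "\<lambda>j. trunc N (coord (inner_pt j a))"
    have lt1: "norm (inner_pt i a) < 1" for i using norm_inner_pt a by blast
    then have xlt1: "norm (?x i) < 1" for i
      using norm_trunc_coord_le[of N "inner_pt i a"] le_less_trans by blast
    have "\<bar>1 / real (Suc j) - 1 / real (Suc k)\<bar> < d / 2"
    proof -
      have "0 < 1 / real (Suc j)" "0 < 1 / real (Suc k)" by simp_all
      then show ?thesis using small[of j] small[of k] jk by linarith
    qed
    moreover have "norm (?x j - ?x k) \<le> \<bar>1 / real (Suc j) - 1 / real (Suc k)\<bar>"
    proof (rule c0_norm_le)
      fix n
      have "of_real (1 - 1 / real (Suc j)) * a n - of_real (1 - 1 / real (Suc k)) * a n =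
          of_real (1 / real (Suc k) - 1 / real (Suc j)) * a n"
        by (simp add: algebra_simps)
      then have "cmod (of_real (1 - 1 / real (Suc j)) * a n - of_real (1 - 1 / real (Suc k)) * a n)
          = \<bar>1 / real (Suc k) - 1 / real (Suc j)\<bar> * cmod (a n)"
        by (simp only: norm_mult norm_of_real)
      also have "\<dots> \<le> \<bar>1 / real (Suc j) - 1 / real (Suc k)\<bar>"
        using a mult_left_le[of "cmod (a n)"] by (simp add: abs_minus_commute)
      finally show "cmod (coord (?x j - ?x k) n) \<le> \<bar>1 / real (Suc j) - 1 / real (Suc k)\<bar>"
        using jk by simp
    qed
    ultimately have "cmod (f (?x j) - f (?x k)) < \<epsilon> / 3"
      using d(1) by (intro d(2) xlt1) linarith
    moreover have "cmod (f (inner_pt j a) - f (?x j)) \<le> \<epsilon> / 3" "cmod (f (inner_pt k a) - f (?x k)) \<le> \<epsilon> / 3"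
      using N lt1 by blast+
    moreover have "cmod (f (inner_pt j a) - f (inner_pt k a)) =
        cmod (((f (inner_pt j a) - f (?x j)) - (f (inner_pt k a) - f (?x k))) + (f (?x j) - f (?x k)))"
      by simp
    ultimately show ?thesis
      using norm_triangle_ineq[of "(f (inner_pt j a) - f (?x j)) - (f (inner_pt k a) - f (?x k))" "f (?x j) - f (?x k)"]
        norm_triangle_ineq4[of "f (inner_pt j a) - f (?x j)" "f (inner_pt k a) - f (?x k)"] by linarith
  qed
  then show ?thesis by blast
qed

definition ext_lim :: "(c0 \<Rightarrow> complex) \<Rightarrow> linf \<Rightarrow> complex" where
  "ext_lim f z = lim (\<lambda>k. f (inner_pt k (apply_bcontfun z)))"

lemma ext_lim_tendsto:
  assumes f: "f \<in> Au_c0" and z: "z \<in> cball 0 1"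
  shows "(\<lambda>k. f (inner_pt k (apply_bcontfun z))) \<longlonglongrightarrow> ext_lim f z"
proof -
  have "Cauchy (\<lambda>k. f (inner_pt k (apply_bcontfun z)))"
  proof (rule metric_CauchyI)
    fix e :: real assume "0 < e"
    then have "0 < e / 2" by simp
    from inner_pt_Cauchy[OF f this] obtain N where
      N: "\<forall>j\<ge>N. \<forall>k\<ge>N. \<forall>a. (\<forall>n. cmod (a n) \<le> 1) \<longrightarrow> cmod (f (inner_pt j a) - f (inner_pt k a)) \<le> e / 2"
      by blast
    have "\<forall>n. cmod (apply_bcontfun z n) \<le> 1" using z linf_cball_iff by blast
    with N have *: "cmod (f (inner_pt m (apply_bcontfun z)) - f (inner_pt n (apply_bcontfun z))) \<le> e / 2"
      if "N \<le> m" "N \<le> n" for m n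
      using that by blast
    have "dist (f (inner_pt m (apply_bcontfun z))) (f (inner_pt n (apply_bcontfun z))) < e"
      if "N \<le> m" "N \<le> n" for m n
      unfolding dist_norm using *[OF that] \<open>0 < e\<close> by linarith
    then show "\<exists>M. \<forall>m\<ge>M. \<forall>n\<ge>M. dist (f (inner_pt m (apply_bcontfun z))) (f (inner_pt n (apply_bcontfun z))) < e"
      by blast
  qed
  then show ?thesis
    by (simp add: ext_lim_def Cauchy_convergent_iff convergent_LIMSEQ_iff)
qed

lemma ext_lim_uniform:
  assumes f: "f \<in> Au_c0" and \<epsilon>: "0 < \<epsilon>"
  shows "\<exists>k. \<forall>z\<in>cball 0 1. cmod (f (inner_pt k (apply_bcontfun z)) - ext_lim f z) \<le> \<epsilon>"
proof -
  obtain N where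
    N: "\<forall>j\<ge>N. \<forall>k\<ge>N. \<forall>a. (\<forall>n. cmod (a n) \<le> 1) \<longrightarrow> cmod (f (inner_pt j a) - f (inner_pt k a)) \<le> \<epsilon>"
    using inner_pt_Cauchy[OF f \<epsilon>] by blast
  have "cmod (f (inner_pt N (apply_bcontfun z)) - ext_lim f z) \<le> \<epsilon>" if z: "z \<in> cball 0 1" for z
  proof (rule LIMSEQ_le_const2)
    show "(\<lambda>k. cmod (f (inner_pt N (apply_bcontfun z)) - f (inner_pt k (apply_bcontfun z))))
        \<longlonglongrightarrow> cmod (f (inner_pt N (apply_bcontfun z)) - ext_lim f z)"
      by (intro tendsto_intros ext_lim_tendsto f z)
    show "\<exists>M. \<forall>k\<ge>M. cmod (f (inner_pt N (apply_bcontfun z)) - f (inner_pt k (apply_bcontfun z))) \<le> \<epsilon>"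
      using N z linf_cball_iff by blast
  qed
  then show ?thesis by blast
qed

lemma openin_weak_star_coord:
  assumes "open U"
  shows "openin weak_star_linf {z. apply_bcontfun z n \<in> U}"
proof -
  let ?a = "\<lambda>i. if i = n then 1 else 0 :: complex"
  have "(\<Sum>i. ?a i * apply_bcontfun z i) = apply_bcontfun z n" for z :: linf
    using sums_unique[OF sums_single[of n "apply_bcontfun z"]] by (simp add: if_distrib if_distribR cong: if_cong)
  moreover have "summable (\<lambda>i. cmod (?a i))"
    by (rule summable_finite[of "{n}"]) auto
  ultimately show ?thesis
    unfolding weak_star_linf_def using assms
    by (intro topology_generated_by_Basis) (auto intro!: exI[of _ ?a] exI[of _ U])
qed

lemma topspace_weak_star [simp]: "topspace weak_star_linf = UNIV"
  using openin_subset[OF openin_weak_star_coord[of UNIV 0]] by auto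

text \<open>Up to \<open>\<epsilon> / 4\<close>, uniformly on the closed ball,
  \<open>ext_lim f\<close> is a continuous function of the first \<open>k\<close> coordinates, and
  coordinates are weak-star continuous.\<close>

lemma ext_lim_continuous:
  assumes f: "f \<in> Au_c0"
  shows "continuous_map (subtopology weak_star_linf (cball 0 1)) euclidean (ext_lim f)"
  unfolding mtopology_is_euclidean[symmetric] Met_TC.continuous_map_to_metric
proof (intro ballI allI impI)
  fix z :: linf and \<epsilon> :: real
  assume "z \<in> topspace (subtopology weak_star_linf (cball 0 1))" and \<epsilon>: "0 < \<epsilon>"
  then have z: "z \<in> cball 0 1" by simp
  have "0 < \<epsilon> / 4" using \<epsilon> by simp
  obtain k where k: "\<And>z. z \<in> cball 0 1 \<Longrightarrow> cmod (f (inner_pt k (apply_bcontfun z)) - ext_lim f z) \<le> \<epsilon> / 4"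
    using ext_lim_uniform[OF f \<open>0 < \<epsilon> / 4\<close>] by blast
  obtain d where d: "0 < d"
    "\<And>x y. norm x < 1 \<Longrightarrow> norm y < 1 \<Longrightarrow> norm (x - y) < d \<Longrightarrow> cmod (f x - f y) < \<epsilon> / 4"
    using Au_c0_uniformly_continuousD[OF f \<open>0 < \<epsilon> / 4\<close>] by metis
  \<comment> \<open>The range \<open>{..k}\<close> instead of \<open>{..<k}\<close> keeps the
    intersection over a nonempty set when \<open>k = 0\<close>.\<close>
  define V where "V = (\<Inter>n\<in>{..k}. {y. apply_bcontfun y n \<in> ball (apply_bcontfun z n) (d / 2)})"
  have V: "openin weak_star_linf V"
    unfolding V_def by (intro openin_INT2 openin_weak_star_coord) auto
  have "cmod (ext_lim f z - ext_lim f y) < \<epsilon>" if y: "y \<in> cball 0 1" "y \<in> V" for y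
  proof -
    have lt1: "norm (inner_pt k (apply_bcontfun z)) < 1" "norm (inner_pt k (apply_bcontfun y)) < 1"
      using norm_inner_pt linf_cball_iff z y(1) by blast+
    have "norm (inner_pt k (apply_bcontfun z) - inner_pt k (apply_bcontfun y)) \<le> d / 2"
    proof (rule c0_norm_le)
      fix n
      have "cmod (of_real (1 - 1 / real (Suc k)) * apply_bcontfun z n - of_real (1 - 1 / real (Suc k)) * apply_bcontfun y n) \<le> d / 2"
        if "n < k"
      proof -
        have "cmod (apply_bcontfun z n - apply_bcontfun y n) \<le> d / 2"
          using y(2) that by (auto simp: V_def dist_norm intro: less_imp_le)
        then have "(1 - 1 / real (Suc k)) * cmod (apply_bcontfun z n - apply_bcontfun y n) \<le> 1 * (d / 2)"
          using shrink_factor[of k] by (intro mult_mono) auto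
        then show ?thesis
          by (simp only: right_diff_distrib[symmetric] norm_mult cmod_of_shrink_factor mult_1)
      qed
      then show "cmod (coord (inner_pt k (apply_bcontfun z) - inner_pt k (apply_bcontfun y)) n) \<le> d / 2"
        using d(1) by simp
    qed
    then have "cmod (f (inner_pt k (apply_bcontfun z)) - f (inner_pt k (apply_bcontfun y))) < \<epsilon> / 4"
      using d(1) by (intro d(2) lt1) linarith
    moreover note k[OF z] k[OF y(1)]
    moreover have "cmod (ext_lim f z - ext_lim f y) = cmod ((f (inner_pt k (apply_bcontfun z)) - f (inner_pt k (apply_bcontfun y))) -
       ((f (inner_pt k (apply_bcontfun z)) - ext_lim f z) - (f (inner_pt k (apply_bcontfun y)) - ext_lim f y)))"
      by simp
    ultimately show ?thesis
      using norm_triangle_ineq4[of "f (inner_pt k (apply_bcontfun z)) - f (inner_pt k (apply_bcontfun y))"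
          "(f (inner_pt k (apply_bcontfun z)) - ext_lim f z) - (f (inner_pt k (apply_bcontfun y)) - ext_lim f y)"]
        norm_triangle_ineq4[of "f (inner_pt k (apply_bcontfun z)) - ext_lim f z"
          "f (inner_pt k (apply_bcontfun y)) - ext_lim f y"] \<epsilon> by linarith
  qed
  moreover have "z \<in> V" using d(1) by (simp add: V_def)
  ultimately show "\<exists>U. openin (subtopology weak_star_linf (cball 0 1)) U \<and> z \<in> U \<and>
      (\<forall>y\<in>U. ext_lim f y \<in> Met_TC.mball (ext_lim f z) \<epsilon>)"
    using V z by (intro exI[of _ "V \<inter> cball 0 1"])
      (auto simp: openin_subtopology Met_TC.mball_def dist_norm)
qed

lemma inner_pt_tendsto: "(\<lambda>k. inner_pt k (coord x)) \<longlonglongrightarrow> x"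
proof -
  have "(\<lambda>k. (1 - 1 / real (Suc k)) *\<^sub>R trunc k (coord x)) \<longlonglongrightarrow> (1 - 0) *\<^sub>R x"
    by (intro tendsto_intros trunc_tendsto LIMSEQ_Suc[OF lim_1_over_n])
  moreover have "(1 - 1 / real (Suc k)) *\<^sub>R trunc k (coord x) = inner_pt k (coord x)" for k
    by (rule c0_eqI) (simp add: scaleR_conv_of_real)
  ultimately show ?thesis by simp
qed

lemma ext_lim_c0:
  assumes f: "f \<in> Au_c0" and x: "norm x < 1"
  shows "ext_lim f (linf_of_c0 x) = f x"
proof -
  have "continuous_on (ball 0 1) f"
    using f by (simp add: Au_c0_def uniformly_continuous_imp_continuous)
  then have "isCont f x"
    using x by (simp add: continuous_on_eq_continuous_at)
  then have "(\<lambda>k. f (inner_pt k (coord x))) \<longlonglongrightarrow> f x"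
    using inner_pt_tendsto isCont_tendsto_compose by blast
  then show ?thesis
    by (simp add: ext_lim_def limI)
qed

text \<open>Gives the weak-star density of the ball of \<open>c0\<close>. Holding eventually, the
  property passes to finite intersections, so the work lies in subbasic sets, where the series
  converge with the summable majorant \<open>cmod (a n)\<close>.\<close>

lemma inner_pt_weak_star:
  assumes "openin weak_star_linf U" "z \<in> U" "z \<in> cball 0 1"
  shows "\<forall>\<^sub>F k in sequentially. linf_of_c0 (inner_pt k (apply_bcontfun z)) \<in> U"
proof -
  have "generate_topology_on {{z. (\<Sum>n. a n * apply_bcontfun z n) \<in> U} | a U. summable (\<lambda>n. cmod (a n)) \<and> open U} U"
    using assms(1) unfolding weak_star_linf_def openin_topology_generated_by_iff .
  then show ?thesis
    using assms(2)
  proof (induction rule: generate_topology_on.induct)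
    case (Int a b)
    then show ?case by (simp add: eventually_conj)
  next
    case (UN K)
    then obtain k where "k \<in> K" "z \<in> k" by blast
    with UN.IH show ?case by (blast intro: eventually_mono)
  next
    case (Basis s)
    then obtain a U where s: "s = {z. (\<Sum>n. a n * apply_bcontfun z n) \<in> U}"
      and a: "summable (\<lambda>n. cmod (a n))" and U: "open U" by blast
    have le: "cmod (a n * coord (inner_pt k (apply_bcontfun z)) n) \<le> cmod (a n)" for k n
    proof -
      have "norm (inner_pt k (apply_bcontfun z)) < 1"
        using assms(3) linf_cball_iff norm_inner_pt by blast
      then have "cmod (coord (inner_pt k (apply_bcontfun z)) n) \<le> 1"
        using coord_le_norm[of "inner_pt k (apply_bcontfun z)" n] by linarith
      then show ?thesis by (simp only: norm_mult mult_left_le norm_ge_zero)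
    qed
    have lim: "(\<lambda>k. a n * coord (inner_pt k (apply_bcontfun z)) n) \<longlonglongrightarrow> a n * apply_bcontfun z n" for n
    proof -
      have "(\<lambda>k. a n * (of_real (1 - 1 / real (Suc k)) * apply_bcontfun z n)) \<longlonglongrightarrow> a n * (of_real (1 - 0) * apply_bcontfun z n)"
        by (intro tendsto_intros LIMSEQ_Suc[OF lim_1_over_n])
      moreover have "\<forall>\<^sub>F k in sequentially. a n * (of_real (1 - 1 / real (Suc k)) * apply_bcontfun z n) =
          a n * coord (inner_pt k (apply_bcontfun z)) n"
        using eventually_gt_at_top[of n] by eventually_elim simp
      ultimately have "(\<lambda>k. a n * coord (inner_pt k (apply_bcontfun z)) n) \<longlonglongrightarrow> a n * (of_real (1 - 0) * apply_bcontfun z n)"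
        by (rule Lim_transform_eventually)
      then show ?thesis by (simp only: diff_zero of_real_1 mult_1)
    qed
    have "\<forall>\<^sub>F (n, k) in at_top \<times>\<^sub>F sequentially. cmod (a n * coord (inner_pt k (apply_bcontfun z)) n) \<le> cmod (a n)"
      by (intro always_eventually) (use le in auto)
    from tannerys_theorem[OF lim this a sequentially_bot]
    have "(\<lambda>k. \<Sum>n. a n * coord (inner_pt k (apply_bcontfun z)) n) \<longlonglongrightarrow> (\<Sum>n. a n * apply_bcontfun z n)"
      by blast
    moreover have "(\<Sum>n. a n * apply_bcontfun z n) \<in> U" using Basis s by simp
    ultimately show ?case
      unfolding s mem_Collect_eq using U by (intro topological_tendstoD)
  qed simp
qed

text \<open>Shows that the definite description denotes: \<open>ext_lim f\<close> qualifies, and an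
  extension with another value at \<open>z\<close> would be separated from it on a weak-star
  neighbourhood of \<open>z\<close>, which contains points of the ball of \<open>c0\<close>.\<close>

lemma ext_c0_eq_ext_lim:
  assumes f: "f \<in> Au_c0" and z: "z \<in> cball 0 1"
  shows "ext_c0 f z = ext_lim f z"
proof -
  let ?X = "subtopology weak_star_linf (cball 0 1)"
  let ?P = "\<lambda>g. g \<in> extensional (cball 0 1) \<and> continuous_map ?X euclidean g \<and> (\<forall>x\<in>ball 0 1. g (linf_of_c0 x) = f x)"
  let ?g = "restrict (ext_lim f) (cball 0 1)"
  have in_cball: "linf_of_c0 x \<in> cball 0 1" if "norm x < 1" for x
    using that by (simp add: norm_c0.rep_eq)
  have "continuous_map ?X euclidean ?g"
    by (rule continuous_map_eq[OF ext_lim_continuous[OF f]]) simp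
  then have g: "?P ?g"
    using in_cball ext_lim_c0[OF f] by simp
  have "h = ?g" if h: "?P h" for h
  proof (rule extensionalityI)
    fix z :: linf assume z: "z \<in> cball 0 1"
    show "h z = ?g z"
    proof (rule ccontr)
      assume "h z \<noteq> ?g z"
      then have "\<exists>A B. open A \<and> open B \<and> h z \<in> A \<and> ?g z \<in> B \<and> A \<inter> B = {}"
        by (rule hausdorff)
      then obtain A B where AB: "open A" "open B" "h z \<in> A" "?g z \<in> B" "A \<inter> B = {}"
        by (elim exE conjE) (rule that)
      have "openin ?X {y \<in> topspace ?X. h y \<in> A}" "openin ?X {y \<in> topspace ?X. ?g y \<in> B}"
        using h g AB(1,2) by (auto simp: continuous_map_def)
      then have "openin ?X ({y \<in> topspace ?X. h y \<in> A} \<inter> {y \<in> topspace ?X. ?g y \<in> B})"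
        by (rule openin_Int)
      then obtain T where T: "openin weak_star_linf T"
        "{y \<in> topspace ?X. h y \<in> A} \<inter> {y \<in> topspace ?X. ?g y \<in> B} = T \<inter> cball 0 1"
        by (auto simp: openin_subtopology)
      have "z \<in> {y \<in> topspace ?X. h y \<in> A} \<inter> {y \<in> topspace ?X. ?g y \<in> B}" using z AB by simp
      then have "z \<in> T" using T(2) by blast
      obtain k where k: "linf_of_c0 (inner_pt k (apply_bcontfun z)) \<in> T"
        using eventually_happens'[OF sequentially_bot inner_pt_weak_star[OF T(1) \<open>z \<in> T\<close> z]] by (elim exE)
      have lt1: "norm (inner_pt k (apply_bcontfun z)) < 1"
        using z linf_cball_iff norm_inner_pt by blast
      then have "h (linf_of_c0 (inner_pt k (apply_bcontfun z))) \<in> A"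
        "?g (linf_of_c0 (inner_pt k (apply_bcontfun z))) \<in> B"
        using T(2)[unfolded set_eq_iff, rule_format, of "linf_of_c0 (inner_pt k (apply_bcontfun z))"]
          k in_cball[OF lt1] by simp_all
      moreover have "h (linf_of_c0 (inner_pt k (apply_bcontfun z))) = ?g (linf_of_c0 (inner_pt k (apply_bcontfun z)))"
        using h g lt1 by (metis mem_ball_0)
      ultimately show False using AB(5) by auto
    qed
  qed (use h g in auto)
  then have "ext_c0 f = ?g"
    unfolding ext_c0_def using g by (intro the_equality) blast+
  then show ?thesis using z by simp
qed

text \<open>The working form of evaluation: later facts about its values come from values at points
  of the open ball.\<close>

lemma delta_c0_tendsto:
  assumes "f \<in> Au_c0" "z \<in> cball 0 1"
  shows "(\<lambda>k. f (inner_pt k (apply_bcontfun z))) \<longlonglongrightarrow> delta_c0 z f"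
  using ext_lim_tendsto[OF assms] ext_c0_eq_ext_lim[OF assms] assms(1) by (simp add: delta_c0_def)

section \<open>Boundary values in the disc algebra\<close>

lemma ext_disc_continuous:
  assumes f: "f \<in> disc_algebra"
  shows "continuous_on (cball 0 1) (ext_disc f)" and "\<And>x. cmod x < 1 \<Longrightarrow> ext_disc f x = f x"
proof -
  let ?P = "\<lambda>g. g \<in> extensional (cball 0 1) \<and> continuous_on (cball 0 1) g \<and> (\<forall>x\<in>ball 0 1. g x = f x)"
  have "uniformly_continuous_on (ball 0 1) f"
    using f by (simp add: disc_algebra_def)
  then obtain g where g: "uniformly_continuous_on (cball 0 1) g" "\<And>x. x \<in> ball 0 1 \<Longrightarrow> f x = g x"
    "\<And>Y h x. ball 0 1 \<subseteq> Y \<Longrightarrow> Y \<subseteq> cball 0 1 \<Longrightarrow> continuous_on Y h \<Longrightarrow> (\<And>x. x \<in> ball 0 1 \<Longrightarrow> f x = h x) \<Longrightarrow> x \<in> Y \<Longrightarrow> h x = g x"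
    by (rule uniformly_continuous_on_extension_on_closure) auto
  have 1: "?P (restrict g (cball 0 1))"
    using g(2) continuous_on_eq[OF uniformly_continuous_imp_continuous[OF g(1)], of "restrict g (cball 0 1)"] by simp
  have "h = restrict g (cball 0 1)" if h: "?P h" for h
    by (rule extensionalityI[where A = "cball 0 1"])
      (use h g(3)[of "cball 0 1" h] in auto)
  then have "ext_disc f = restrict g (cball 0 1)"
    unfolding ext_disc_def using 1 by (intro the_equality) blast+
  with 1 show "continuous_on (cball 0 1) (ext_disc f)" "\<And>x. cmod x < 1 \<Longrightarrow> ext_disc f x = f x"
    by auto
qed

section \<open>Moebius maps and suprema over unit balls\<close>

text \<open>On the closed disc the denominator vanishes only for \<open>a = b\<close> on the circle;
  the quotient is then 0 / 0, with value 0.\<close>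

definition pdisc :: "complex \<Rightarrow> complex \<Rightarrow> real" where
  "pdisc a b = cmod ((a - b) / (1 - cnj a * b))"

lemma cmod_moebius_identity:
  "(cmod (1 - cnj a * b))\<^sup>2 - (cmod (a - b))\<^sup>2 = (1 - (cmod a)\<^sup>2) * (1 - (cmod b)\<^sup>2)"
  unfolding cmod_power2 by (simp add: power2_eq_square algebra_simps)

lemma cmod_moebius_le:
  assumes "cmod a \<le> 1" "cmod b \<le> 1"
  shows "cmod (a - b) \<le> cmod (1 - cnj a * b)"
proof -
  have "0 \<le> (1 - (cmod a)\<^sup>2) * (1 - (cmod b)\<^sup>2)"
    using assms by (simp add: power_le_one)
  then have "(cmod (a - b))\<^sup>2 \<le> (cmod (1 - cnj a * b))\<^sup>2"
    using cmod_moebius_identity[of a b] by linarith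
  then show ?thesis by (rule power2_le_imp_le) simp
qed

lemma pdisc_le_1: "cmod a \<le> 1 \<Longrightarrow> cmod b \<le> 1 \<Longrightarrow> pdisc a b \<le> 1"
  using cmod_moebius_le[of a b]
  by (cases "1 - cnj a * b = 0") (simp_all add: pdisc_def norm_divide divide_le_eq_1)

lemma pdisc_nonneg: "0 \<le> pdisc a b"
  by (simp add: pdisc_def)

text \<open>The right side of \<open>cmod_moebius_identity\<close> vanishes as soon as one of the
  points is on the circle.\<close>

lemma pdisc_boundary:
  assumes "cmod a \<le> 1" "cmod b \<le> 1" "a \<noteq> b" "cmod a = 1 \<or> cmod b = 1"
  shows "pdisc a b = 1"
proof -
  have "(cmod (1 - cnj a * b))\<^sup>2 = (cmod (a - b))\<^sup>2"
    using cmod_moebius_identity[of a b] assms(4) by auto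
  then have "cmod (1 - cnj a * b) = cmod (a - b)"
    by (metis norm_ge_zero power2_eq_imp_eq)
  then show ?thesis
    using assms(3) by (simp add: pdisc_def norm_divide)
qed

lemma moebius_denom_nz:
  assumes "cmod a < 1" "cmod b \<le> 1"
  shows "1 - cnj a * b \<noteq> 0"
proof
  assume "1 - cnj a * b = 0"
  then have "cmod (cnj a * b) = 1" by simp
  moreover have "cmod (cnj a * b) \<le> cmod a"
    using assms by (simp add: norm_mult mult_left_le)
  ultimately show False using assms by simp
qed

lemma cmod_Moebius_eq_pdisc: "cmod (Moebius_function 0 a b) = pdisc a b"
  by (simp add: Moebius_function_simple pdisc_def norm_divide norm_minus_commute)

lemma continuous_on_Moebius: "cmod a < 1 \<Longrightarrow> continuous_on (cball 0 1) (Moebius_function 0 a)"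
  unfolding Moebius_function_def
  by (intro continuous_intros) (use moebius_denom_nz in auto)

text \<open>Moebius maps carry \<open>a\<close> and \<open>z\<close> to 0. It remains to send the
  image of \<open>b\<close> to the image of \<open>w\<close>, which has no greater modulus:
  multiplication by \<open>c\<close> does this.\<close>

lemma Moebius_interpolation:
  assumes a: "cmod a < 1" and b: "cmod b < 1" and z: "cmod z < 1" and w: "cmod w < 1"
    and le: "pdisc z w \<le> pdisc a b"
  obtains \<phi> where "continuous_on (cball 0 1) \<phi>" "\<phi> holomorphic_on ball 0 1"
    "\<And>\<zeta>. cmod \<zeta> < 1 \<Longrightarrow> cmod (\<phi> \<zeta>) < 1" "\<phi> a = z" "\<phi> b = w"
proof (cases "a = b")
  case True
  then have "pdisc z w = 0" using le pdisc_nonneg[of z w] by (simp add: pdisc_def)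
  then have "z = w" using moebius_denom_nz[OF z, of w] w by (simp add: pdisc_def)
  with True z show thesis by (intro that[of "\<lambda>_. z"]) auto
next
  case False
  define c where "c = Moebius_function 0 z w / Moebius_function 0 a b"
  have ab: "Moebius_function 0 a b \<noteq> 0"
    using False moebius_denom_nz[OF a, of b] b by (simp add: Moebius_function_simple)
  have c: "cmod c \<le> 1"
    using le ab by (simp add: c_def norm_divide cmod_Moebius_eq_pdisc[symmetric])
  define \<phi> where "\<phi> \<zeta> = Moebius_function 0 (- z) (c * Moebius_function 0 a \<zeta>)" for \<zeta>
  have in_cball: "c * Moebius_function 0 a \<zeta> \<in> cball 0 1" if "cmod \<zeta> \<le> 1" for \<zeta>
    using c pdisc_le_1[of a \<zeta>] a that
    by (simp add: norm_mult cmod_Moebius_eq_pdisc mult_le_one pdisc_nonneg)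
  have in_ball: "c * Moebius_function 0 a \<zeta> \<in> ball 0 1" if "cmod \<zeta> < 1" for \<zeta>
    using c Moebius_function_norm_lt_1[OF a that, of 0] mult_left_le_one_le[of "cmod (Moebius_function 0 a \<zeta>)" "cmod c"]
    by (simp add: norm_mult)
  show thesis
  proof (rule that[of \<phi>])
    show "continuous_on (cball 0 1) \<phi>"
      unfolding \<phi>_def
    proof (rule continuous_on_compose2[OF continuous_on_Moebius])
      show "continuous_on (cball 0 1) (\<lambda>\<zeta>. c * Moebius_function 0 a \<zeta>)"
        by (intro continuous_on_mult continuous_on_const continuous_on_Moebius a)
    qed (use z in_cball in auto)
    have "(Moebius_function 0 (- z) \<circ> (\<lambda>\<zeta>. c * Moebius_function 0 a \<zeta>)) holomorphic_on ball 0 1"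
    proof (rule holomorphic_on_compose_gen[OF _ Moebius_function_holomorphic])
      show "(\<lambda>\<zeta>. c * Moebius_function 0 a \<zeta>) holomorphic_on ball 0 1"
        by (intro holomorphic_on_mult holomorphic_on_const Moebius_function_holomorphic a)
    qed (use z in_ball in auto)
    then show "\<phi> holomorphic_on ball 0 1"
      by (simp add: \<phi>_def[abs_def] comp_def)
    show "cmod (\<phi> \<zeta>) < 1" if "cmod \<zeta> < 1" for \<zeta>
      unfolding \<phi>_def using in_ball[OF that] z by (intro Moebius_function_norm_lt_1) auto
    show "\<phi> a = z"
      by (simp add: \<phi>_def Moebius_function_eq_zero Moebius_function_of_zero)
    have "\<phi> b = Moebius_function 0 (- z) (Moebius_function 0 z w)"
      using ab by (simp add: \<phi>_def c_def)
    then show "\<phi> b = w"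
      using Moebius_function_compose[of "- z" z w] z w by simp
  qed
qed

section \<open>Suprema over the unit balls of the two algebras\<close>

lemma sup_norm_le_iff:
  assumes "bdd_above ((\<lambda>x. cmod (f x)) ` X)" "X \<noteq> {}"
  shows "sup_norm X f \<le> B \<longleftrightarrow> (\<forall>x\<in>X. cmod (f x) \<le> B)"
  unfolding sup_norm_def using assms by (simp add: cSUP_le_iff)

lemma sup_norm_Au_c0_le_iff:
  assumes "f \<in> Au_c0"
  shows "sup_norm (ball 0 1) f \<le> B \<longleftrightarrow> (\<forall>x. norm x < 1 \<longrightarrow> cmod (f x) \<le> B)"
proof -
  obtain M where "\<And>x. norm x < 1 \<Longrightarrow> cmod (f x) \<le> M"
    using Au_c0_bounded[OF assms] by blast
  then have "bdd_above ((\<lambda>x. cmod (f x)) ` ball 0 1)"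
    by (auto intro!: bdd_aboveI2)
  then show ?thesis by (subst sup_norm_le_iff) auto
qed

lemma delta_disc_eq_ext: "f \<in> disc_algebra \<Longrightarrow> delta_disc l f = ext_disc f l"
  by (simp add: delta_disc_def)

lemma delta_disc_interior: "f \<in> disc_algebra \<Longrightarrow> cmod l < 1 \<Longrightarrow> delta_disc l f = f l"
  by (simp add: delta_disc_eq_ext ext_disc_continuous(2))

lemma continuous_on_delta_disc: "f \<in> disc_algebra \<Longrightarrow> continuous_on (cball 0 1) (\<lambda>l. delta_disc l f)"
  using ext_disc_continuous(1)[of f] by (simp add: delta_disc_eq_ext)

lemma disc_algebraI:
  assumes g: "continuous_on (cball 0 1) g" "g holomorphic_on ball 0 1"
  shows "restrict g (ball 0 1) \<in> disc_algebra"
    and "cmod l \<le> 1 \<Longrightarrow> delta_disc l (restrict g (ball 0 1)) = g l"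
proof -
  have "uniformly_continuous_on (ball 0 1) g"
    using compact_uniformly_continuous[OF g(1) compact_cball]
    unfolding uniformly_continuous_on_def by (meson ball_subset_cball subsetD)
  then have "uniformly_continuous_on (ball 0 1) (restrict g (ball 0 1))"
    by (simp add: uniformly_continuous_on_def)
  moreover have "restrict g (ball 0 1) holomorphic_on ball 0 1"
    by (rule holomorphic_transform[OF g(2)]) simp
  ultimately show 1: "restrict g (ball 0 1) \<in> disc_algebra"
    by (simp add: disc_algebra_def)
  define G where "G = ext_disc (restrict g (ball 0 1))"
  have "continuous_on (cball 0 1) G" "\<And>x. cmod x < 1 \<Longrightarrow> G x = g x"
    using ext_disc_continuous[OF 1] by (simp_all add: G_def)
  then have "cmod (g l - G l) \<le> 0" if "l \<in> closure (ball 0 1)"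
    by (intro continuous_on_closure_norm_le[OF _ _ that]) (auto intro!: continuous_intros g(1))
  then show "cmod l \<le> 1 \<Longrightarrow> delta_disc l (restrict g (ball 0 1)) = g l"
    by (simp add: delta_disc_eq_ext[OF 1] G_def)
qed

lemma disc_algebra_bounded:
  assumes "f \<in> disc_algebra"
  obtains M where "\<And>x. cmod x < 1 \<Longrightarrow> cmod (f x) \<le> M"
proof -
  have "bounded (ext_disc f ` cball 0 1)"
    using ext_disc_continuous(1)[OF assms] by (intro compact_imp_bounded compact_continuous_image) auto
  then obtain M where M: "\<forall>x\<in>cball 0 1. cmod (ext_disc f x) \<le> M"
    by (auto simp: bounded_iff)
  show thesis
  proof (rule that)
    fix x :: complex assume "cmod x < 1"
    with M ext_disc_continuous(2)[OF assms this] show "cmod (f x) \<le> M"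
      by (metis less_imp_le mem_cball_0)
  qed
qed

lemma sup_norm_disc_le_iff:
  assumes "f \<in> disc_algebra"
  shows "sup_norm (ball 0 1) f \<le> B \<longleftrightarrow> (\<forall>x. cmod x < 1 \<longrightarrow> cmod (f x) \<le> B)"
proof -
  obtain M where "\<And>x. cmod x < 1 \<Longrightarrow> cmod (f x) \<le> M"
    using disc_algebra_bounded[OF assms] by blast
  then have "bdd_above ((\<lambda>x. cmod (f x)) ` ball 0 1)"
    by (auto intro!: bdd_aboveI2)
  then show ?thesis by (subst sup_norm_le_iff) auto
qed

lemma cmod_delta_disc_le:
  assumes f: "f \<in> disc_algebra" and B: "\<And>x. cmod x < 1 \<Longrightarrow> cmod (f x) \<le> B" and l: "cmod l \<le> 1"
  shows "cmod (delta_disc l f) \<le> B"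
proof -
  have "l \<in> closure (ball 0 1)" using l by simp
  then show ?thesis
    using continuous_on_closure_norm_le[where s = "ball 0 1" and f = "\<lambda>l. delta_disc l f" and b = B and x = l]
      continuous_on_delta_disc[OF f] B delta_disc_interior[OF f] by simp
qed

lemma cmod_delta_c0_le:
  assumes f: "f \<in> Au_c0" and B: "\<And>x. norm x < 1 \<Longrightarrow> cmod (f x) \<le> B" and z: "z \<in> cball 0 1"
  shows "cmod (delta_c0 z f) \<le> B"
proof (rule LIMSEQ_le_const2)
  show "(\<lambda>k. cmod (f (inner_pt k (apply_bcontfun z)))) \<longlonglongrightarrow> cmod (delta_c0 z f)"
    by (intro tendsto_norm delta_c0_tendsto f z)
  show "\<exists>N. \<forall>n\<ge>N. cmod (f (inner_pt n (apply_bcontfun z))) \<le> B"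
    using B norm_inner_pt z linf_cball_iff by blast
qed

text \<open>The zero function makes the index sets of the suprema nonempty and shows that the
  pseudo-hyperbolic distance is nonnegative.\<close>

lemma zero_in_disc_algebra: "(\<lambda>x\<in>ball 0 1. 0) \<in> disc_algebra"
  and delta_disc_zero: "cmod l \<le> 1 \<Longrightarrow> delta_disc l (\<lambda>x\<in>ball 0 1. 0) = 0"
  using disc_algebraI[where g = "\<lambda>_. 0"] by auto

lemma zero_in_Au_c0: "(\<lambda>x\<in>ball 0 1. 0) \<in> Au_c0"
proof -
  have "holomorphic_c0 (\<lambda>x\<in>ball 0 1. 0) (ball 0 1)"
    unfolding holomorphic_c0_def
  proof (intro ballI exI conjI allI)
    fix x :: c0 assume "x \<in> ball 0 1"
    then show "((\<lambda>x\<in>ball 0 1. 0) has_derivative (\<lambda>_. 0::complex)) (at x)"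
      by (intro has_derivative_transform_within_open[OF has_derivative_const[of 0] open_ball, of x 0 1]) auto
  qed simp
  then show ?thesis
    by (simp add: Au_c0_def uniformly_continuous_on_def)
qed

lemma delta_c0_zero: "z \<in> cball 0 1 \<Longrightarrow> delta_c0 z (\<lambda>x\<in>ball 0 1. 0) = 0"
  using cmod_delta_c0_le[OF zero_in_Au_c0, of 0 z] by simp

lemma gleason_dist_disc_upper:
  assumes "f \<in> disc_algebra" "\<And>x. cmod x < 1 \<Longrightarrow> cmod (f x) \<le> 1" "cmod a \<le> 1" "cmod b \<le> 1"
  shows "cmod (delta_disc a f - delta_disc b f) \<le> gleason_dist_disc a b"
  unfolding gleason_dist_def
proof (rule cSUP_upper)
  show "f \<in> {f \<in> disc_algebra. sup_norm (ball 0 1) f \<le> 1}"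
    using assms by (simp add: sup_norm_disc_le_iff)
  show "bdd_above ((\<lambda>f. cmod (delta_disc a f - delta_disc b f)) ` {f \<in> disc_algebra. sup_norm (ball 0 1) f \<le> 1})"
  proof (rule bdd_aboveI2)
    fix f assume f: "f \<in> {f \<in> disc_algebra. sup_norm (ball 0 1) f \<le> 1}"
    then have "cmod (delta_disc a f) \<le> 1" "cmod (delta_disc b f) \<le> 1"
      using assms(3,4) by (auto intro!: cmod_delta_disc_le simp: sup_norm_disc_le_iff)
    then show "cmod (delta_disc a f - delta_disc b f) \<le> 2"
      using norm_triangle_ineq4[of "delta_disc a f" "delta_disc b f"] by linarith
  qed
qed

lemma gleason_dist_disc_least:
  assumes "\<And>f. f \<in> disc_algebra \<Longrightarrow> (\<And>x. cmod x < 1 \<Longrightarrow> cmod (f x) \<le> 1) \<Longrightarrow> cmod (delta_disc a f - delta_disc b f) \<le> B"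
  shows "gleason_dist_disc a b \<le> B"
  unfolding gleason_dist_def
proof (rule cSUP_least)
  have "sup_norm (ball 0 1) (\<lambda>x\<in>ball (0::complex) 1. 0) \<le> 1"
    by (subst sup_norm_disc_le_iff[OF zero_in_disc_algebra]) simp
  then show "{f \<in> disc_algebra. sup_norm (ball 0 1) f \<le> 1} \<noteq> {}"
    using zero_in_disc_algebra by blast
qed (use assms in \<open>auto simp: sup_norm_disc_le_iff\<close>)

lemma pseudohyp_dist_disc_upper:
  assumes "f \<in> disc_algebra" "\<And>x. cmod x < 1 \<Longrightarrow> cmod (f x) \<le> 1" "delta_disc b f = 0" "cmod a \<le> 1"
  shows "cmod (delta_disc a f) \<le> pseudohyp_dist_disc a b"
  unfolding pseudohyp_dist_def
proof (rule cSUP_upper)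
  show "f \<in> {f \<in> disc_algebra. sup_norm (ball 0 1) f \<le> 1 \<and> delta_disc b f = 0}"
    using assms by (simp add: sup_norm_disc_le_iff)
  show "bdd_above ((\<lambda>f. cmod (delta_disc a f)) ` {f \<in> disc_algebra. sup_norm (ball 0 1) f \<le> 1 \<and> delta_disc b f = 0})"
    by (rule bdd_aboveI2[of _ _ 1])
      (use assms(4) in \<open>auto intro!: cmod_delta_disc_le simp: sup_norm_disc_le_iff\<close>)
qed

lemma pseudohyp_dist_disc_least:
  assumes "\<And>f. f \<in> disc_algebra \<Longrightarrow> (\<And>x. cmod x < 1 \<Longrightarrow> cmod (f x) \<le> 1) \<Longrightarrow> delta_disc b f = 0 \<Longrightarrow> cmod (delta_disc a f) \<le> B"
    and "cmod b \<le> 1"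
  shows "pseudohyp_dist_disc a b \<le> B"
  unfolding pseudohyp_dist_def
proof (rule cSUP_least)
  have "sup_norm (ball 0 1) (\<lambda>x\<in>ball (0::complex) 1. 0) \<le> 1"
    by (subst sup_norm_disc_le_iff[OF zero_in_disc_algebra]) simp
  then show "{f \<in> disc_algebra. sup_norm (ball 0 1) f \<le> 1 \<and> delta_disc b f = 0} \<noteq> {}"
    using zero_in_disc_algebra delta_disc_zero[OF assms(2)] by blast
qed (use assms in \<open>auto simp: sup_norm_disc_le_iff\<close>)

lemma gleason_dist_c0_upper:
  assumes "f \<in> Au_c0" "\<And>x. norm x < 1 \<Longrightarrow> cmod (f x) \<le> 1" "z \<in> cball 0 1" "w \<in> cball 0 1"
  shows "cmod (delta_c0 z f - delta_c0 w f) \<le> gleason_dist_c0 z w"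
  unfolding gleason_dist_def
proof (rule cSUP_upper)
  show "f \<in> {f \<in> Au_c0. sup_norm (ball 0 1) f \<le> 1}"
    using assms by (simp add: sup_norm_Au_c0_le_iff)
  show "bdd_above ((\<lambda>f. cmod (delta_c0 z f - delta_c0 w f)) ` {f \<in> Au_c0. sup_norm (ball 0 1) f \<le> 1})"
  proof (rule bdd_aboveI2)
    fix f assume f: "f \<in> {f \<in> Au_c0. sup_norm (ball 0 1) f \<le> 1}"
    then have "cmod (delta_c0 z f) \<le> 1" "cmod (delta_c0 w f) \<le> 1"
      using assms(3,4) by (auto intro!: cmod_delta_c0_le simp: sup_norm_Au_c0_le_iff)
    then show "cmod (delta_c0 z f - delta_c0 w f) \<le> 2"
      using norm_triangle_ineq4[of "delta_c0 z f" "delta_c0 w f"] by linarith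
  qed
qed

lemma gleason_dist_c0_least:
  assumes "\<And>f. f \<in> Au_c0 \<Longrightarrow> (\<And>x. norm x < 1 \<Longrightarrow> cmod (f x) \<le> 1) \<Longrightarrow> cmod (delta_c0 z f - delta_c0 w f) \<le> B"
  shows "gleason_dist_c0 z w \<le> B"
  unfolding gleason_dist_def
proof (rule cSUP_least)
  have "sup_norm (ball 0 1) (\<lambda>x\<in>ball (0::c0) 1. 0) \<le> 1"
    by (subst sup_norm_Au_c0_le_iff[OF zero_in_Au_c0]) simp
  then show "{f \<in> Au_c0. sup_norm (ball 0 1) f \<le> 1} \<noteq> {}"
    using zero_in_Au_c0 by blast
qed (use assms in \<open>auto simp: sup_norm_Au_c0_le_iff\<close>)

lemma pseudohyp_dist_c0_upper:
  assumes "f \<in> Au_c0" "\<And>x. norm x < 1 \<Longrightarrow> cmod (f x) \<le> 1" "delta_c0 w f = 0" "z \<in> cball 0 1"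
  shows "cmod (delta_c0 z f) \<le> pseudohyp_dist_c0 z w"
  unfolding pseudohyp_dist_def
proof (rule cSUP_upper)
  show "f \<in> {f \<in> Au_c0. sup_norm (ball 0 1) f \<le> 1 \<and> delta_c0 w f = 0}"
    using assms by (simp add: sup_norm_Au_c0_le_iff)
  show "bdd_above ((\<lambda>f. cmod (delta_c0 z f)) ` {f \<in> Au_c0. sup_norm (ball 0 1) f \<le> 1 \<and> delta_c0 w f = 0})"
    by (rule bdd_aboveI2[of _ _ 1])
      (use assms(4) in \<open>auto intro!: cmod_delta_c0_le simp: sup_norm_Au_c0_le_iff\<close>)
qed

lemma pseudohyp_dist_c0_least:
  assumes "\<And>f. f \<in> Au_c0 \<Longrightarrow> (\<And>x. norm x < 1 \<Longrightarrow> cmod (f x) \<le> 1) \<Longrightarrow> delta_c0 w f = 0 \<Longrightarrow> cmod (delta_c0 z f) \<le> B"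
    and "w \<in> cball 0 1"
  shows "pseudohyp_dist_c0 z w \<le> B"
  unfolding pseudohyp_dist_def
proof (rule cSUP_least)
  have "sup_norm (ball 0 1) (\<lambda>x\<in>ball (0::c0) 1. 0) \<le> 1"
    by (subst sup_norm_Au_c0_le_iff[OF zero_in_Au_c0]) simp
  then show "{f \<in> Au_c0. sup_norm (ball 0 1) f \<le> 1 \<and> delta_c0 w f = 0} \<noteq> {}"
    using zero_in_Au_c0 delta_c0_zero[OF assms(2)] by blast
qed (use assms in \<open>auto simp: sup_norm_Au_c0_le_iff\<close>)

section \<open>Reduction to the disc\<close>

lemma dilate_disc_algebra:
  assumes f: "f \<in> disc_algebra" and r: "0 \<le> r" "r < 1"
  shows "(\<lambda>x\<in>ball 0 1. f (of_real r * x)) \<in> disc_algebra"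
    and "cmod l \<le> 1 \<Longrightarrow> delta_disc l (\<lambda>x\<in>ball 0 1. f (of_real r * x)) = delta_disc (of_real r * l) f"
    and "cmod x < 1 \<Longrightarrow> cmod (of_real r * x) < 1"
proof -
  have lt1: "cmod (of_real r * x) < 1" if "cmod x \<le> 1" for x
    using that r mult_left_le[of "cmod x" r] by (simp add: norm_mult)
  define g where "g x = f (of_real r * x)" for x
  have fhol: "f holomorphic_on ball 0 1" using f by (simp add: disc_algebra_def)
  have "(f \<circ> (\<lambda>x. of_real r * x)) holomorphic_on ball 0 1"
    using lt1 by (intro holomorphic_on_compose_gen[OF _ fhol]) (auto intro!: holomorphic_intros)
  then have ghol: "g holomorphic_on ball 0 1" by (simp add: g_def[abs_def] comp_def)
  have gcont: "continuous_on (cball 0 1) g"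
    unfolding g_def using lt1
    by (intro continuous_on_compose2[OF holomorphic_on_imp_continuous_on[OF fhol]])
      (auto intro!: continuous_intros)
  show "(\<lambda>x\<in>ball 0 1. f (of_real r * x)) \<in> disc_algebra"
    using disc_algebraI(1)[OF gcont ghol] by (simp add: g_def[abs_def])
  show "cmod l \<le> 1 \<Longrightarrow> delta_disc l (\<lambda>x\<in>ball 0 1. f (of_real r * x)) = delta_disc (of_real r * l) f"
    using disc_algebraI(2)[OF gcont ghol, of l] lt1[of l] by (simp add: g_def[abs_def] delta_disc_interior[OF f])
  show "cmod x < 1 \<Longrightarrow> cmod (of_real r * x) < 1"
    using lt1 by simp
qed

text \<open>A competitor at the dilated points, composed with the dilation, is a competitor at the
  original ones. Estimates at shrunk points thus return to coordinates that may lie on the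
  circle.\<close>

lemma gleason_dist_disc_dilate:
  assumes r: "0 \<le> r" "r < 1" and ab: "cmod a \<le> 1" "cmod b \<le> 1"
  shows "gleason_dist_disc (of_real r * a) (of_real r * b) \<le> gleason_dist_disc a b"
proof (rule gleason_dist_disc_least)
  fix f assume f: "f \<in> disc_algebra" "\<And>x. cmod x < 1 \<Longrightarrow> cmod (f x) \<le> 1"
  let ?g = "\<lambda>x\<in>ball 0 1. f (of_real r * x)"
  note g = dilate_disc_algebra[OF f(1) r]
  have g1: "cmod (?g x) \<le> 1" if "cmod x < 1" for x
    using that f(2) g(3) by simp
  have "cmod (delta_disc a ?g - delta_disc b ?g) \<le> gleason_dist_disc a b"
    using g1 by (intro gleason_dist_disc_upper g(1) ab)
  then show "cmod (delta_disc (of_real r * a) f - delta_disc (of_real r * b) f) \<le> gleason_dist_disc a b"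
    by (simp only: g(2) ab)
qed

lemma pseudohyp_dist_disc_dilate:
  assumes r: "0 \<le> r" "r < 1" and ab: "cmod a \<le> 1" "cmod b \<le> 1"
  shows "pseudohyp_dist_disc (of_real r * a) (of_real r * b) \<le> pseudohyp_dist_disc a b"
proof (rule pseudohyp_dist_disc_least)
  fix f assume f: "f \<in> disc_algebra" "\<And>x. cmod x < 1 \<Longrightarrow> cmod (f x) \<le> 1"
    and f0: "delta_disc (of_real r * b) f = 0"
  let ?g = "\<lambda>x\<in>ball 0 1. f (of_real r * x)"
  note g = dilate_disc_algebra[OF f(1) r]
  have g1: "cmod (?g x) \<le> 1" if "cmod x < 1" for x
    using that f(2) g(3) by simp
  have "delta_disc b ?g = 0" by (simp only: g(2) ab f0)
  then have "cmod (delta_disc a ?g) \<le> pseudohyp_dist_disc a b"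
    using g1 by (intro pseudohyp_dist_disc_upper g(1) ab)
  then show "cmod (delta_disc (of_real r * a) f) \<le> pseudohyp_dist_disc a b"
    by (simp only: g(2) ab)
next
  show "cmod (of_real r * b) \<le> 1"
    using r ab mult_le_one[of r "cmod b"] by (simp add: norm_mult)
qed

lemma bounded_linear_coord: "bounded_linear (\<lambda>x. coord x n)"
  by (rule bounded_linear_intro[where K = 1]) (simp_all add: coord_le_norm)

text \<open>Pulling back along a coordinate preserves a bound by 1, so test functions on the disc
  become test functions on the ball. This yields the lower bounds for both distances.\<close>

lemma coord_compose_Au_c0:
  assumes g: "g \<in> disc_algebra"
  shows "(\<lambda>x\<in>ball 0 1. g (coord x n)) \<in> Au_c0"
    and "z \<in> cball 0 1 \<Longrightarrow> delta_c0 z (\<lambda>x\<in>ball 0 1. g (coord x n)) = delta_disc (apply_bcontfun z n) g"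
proof -
  let ?f = "\<lambda>x\<in>ball 0 1. g (coord x n)"
  have in_ball: "cmod (coord x n) < 1" if "norm x < 1" for x
    using coord_le_norm[of x n] that by simp
  have "holomorphic_c0 ?f (ball 0 1)"
    unfolding holomorphic_c0_def
  proof (intro ballI)
    fix x :: c0 assume x: "x \<in> ball 0 1"
    then have "g field_differentiable at (coord x n)"
      using g in_ball by (auto simp: disc_algebra_def holomorphic_on_open field_differentiable_def)
    then obtain D where "(g has_field_derivative D) (at (coord x n))"
      by (auto simp: field_differentiable_def)
    then have "((\<lambda>y. g (coord y n)) has_derivative (\<lambda>h. D * coord h n)) (at x)"
      using has_derivative_compose[OF bounded_linear_imp_has_derivative[OF bounded_linear_coord]]
      unfolding has_field_derivative_def by blast
    then have "(?f has_derivative (\<lambda>h. D * coord h n)) (at x)"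
      by (rule has_derivative_transform_within_open[OF _ open_ball x]) simp
    then show "\<exists>L. (?f has_derivative L) (at x) \<and> (\<forall>c h. L (c0_scaleC c h) = c * L h)"
      by (intro exI[of _ "\<lambda>h. D * coord h n"]) simp
  qed
  moreover have "uniformly_continuous_on (ball 0 1) ?f"
  proof -
    have "uniformly_continuous_on (ball 0 1) g" using g by (simp add: disc_algebra_def)
    then have *: "\<exists>d>0. \<forall>x\<in>ball 0 1. \<forall>y\<in>ball 0 1. dist y x < d \<longrightarrow> dist (g y) (g x) < e" if "0 < e" for e
      using that unfolding uniformly_continuous_on_def by blast
    show ?thesis
      unfolding uniformly_continuous_on_def
    proof (intro allI impI)
      fix e :: real assume "0 < e"
      from *[OF this] obtain d where d: "d > 0"
        "\<forall>x\<in>ball 0 1. \<forall>y\<in>ball 0 1. dist y x < d \<longrightarrow> dist (g y) (g x) < e" by blast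
      have "dist (?f y) (?f x) < e" if "norm x < 1" "norm y < 1" "dist y x < d" for x y
      proof -
        have "dist (coord y n) (coord x n) < d"
          using coord_le_norm[of "y - x" n] that(3) by (simp add: dist_norm)
        then show ?thesis using d(2) in_ball that(1,2) by simp
      qed
      with d(1) show "\<exists>d>0. \<forall>x\<in>ball 0 1. \<forall>y\<in>ball 0 1. dist y x < d \<longrightarrow> dist (?f y) (?f x) < e"
        by (intro exI[of _ d]) simp
    qed
  qed
  ultimately show 1: "?f \<in> Au_c0" by (simp add: Au_c0_def)
  assume z: "z \<in> cball 0 1"
  then have zn: "cmod (apply_bcontfun z n) \<le> 1" using linf_cball_iff by blast
  \<comment> \<open>This is the factor in \<open>inner_pt\<close>: coordinate \<open>n\<close> of
    \<open>inner_pt k\<close> is \<open>r k\<close> times that of \<open>z\<close> once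
    \<open>k\<close> exceeds \<open>n\<close>.\<close>
  define r where "r k = 1 - 1 / real (Suc k)" for k
  have r: "0 \<le> r k" "r k < 1" for k by (simp_all only: r_def shrink_factor)
  have rz: "cmod (of_real (r k) * apply_bcontfun z n) < 1" for k
    using r[of k] zn mult_left_le[of "cmod (apply_bcontfun z n)" "r k"] by (simp add: norm_mult)
  have "(\<lambda>k. of_real (r k) * apply_bcontfun z n) \<longlonglongrightarrow> of_real (1 - 0) * apply_bcontfun z n"
    unfolding r_def by (intro tendsto_intros LIMSEQ_Suc[OF lim_1_over_n])
  then have "(\<lambda>k. delta_disc (of_real (r k) * apply_bcontfun z n) g) \<longlonglongrightarrow> delta_disc (apply_bcontfun z n) g"
    using zn rz by (intro continuous_on_tendsto_compose[OF continuous_on_delta_disc[OF g]])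
      (auto intro!: always_eventually less_imp_le)
  moreover have "\<forall>\<^sub>F k in sequentially. delta_disc (of_real (r k) * apply_bcontfun z n) g = ?f (inner_pt k (apply_bcontfun z))"
    using eventually_gt_at_top[of n]
  proof eventually_elim
    case (elim k)
    have "norm (inner_pt k (apply_bcontfun z)) < 1"
      using z linf_cball_iff norm_inner_pt by blast
    then have "?f (inner_pt k (apply_bcontfun z)) = g (of_real (r k) * apply_bcontfun z n)"
      using elim by (simp add: r_def)
    then show ?case by (simp only: delta_disc_interior[OF g rz])
  qed
  ultimately have "(\<lambda>k. ?f (inner_pt k (apply_bcontfun z))) \<longlonglongrightarrow> delta_disc (apply_bcontfun z n) g"
    by (rule Lim_transform_eventually)
  then show "delta_c0 z ?f = delta_disc (apply_bcontfun z n) g"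
    using delta_c0_tendsto[OF 1 z] LIMSEQ_unique by blast
qed

lemma analytic_disc_compose:
  assumes f: "f \<in> Au_c0"
    and cont: "\<And>n. n < N \<Longrightarrow> continuous_on (cball 0 1) (\<phi> n)"
    and hol: "\<And>n. n < N \<Longrightarrow> \<phi> n holomorphic_on ball 0 1"
    and lt1: "\<And>n \<zeta>. n < N \<Longrightarrow> cmod \<zeta> < 1 \<Longrightarrow> cmod (\<phi> n \<zeta>) < 1"
  shows "(\<lambda>\<zeta>\<in>ball 0 1. f (trunc N (\<lambda>n. \<phi> n \<zeta>))) \<in> disc_algebra"
    and "cmod \<zeta> < 1 \<Longrightarrow> norm (trunc N (\<lambda>n. \<phi> n \<zeta>)) < 1"
proof -
  interpret bounded_bilinear c0_scaleC by (rule c0_scaleC_bilinear)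
  define p where "p \<zeta> = trunc N (\<lambda>n. \<phi> n \<zeta>)" for \<zeta>
  have p_sum: "p \<zeta> = (\<Sum>n<N. c0_scaleC (\<phi> n \<zeta>) (unit_c0 n))" for \<zeta>
    by (simp add: p_def trunc_eq_sum)
  have p_lt1: "norm (p \<zeta>) < 1" if "cmod \<zeta> < 1" for \<zeta>
  proof -
    \<comment> \<open>A maximum over finitely many coordinates stays strictly below 1, which a
      supremum over infinitely many might not; inserting 0 covers \<open>N = 0\<close>.\<close>
    define B where "B = Max (insert 0 ((\<lambda>n. cmod (\<phi> n \<zeta>)) ` {..<N}))"
    have "norm (p \<zeta>) \<le> B"
      unfolding p_def B_def by (intro norm_trunc_le) (auto intro!: Max_ge)
    moreover have "B < 1"
      unfolding B_def using lt1[OF _ that] by (subst Max_less_iff) auto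
    ultimately show ?thesis by simp
  qed
  then show "cmod \<zeta> < 1 \<Longrightarrow> norm (trunc N (\<lambda>n. \<phi> n \<zeta>)) < 1"
    by (simp add: p_def)
  have "continuous_on (cball 0 1) p"
    unfolding p_sum by (intro continuous_on_sum continuous_on continuous_on_const cont) auto
  then have "uniformly_continuous_on (cball 0 1) p"
    by (intro compact_uniformly_continuous) auto
  then have p_uc: "uniformly_continuous_on (ball 0 1) p"
    unfolding uniformly_continuous_on_def by (meson ball_subset_cball subsetD)
  have "uniformly_continuous_on (ball 0 1) f" using f by (simp add: Au_c0_def)
  moreover have p_img: "p ` ball 0 1 \<subseteq> ball 0 1" using p_lt1 by auto
  ultimately have "uniformly_continuous_on (p ` ball 0 1) f"
    unfolding uniformly_continuous_on_def by (meson subsetD)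
  from uniformly_continuous_on_compose[OF p_uc this]
  have "uniformly_continuous_on (ball 0 1) (\<lambda>\<zeta>\<in>ball 0 1. f (p \<zeta>))"
    by (simp add: uniformly_continuous_on_def)
  moreover have "(\<lambda>\<zeta>. f (p \<zeta>)) holomorphic_on ball 0 1"
    unfolding holomorphic_on_def
  proof (intro ballI)
    fix \<zeta> :: complex assume \<zeta>: "\<zeta> \<in> ball 0 1"
    have "\<exists>D. (\<phi> n has_field_derivative D) (at \<zeta>)" if "n < N" for n
      using hol[OF that] \<zeta> by (auto simp: holomorphic_on_open)
    then obtain D where D: "\<And>n. n < N \<Longrightarrow> (\<phi> n has_field_derivative D n) (at \<zeta>)"
      by metis
    have "p \<zeta> \<in> ball 0 1" using p_img \<zeta> by blast
    then obtain L where L: "(f has_derivative L) (at (p \<zeta>))" and lin: "\<And>c h. L (c0_scaleC c h) = c * L h"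
      using f unfolding Au_c0_def holomorphic_c0_def by blast
    have "(p has_derivative (\<lambda>h. \<Sum>n<N. c0_scaleC (D n * h) (unit_c0 n))) (at \<zeta>)"
      unfolding p_sum
      by (intro has_derivative_sum bounded_linear.has_derivative[OF bounded_linear_left])
        (use D in \<open>auto simp: has_field_derivative_def\<close>)
    from has_derivative_compose[OF this L]
    have "((\<lambda>\<zeta>. f (p \<zeta>)) has_derivative (\<lambda>h. (\<Sum>n<N. D n * L (unit_c0 n)) * h)) (at \<zeta>)"
      by (simp add: linear_sum[OF has_derivative_linear[OF L]] lin sum_distrib_left mult_ac)
    then have "((\<lambda>\<zeta>. f (p \<zeta>)) has_field_derivative (\<Sum>n<N. D n * L (unit_c0 n))) (at \<zeta>)"
      by (simp add: has_field_derivative_def)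
    then show "(\<lambda>\<zeta>. f (p \<zeta>)) field_differentiable at \<zeta> within ball 0 1"
      using field_differentiable_at_within field_differentiable_def by blast
  qed
  then have "(\<lambda>\<zeta>\<in>ball 0 1. f (p \<zeta>)) holomorphic_on ball 0 1"
    by (rule holomorphic_transform) simp
  ultimately show "(\<lambda>\<zeta>\<in>ball 0 1. f (trunc N (\<lambda>n. \<phi> n \<zeta>))) \<in> disc_algebra"
    by (simp add: disc_algebra_def p_def)
qed

text \<open>An analytic disc \<open>\<phi>\<close> in the polydisc passing through both points reduces the
  comparison to the disc; it exists when it is placed at the coordinates \<open>(z m, w m)\<close> that are
  farthest apart, since every other pair of coordinates is then reached by a composition of
  Moebius maps with a contraction.\<close>

lemma exists_disc_slice:
  assumes f: "f \<in> Au_c0" "\<And>x. norm x < 1 \<Longrightarrow> cmod (f x) \<le> 1" and N: "0 < N"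
    and zw: "\<And>n. n < N \<Longrightarrow> cmod (z n) < 1" "\<And>n. n < N \<Longrightarrow> cmod (w n) < 1"
  obtains m F where "m < N" "F \<in> disc_algebra" "\<And>x. cmod x < 1 \<Longrightarrow> cmod (F x) \<le> 1"
    "F (z m) = f (trunc N z)" "F (w m) = f (trunc N w)"
proof -
  have "finite ((\<lambda>n. pdisc (z n) (w n)) ` {..<N})" "(\<lambda>n. pdisc (z n) (w n)) ` {..<N} \<noteq> {}"
    using N by auto
  from Max_in[OF this] obtain m where m: "m < N"
    "Max ((\<lambda>n. pdisc (z n) (w n)) ` {..<N}) = pdisc (z m) (w m)" by auto
  have max: "pdisc (z n) (w n) \<le> pdisc (z m) (w m)" if "n < N" for n
    using that by (subst m(2)[symmetric]) (intro Max_ge, auto)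
  have "\<exists>\<phi>. continuous_on (cball 0 1) \<phi> \<and> \<phi> holomorphic_on ball 0 1 \<and>
      (\<forall>\<zeta>. cmod \<zeta> < 1 \<longrightarrow> cmod (\<phi> \<zeta>) < 1) \<and> \<phi> (z m) = z n \<and> \<phi> (w m) = w n" if n: "n < N" for n
    using Moebius_interpolation[OF zw(1)[OF m(1)] zw(2)[OF m(1)] zw(1)[OF n] zw(2)[OF n] max[OF n]]
    by metis
  then obtain \<phi> where \<phi>: "\<And>n. n < N \<Longrightarrow> continuous_on (cball 0 1) (\<phi> n)"
    "\<And>n. n < N \<Longrightarrow> \<phi> n holomorphic_on ball 0 1"
    "\<And>n \<zeta>. n < N \<Longrightarrow> cmod \<zeta> < 1 \<Longrightarrow> cmod (\<phi> n \<zeta>) < 1"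
    "\<And>n. n < N \<Longrightarrow> \<phi> n (z m) = z n" "\<And>n. n < N \<Longrightarrow> \<phi> n (w m) = w n"
    by metis
  let ?F = "\<lambda>\<zeta>\<in>ball 0 1. f (trunc N (\<lambda>n. \<phi> n \<zeta>))"
  show thesis
  proof (rule that[OF m(1) analytic_disc_compose(1)[OF f(1) \<phi>(1-3)]])
    show "cmod (?F x) \<le> 1" if "cmod x < 1" for x
      using f(2) analytic_disc_compose(2)[OF f(1) \<phi>(1-3) that] that by simp
    have "trunc N (\<lambda>n. \<phi> n (z m)) = trunc N z" "trunc N (\<lambda>n. \<phi> n (w m)) = trunc N w"
      using \<phi>(4,5) by (auto intro!: c0_eqI)
    then show "?F (z m) = f (trunc N z)" "?F (w m) = f (trunc N w)"
      using zw m(1) by auto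
  qed
qed

text \<open>Taking \<open>Suc k\<close> guarantees at least one coordinate from which to choose the
  farthest pair. That pair consists of shrunk coordinates, hence the factor
  \<open>r\<close>.\<close>

lemma inner_pt_slice:
  assumes f: "f \<in> Au_c0" "\<And>x. norm x < 1 \<Longrightarrow> cmod (f x) \<le> 1"
    and zw: "\<And>n. cmod (z n) \<le> 1" "\<And>n. cmod (w n) \<le> 1"
  obtains m r F where "0 \<le> r" "r < 1" "F \<in> disc_algebra" "\<And>x. cmod x < 1 \<Longrightarrow> cmod (F x) \<le> 1"
    "delta_disc (of_real r * z m) F = f (inner_pt (Suc k) z)" "delta_disc (of_real r * w m) F = f (inner_pt (Suc k) w)"
proof -
  define r where "r = 1 - 1 / real (Suc (Suc k))"
  have r: "0 \<le> r" "r < 1" by (simp_all only: r_def shrink_factor)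
  have lt1: "cmod (of_real r * a) < 1" if "cmod a \<le> 1" for a
    using r that mult_left_le[of "cmod a" r] by (simp add: norm_mult)
  obtain m F where "m < Suc k" and F: "F \<in> disc_algebra" "\<And>x. cmod x < 1 \<Longrightarrow> cmod (F x) \<le> 1"
    "F (of_real r * z m) = f (trunc (Suc k) (\<lambda>n. of_real r * z n))"
    "F (of_real r * w m) = f (trunc (Suc k) (\<lambda>n. of_real r * w n))"
    by (rule exists_disc_slice[OF f, where N = "Suc k" and z = "\<lambda>n. of_real r * z n" and w = "\<lambda>n. of_real r * w n"])
      (use lt1 zw in auto)
  then show thesis
    using r lt1 zw by (intro that[of r F m]) (simp_all add: delta_disc_interior inner_pt_def r_def)
qed

lemma gleason_dist_disc_le_2: "cmod a \<le> 1 \<Longrightarrow> cmod b \<le> 1 \<Longrightarrow> gleason_dist_disc a b \<le> 2"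
proof (rule gleason_dist_disc_least)
  fix f assume "cmod a \<le> 1" "cmod b \<le> 1" "f \<in> disc_algebra" "\<And>x. cmod x < 1 \<Longrightarrow> cmod (f x) \<le> 1"
  then have "cmod (delta_disc a f) \<le> 1" "cmod (delta_disc b f) \<le> 1"
    by (auto intro!: cmod_delta_disc_le)
  then show "cmod (delta_disc a f - delta_disc b f) \<le> 2"
    using norm_triangle_ineq4[of "delta_disc a f" "delta_disc b f"] by linarith
qed

lemma pseudohyp_dist_disc_le_1: "cmod a \<le> 1 \<Longrightarrow> cmod b \<le> 1 \<Longrightarrow> pseudohyp_dist_disc a b \<le> 1"
  by (rule pseudohyp_dist_disc_least) (auto intro!: cmod_delta_disc_le)

lemma pseudohyp_dist_disc_nonneg: "cmod a \<le> 1 \<Longrightarrow> cmod b \<le> 1 \<Longrightarrow> 0 \<le> pseudohyp_dist_disc a b"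
  using pseudohyp_dist_disc_upper[OF zero_in_disc_algebra _ delta_disc_zero, of b a] by (simp add: delta_disc_zero)

text \<open>From above, a slice replaces \<open>f\<close> by a disc function at one pair of shrunk
  coordinates, and dilation leads back to the pair itself before the limit is taken. From below,
  coordinate pullbacks compete.\<close>

lemma gleason_dist_c0_eq:
  assumes z: "z \<in> cball 0 1" and w: "w \<in> cball 0 1"
  shows "gleason_dist_c0 z w = (SUP n. gleason_dist_disc (apply_bcontfun z n) (apply_bcontfun w n))"
    (is "_ = (SUP n. ?g n)")
proof (rule antisym)
  have zw: "cmod (apply_bcontfun z n) \<le> 1" "cmod (apply_bcontfun w n) \<le> 1" for n
    using z w linf_cball_iff by blast+
  have bdd: "bdd_above (range ?g)"
    using gleason_dist_disc_le_2[OF zw] by (intro bdd_aboveI2) auto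
  show "gleason_dist_c0 z w \<le> (SUP n. ?g n)"
  proof (rule gleason_dist_c0_least)
    fix f assume f: "f \<in> Au_c0" "\<And>x. norm x < 1 \<Longrightarrow> cmod (f x) \<le> 1"
    show "cmod (delta_c0 z f - delta_c0 w f) \<le> (SUP n. ?g n)"
    proof (rule LIMSEQ_le_const2)
      show "(\<lambda>k. cmod (f (inner_pt (Suc k) (apply_bcontfun z)) - f (inner_pt (Suc k) (apply_bcontfun w))))
          \<longlonglongrightarrow> cmod (delta_c0 z f - delta_c0 w f)"
        by (intro tendsto_intros LIMSEQ_Suc delta_c0_tendsto f z w)
      have "cmod (f (inner_pt (Suc k) (apply_bcontfun z)) - f (inner_pt (Suc k) (apply_bcontfun w))) \<le> (SUP n. ?g n)" for k
      proof -
        obtain m r F where r: "0 \<le> r" "r < 1" and F: "F \<in> disc_algebra" "\<And>x. cmod x < 1 \<Longrightarrow> cmod (F x) \<le> 1"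
          "delta_disc (of_real r * apply_bcontfun z m) F = f (inner_pt (Suc k) (apply_bcontfun z))"
          "delta_disc (of_real r * apply_bcontfun w m) F = f (inner_pt (Suc k) (apply_bcontfun w))"
          by (rule inner_pt_slice[where z = "apply_bcontfun z" and w = "apply_bcontfun w" and k = k, OF f zw that]) blast+
        have rl: "cmod (of_real r * a) \<le> 1" if "cmod a \<le> 1" for a
          using r that mult_le_one[of r "cmod a"] by (simp add: norm_mult)
        have "cmod (f (inner_pt (Suc k) (apply_bcontfun z)) - f (inner_pt (Suc k) (apply_bcontfun w)))
            \<le> gleason_dist_disc (of_real r * apply_bcontfun z m) (of_real r * apply_bcontfun w m)"
          unfolding F(3,4)[symmetric] by (intro gleason_dist_disc_upper F(1,2) rl zw)
        also have "\<dots> \<le> ?g m" by (rule gleason_dist_disc_dilate[OF r zw])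
        also have "\<dots> \<le> (SUP n. ?g n)" by (rule cSUP_upper[OF _ bdd]) simp
        finally show ?thesis .
      qed
      then show "\<exists>M. \<forall>k\<ge>M. cmod (f (inner_pt (Suc k) (apply_bcontfun z)) - f (inner_pt (Suc k) (apply_bcontfun w))) \<le> (SUP n. ?g n)"
        by blast
    qed
  qed
  show "(SUP n. ?g n) \<le> gleason_dist_c0 z w"
  proof (rule cSUP_least)
    fix n
    show "?g n \<le> gleason_dist_c0 z w"
    proof (rule gleason_dist_disc_least)
      fix g assume g: "g \<in> disc_algebra" "\<And>x. cmod x < 1 \<Longrightarrow> cmod (g x) \<le> 1"
      have "cmod ((\<lambda>x\<in>ball 0 1. g (coord x n)) x) \<le> 1" if "norm x < 1" for x
        using that g(2) coord_le_norm[of x n] by simp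
      from gleason_dist_c0_upper[OF coord_compose_Au_c0(1)[OF g(1)] this z w]
      show "cmod (delta_disc (apply_bcontfun z n) g - delta_disc (apply_bcontfun w n) g) \<le> gleason_dist_c0 z w"
        by (simp only: coord_compose_Au_c0(2)[OF g(1)] z w)
    qed
  qed simp
qed

lemma pseudohyp_dist_c0_eq:
  assumes z: "z \<in> cball 0 1" and w: "w \<in> cball 0 1"
  shows "pseudohyp_dist_c0 z w = (SUP n. pseudohyp_dist_disc (apply_bcontfun z n) (apply_bcontfun w n))"
    (is "_ = (SUP n. ?g n)")
proof (rule antisym)
  have zw: "cmod (apply_bcontfun z n) \<le> 1" "cmod (apply_bcontfun w n) \<le> 1" for n
    using z w linf_cball_iff by blast+
  have bdd: "bdd_above (range ?g)"
    using pseudohyp_dist_disc_le_1[OF zw] by (intro bdd_aboveI2) auto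
  define S where "S = (SUP n. ?g n)"
  have gS: "?g n \<le> S" for n unfolding S_def by (rule cSUP_upper[OF _ bdd]) simp
  have "0 \<le> S" using order.trans[OF pseudohyp_dist_disc_nonneg[OF zw] gS] .
  have "pseudohyp_dist_c0 z w \<le> S"
  proof (rule pseudohyp_dist_c0_least)
    fix f assume f: "f \<in> Au_c0" "\<And>x. norm x < 1 \<Longrightarrow> cmod (f x) \<le> 1" and f0: "delta_c0 w f = 0"
    define a where "a k = f (inner_pt (Suc k) (apply_bcontfun z))" for k
    define b where "b k = f (inner_pt (Suc k) (apply_bcontfun w))" for k
    have a: "a \<longlonglongrightarrow> delta_c0 z f" and b: "b \<longlonglongrightarrow> 0"
      using LIMSEQ_Suc[OF delta_c0_tendsto[OF f(1) z]] LIMSEQ_Suc[OF delta_c0_tendsto[OF f(1) w]] f0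
      by (simp_all add: a_def[abs_def] b_def[abs_def])
    \<comment> \<open>The value \<open>b k\<close> tends to 0 but need not vanish. Subtracting it
      from the disc function and dividing by \<open>1 + cmod (b k)\<close> gives an admissible
      competitor; the correction disappears in the limit.\<close>
    have ab: "cmod (a k) \<le> cmod (b k) + (1 + cmod (b k)) * S" for k
    proof -
      obtain m r F where r: "0 \<le> r" "r < 1" and F: "F \<in> disc_algebra" "\<And>x. cmod x < 1 \<Longrightarrow> cmod (F x) \<le> 1"
        "delta_disc (of_real r * apply_bcontfun z m) F = f (inner_pt (Suc k) (apply_bcontfun z))"
        "delta_disc (of_real r * apply_bcontfun w m) F = f (inner_pt (Suc k) (apply_bcontfun w))"
        by (rule inner_pt_slice[where z = "apply_bcontfun z" and w = "apply_bcontfun w" and k = k, OF f zw that]) blast+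
      note F = F(1,2) F(3,4)[folded a_def b_def]
      define c where "c = 1 + cmod (b k)"
      have c: "0 < c" by (simp add: c_def add_pos_nonneg)
      define G where "G x = (delta_disc x F - b k) / of_real c" for x
      have Gc: "continuous_on (cball 0 1) G"
        unfolding G_def using c by (intro continuous_intros continuous_on_delta_disc F(1)) auto
      have "(\<lambda>x. (F x - b k) / of_real c) holomorphic_on ball 0 1"
        using F(1) c by (intro holomorphic_intros) (auto simp: disc_algebra_def)
      then have Gh: "G holomorphic_on ball 0 1"
        by (rule holomorphic_transform) (simp add: G_def delta_disc_interior F(1))
      have "cmod (restrict G (ball 0 1) x) \<le> 1" if x: "cmod x < 1" for x
      proof -
        have "cmod (F x - b k) \<le> c"
          using F(2)[OF x] norm_triangle_ineq4[of "F x" "b k"] by (simp add: c_def)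
        then show ?thesis using x c by (simp add: G_def delta_disc_interior F(1) norm_divide)
      qed
      moreover have rl: "cmod (of_real r * x) \<le> 1" if "cmod x \<le> 1" for x
        using r that mult_le_one[of r "cmod x"] by (simp add: norm_mult)
      ultimately have "cmod (delta_disc (of_real r * apply_bcontfun z m) (restrict G (ball 0 1)))
          \<le> pseudohyp_dist_disc (of_real r * apply_bcontfun z m) (of_real r * apply_bcontfun w m)"
        by (intro pseudohyp_dist_disc_upper disc_algebraI(1)[OF Gc Gh])
          (simp_all only: disc_algebraI(2)[OF Gc Gh] rl zw, simp add: G_def F)
      also have "\<dots> \<le> S"
        using pseudohyp_dist_disc_dilate[OF r zw] gS order.trans by blast
      finally have "cmod (G (of_real r * apply_bcontfun z m)) \<le> S"
        by (simp only: disc_algebraI(2)[OF Gc Gh] rl zw)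
      then have "cmod (a k - b k) \<le> c * S"
        using c by (simp add: G_def F norm_divide pos_divide_le_eq mult.commute)
      then show ?thesis
        using norm_triangle_sub[of "a k" "b k"] by (simp add: c_def)
    qed
    show "cmod (delta_c0 z f) \<le> S"
    proof (rule LIMSEQ_le)
      show "(\<lambda>k. cmod (a k)) \<longlonglongrightarrow> cmod (delta_c0 z f)" by (intro tendsto_norm a)
      have "(\<lambda>k. cmod (b k) + (1 + cmod (b k)) * S) \<longlonglongrightarrow> cmod 0 + (1 + cmod 0) * S"
        by (intro tendsto_intros b)
      then show "(\<lambda>k. cmod (b k) + (1 + cmod (b k)) * S) \<longlonglongrightarrow> S" by simp
      show "\<exists>N. \<forall>n\<ge>N. cmod (a n) \<le> cmod (b n) + (1 + cmod (b n)) * S" using ab by blast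
    qed
  qed (rule w)
  then show "pseudohyp_dist_c0 z w \<le> (SUP n. ?g n)" by (simp add: S_def)
  show "(SUP n. ?g n) \<le> pseudohyp_dist_c0 z w"
  proof (rule cSUP_least)
    fix n
    show "?g n \<le> pseudohyp_dist_c0 z w"
    proof (rule pseudohyp_dist_disc_least)
      fix g assume g: "g \<in> disc_algebra" "\<And>x. cmod x < 1 \<Longrightarrow> cmod (g x) \<le> 1"
        and g0: "delta_disc (apply_bcontfun w n) g = 0"
      have "cmod ((\<lambda>x\<in>ball 0 1. g (coord x n)) x) \<le> 1" if "norm x < 1" for x
        using that g(2) coord_le_norm[of x n] by simp
      moreover have "delta_c0 w (\<lambda>x\<in>ball 0 1. g (coord x n)) = 0"
        using g0 by (simp only: coord_compose_Au_c0(2)[OF g(1) w])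
      ultimately have "cmod (delta_c0 z (\<lambda>x\<in>ball 0 1. g (coord x n))) \<le> pseudohyp_dist_c0 z w"
        by (intro pseudohyp_dist_c0_upper coord_compose_Au_c0(1) g(1) z)
      then show "cmod (delta_disc (apply_bcontfun z n) g) \<le> pseudohyp_dist_c0 z w"
        by (simp only: coord_compose_Au_c0(2)[OF g(1) z])
    qed (rule zw)
  qed simp
qed

section \<open>Pseudo-hyperbolic distance on the disc\<close>

lemma pdisc_commute: "pdisc a b = pdisc b a"
proof -
  have "cmod (1 - cnj b * a) = cmod (1 - cnj a * b)"
    by (subst complex_mod_cnj[symmetric]) (simp add: mult.commute)
  then show ?thesis
    by (simp add: pdisc_def norm_divide norm_minus_commute)
qed

text \<open>Schwarz-Pick: Schwarz's lemma after \<open>b\<close> has been moved to 0. If a point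
  lies on the circle, \<open>pdisc a b\<close> is 1 and the bound is trivial.\<close>

lemma pseudohyp_dist_disc_le_pdisc:
  assumes a: "cmod a \<le> 1" and b: "cmod b \<le> 1" and ab: "a \<noteq> b"
  shows "pseudohyp_dist_disc a b \<le> pdisc a b"
proof (cases "cmod a < 1 \<and> cmod b < 1")
  case False
  then have "pdisc a b = 1" using a b ab by (intro pdisc_boundary) auto
  then show ?thesis using pseudohyp_dist_disc_le_1[OF a b] by simp
next
  case True
  then have a1: "cmod a < 1" and b1: "cmod b < 1" by auto
  show ?thesis
  proof (rule pseudohyp_dist_disc_least)
    fix f assume f: "f \<in> disc_algebra" "\<And>x. cmod x < 1 \<Longrightarrow> cmod (f x) \<le> 1" "delta_disc b f = 0"
    \<comment> \<open>The factor \<open>c\<close> below 1 makes the function map into the open disc,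
      as Schwarz's lemma demands, and is then removed.\<close>
    have "c * cmod (f a) \<le> pdisc a b" if c: "0 < c" "c < 1" for c
    proof -
      define h where "h x = of_real c * f (Moebius_function 0 (- b) x)" for x
      have M1: "cmod (Moebius_function 0 (- b) x) < 1" if "cmod x < 1" for x
        using b1 that by (intro Moebius_function_norm_lt_1) auto
      have fhol: "f holomorphic_on ball 0 1" using f by (simp add: disc_algebra_def)
      have "(f \<circ> Moebius_function 0 (- b)) holomorphic_on ball 0 1"
        using M1 b1 by (intro holomorphic_on_compose_gen[OF Moebius_function_holomorphic fhol]) auto
      then have "h holomorphic_on ball 0 1"
        unfolding h_def comp_def by (intro holomorphic_intros)
      moreover have "h 0 = 0"
        using f(3) delta_disc_interior[OF f(1) b1] by (simp add: h_def Moebius_function_of_zero)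
      moreover have "cmod (h x) < 1" if "cmod x < 1" for x
      proof -
        have "c * cmod (f (Moebius_function 0 (- b) x)) \<le> c"
          using f(2)[OF M1[OF that]] c by (intro mult_left_le) auto
        moreover have "cmod (h x) = c * cmod (f (Moebius_function 0 (- b) x))"
          using c by (simp add: h_def norm_mult)
        ultimately show ?thesis using c by linarith
      qed
      moreover have "cmod (Moebius_function 0 b a) < 1"
        by (rule Moebius_function_norm_lt_1[OF b1 a1])
      ultimately have "cmod (h (Moebius_function 0 b a)) \<le> cmod (Moebius_function 0 b a)"
        by (rule Schwarz_Lemma(1))
      also have "Moebius_function 0 (- b) (Moebius_function 0 b a) = a"
        using Moebius_function_compose[of "- b" b a] a1 b1 by simp
      then have "cmod (h (Moebius_function 0 b a)) = c * cmod (f a)"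
        using c by (simp add: h_def norm_mult)
      also have "cmod (Moebius_function 0 b a) = pdisc a b"
        by (simp only: cmod_Moebius_eq_pdisc pdisc_commute[of a b])
      finally show ?thesis .
    qed
    then have "cmod (f a) \<le> pdisc a b"
      by (rule field_le_mult_one_interval)
    then show "cmod (delta_disc a f) \<le> pdisc a b"
      by (simp add: delta_disc_interior f(1) a1)
  qed (rule b)
qed

text \<open>For \<open>b\<close> inside, the Moebius map vanishing at \<open>b\<close> is extremal
  even if \<open>a\<close> is on the circle, being continuous on the closed disc. Only
  \<open>b\<close> on the circle calls for near extremal functions.\<close>

lemma pdisc_le_pseudohyp_dist_disc:
  assumes a: "cmod a \<le> 1" and b: "cmod b \<le> 1" and ab: "a \<noteq> b"
  shows "pdisc a b \<le> pseudohyp_dist_disc a b"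
proof (cases "cmod b < 1")
  case True
  let ?M = "Moebius_function 0 b"
  have M: "continuous_on (cball 0 1) ?M" "?M holomorphic_on ball 0 1"
    using True by (auto intro: continuous_on_Moebius Moebius_function_holomorphic)
  have "cmod (restrict ?M (ball 0 1) x) \<le> 1" if "cmod x < 1" for x
    using Moebius_function_norm_lt_1[OF True that, of 0] that by simp
  then have "cmod (delta_disc a (restrict ?M (ball 0 1))) \<le> pseudohyp_dist_disc a b"
    by (intro pseudohyp_dist_disc_upper disc_algebraI(1)[OF M] a)
      (simp_all only: disc_algebraI(2)[OF M] b Moebius_function_eq_zero)
  then show ?thesis
    by (simp only: disc_algebraI(2)[OF M] a cmod_Moebius_eq_pdisc pdisc_commute[of a b])
next
  case False
  with b have b1: "cmod b = 1" by simp
  have cb: "cnj b * b = 1" using b1 by (simp add: complex_norm_square[symmetric] mult.commute)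
  \<comment> \<open>As \<open>u\<close> has nonnegative real part, adding \<open>e > 0\<close> does
    not decrease its modulus. The quotients are therefore bounded by 1, vanish at \<open>b\<close>,
    and tend to 1 at \<open>a\<close> as \<open>e\<close> tends to 0.\<close>
  define u where "u x = 1 - cnj b * x" for x
  have Re_u: "0 \<le> Re (u x)" if "cmod x \<le> 1" for x
  proof -
    have "Re (cnj b * x) \<le> cmod (cnj b * x)" by (rule complex_Re_le_cmod)
    also have "\<dots> \<le> 1" using that b1 by (simp add: norm_mult)
    finally show ?thesis by (simp add: u_def)
  qed
  have ua: "u a \<noteq> 0"
  proof
    assume "u a = 0"
    then have "b * (cnj b * a) = b" by (simp add: u_def)
    then show False using cb ab by (simp add: mult.assoc[symmetric] mult.commute[of b "cnj b"])
  qed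
  have bound: "cmod (u a / (u a + of_real e)) \<le> pseudohyp_dist_disc a b" if e: "0 < e" for e
  proof -
    define g where "g x = u x / (u x + of_real e)" for x
    have nz: "u x + of_real e \<noteq> 0" if "cmod x \<le> 1" for x
    proof
      assume "u x + of_real e = 0"
      then have "Re (u x + of_real e) = 0" by simp
      then show False using Re_u[OF that] e by simp
    qed
    have g: "continuous_on (cball 0 1) g" "g holomorphic_on ball 0 1"
      unfolding g_def using nz
      by (auto simp: u_def intro!: continuous_intros holomorphic_intros)
    have "cmod (restrict g (ball 0 1) x) \<le> 1" if x: "cmod x < 1" for x
    proof -
      have "0 \<le> Re (u x)" using Re_u x by simp
      then have "(cmod (u x))\<^sup>2 \<le> (cmod (u x + of_real e))\<^sup>2"
        unfolding cmod_power2 using e by (auto intro!: add_mono power_mono)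
      then have "cmod (u x) \<le> cmod (u x + of_real e)"
        by (rule power2_le_imp_le) simp
      then show ?thesis using x nz[of x] by (simp add: g_def norm_divide)
    qed
    moreover have "g b = 0" by (simp add: g_def u_def cb)
    ultimately have "cmod (delta_disc a (restrict g (ball 0 1))) \<le> pseudohyp_dist_disc a b"
      by (intro pseudohyp_dist_disc_upper disc_algebraI(1)[OF g] a)
        (simp_all only: disc_algebraI(2)[OF g] b)
    then have "cmod (g a) \<le> pseudohyp_dist_disc a b"
      by (simp only: disc_algebraI(2)[OF g] a)
    then show ?thesis by (simp add: g_def)
  qed
  have "(\<lambda>n. cmod (u a / (u a + of_real (1 / real (Suc n))))) \<longlonglongrightarrow> cmod (u a / (u a + of_real 0))"
    using ua by (intro tendsto_intros LIMSEQ_Suc[OF lim_1_over_n]) auto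
  then have "cmod (u a / (u a + of_real 0)) \<le> pseudohyp_dist_disc a b"
    by (rule LIMSEQ_le_const2) (use bound in \<open>auto simp del: of_real_divide\<close>)
  moreover have "pdisc a b = 1"
    using a b ab b1 by (intro pdisc_boundary) auto
  ultimately show ?thesis using ua by (simp add: norm_divide)
qed

lemma pseudohyp_dist_disc_eq:
  assumes "cmod a \<le> 1" "cmod b \<le> 1"
  shows "pseudohyp_dist_disc a b = (if a = b then 0 else pdisc a b)"
proof (cases "a = b")
  case True
  have "pseudohyp_dist_disc a b \<le> 0"
    using assms True by (intro pseudohyp_dist_disc_least) auto
  then show ?thesis using True pseudohyp_dist_disc_nonneg[OF assms] by simp
next
  case False
  then show ?thesis
    using pseudohyp_dist_disc_le_pdisc[OF assms] pdisc_le_pseudohyp_dist_disc[OF assms] by auto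
qed

section \<open>Interpolation at roots of unity\<close>

definition unity_root :: "nat \<Rightarrow> nat \<Rightarrow> complex" where
  "unity_root M j = cis (2 * pi * real j / real M)"

lemma cmod_unity_root [simp]: "cmod (unity_root M j) = 1"
  by (simp add: unity_root_def)

lemma unity_root_power:
  assumes "0 < M"
  shows "unity_root M j ^ n = unity_root M j ^ (n mod M)"
proof -
  have "unity_root M j ^ M = cis (2 * pi * real j)"
    using assms unfolding unity_root_def Complex.DeMoivre by (simp add: mult_ac)
  then have "unity_root M j ^ M = 1"
    by (simp add: cis_multiple_2pi)
  then have "unity_root M j ^ (M * (n div M) + n mod M) = unity_root M j ^ (n mod M)"
    by (simp only: power_add power_mult power_one mult_1)
  then show ?thesis by simp
qed

text \<open>Off the diagonal the sum is geometric, and its ratio \<open>q\<close> is an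
  \<open>M\<close>-th root of unity other than 1, because \<open>m\<close> and \<open>k\<close>
  differ by less than \<open>M\<close>.\<close>

lemma unity_root_orthogonal:
  assumes m: "m < M" and k: "k < M"
  shows "(\<Sum>j<M. unity_root M j ^ m * cnj (unity_root M j) ^ k) = (if m = k then of_nat M else 0)"
proof (cases "m = k")
  case True
  have "unity_root M j ^ m * cnj (unity_root M j) ^ m = 1" for j
    using complex_norm_square[of "unity_root M j"] by (simp add: power_mult_distrib[symmetric])
  with True show ?thesis by simp
next
  case False
  define q where "q = cis (2 * pi * (real m - real k) / real M)"
  have M: "0 < M" using m by simp
  have q: "unity_root M j ^ m * cnj (unity_root M j) ^ k = q ^ j" for j
    unfolding unity_root_def q_def cis_cnj Complex.DeMoivre cis_mult
    by (rule arg_cong[of _ _ cis]) (simp add: diff_divide_distrib algebra_simps)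
  have "q \<noteq> 1"
  proof
    assume "q = 1"
    then have "cos (2 * pi * (real m - real k) / real M) = 1" by (simp add: q_def complex_eq_iff)
    then obtain n :: int where "2 * pi * (real m - real k) / real M = n * 2 * pi"
      using cos_one_2pi_int by auto
    then have "2 * pi * ((real m - real k) / real M) = 2 * pi * of_int n" by simp
    then have "(real m - real k) / real M = of_int n" by (subst (asm) mult_left_cancel) auto
    then have "real m - real k = of_int n * real M" using M by (simp add: divide_eq_eq)
    then have "real_of_int (int m - int k) = real_of_int (n * int M)" by simp
    then have eq: "int m - int k = n * int M" by (simp only: of_int_eq_iff)
    then have "n \<noteq> 0" using False by auto
    then have "int M \<le> \<bar>n * int M\<bar>" using M by (simp add: abs_mult)
    then show False unfolding eq[symmetric] using m k by linarith
  qed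
  moreover have "q ^ M = 1"
  proof -
    have "q ^ M = cis (2 * pi * (real m - real k))" using M by (simp add: q_def Complex.DeMoivre)
    also have "\<dots> = cis (2 * pi * of_int (int m - int k))" by simp
    also have "\<dots> = 1" by (rule cis_multiple_2pi) simp
    finally show ?thesis .
  qed
  ultimately have "(\<Sum>j<M. q ^ j) = 0" by (simp add: geometric_sum)
  with False show ?thesis by (simp add: q)
qed

text \<open>Interpolation replaces \<open>x ^ n\<close> by \<open>x ^ (n mod M)\<close>, so only
  Taylor terms from \<open>M\<close> on contribute; Cauchy's inequality bounds them geometrically.
  \<open>M\<close> does not depend on \<open>F\<close>, as required when the other coordinates vary.
  Nodes are used instead of Taylor coefficients because a value at a node is again \<open>f\<close>
  with one coordinate frozen.\<close>

lemma roots_of_unity_interpolation: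
  assumes r: "0 < r" "r < 1" and \<epsilon>: "0 < \<epsilon>"
  shows "\<exists>M>0. \<forall>F x. F holomorphic_on ball 0 (1 / r) \<longrightarrow> (\<forall>y. cmod y < 1 / r \<longrightarrow> cmod (F y) \<le> B) \<longrightarrow>
    cmod x \<le> 1 \<longrightarrow>
    cmod (F x - 1 / of_nat M * (\<Sum>j<M. F (unity_root M j) * (\<Sum>k<M. (x * cnj (unity_root M j)) ^ k))) \<le> \<epsilon>"
proof -
  \<comment> \<open>A radius strictly between 1 and \<open>1 / r\<close>: Cauchy's inequality then
    applies on a closed disc inside the domain, with ratio \<open>t\<close> below 1.\<close>
  define s where "s = (1 + 1 / r) / 2"
  have r1: "1 < 1 / r" using r by simp
  then have s: "1 < s" "s < 1 / r" by (simp_all add: s_def)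
  define t where "t = 1 / s"
  have t: "0 < t" "t < 1" using s by (simp_all add: t_def)
  have "(\<lambda>M. 2 * B * t ^ M * (1 / (1 - t))) \<longlonglongrightarrow> 2 * B * 0 * (1 / (1 - t))"
    using t by (intro tendsto_intros LIMSEQ_power_zero) auto
  then have "\<forall>\<^sub>F M in sequentially. 2 * B * t ^ M * (1 / (1 - t)) < \<epsilon>"
    using \<epsilon> by (intro order_tendstoD) auto
  then have "\<forall>\<^sub>F M in sequentially. 2 * B * t ^ M * (1 / (1 - t)) < \<epsilon> \<and> 0 < M"
    using eventually_gt_at_top[of 0] by eventually_elim simp
  then obtain M where M: "2 * B * t ^ M * (1 / (1 - t)) < \<epsilon>" "0 < M"
    by (auto simp: eventually_at_top_linorder)
  show ?thesis
  proof (intro exI[of _ M] conjI allI impI M(2))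
    fix F x
    assume F: "F holomorphic_on ball 0 (1 / r)" and "\<forall>y. cmod y < 1 / r \<longrightarrow> cmod (F y) \<le> B"
      and x: "cmod x \<le> 1"
    then have F: "F holomorphic_on ball 0 (1 / r)" "\<And>y. cmod y < 1 / r \<Longrightarrow> cmod (F y) \<le> B"
      by blast+
    define a where "a n = (deriv ^^ n) F 0 / fact n" for n
    have Fs: "(\<lambda>n. a n * y ^ n) sums F y" if "cmod y \<le> 1" for y
      using holomorphic_power_series[OF F(1), of y] that r1 by (simp add: a_def)
    have "0 \<le> B" using order.trans[OF norm_ge_zero F(2)[of 0]] r by simp
    have a_le: "cmod (a n) \<le> B * t ^ n" for n
    proof -
      have sub: "cball 0 s \<subseteq> ball (0::complex) (1 / r)" using s by auto
      have "cmod ((deriv ^^ n) F 0) \<le> fact n * B / s ^ n"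
        using F s sub by (intro Cauchy_inequality)
          (auto intro: holomorphic_on_subset holomorphic_on_imp_continuous_on)
      then show ?thesis
        by (simp add: a_def t_def norm_divide power_one_over field_simps)
    qed
    define w where "w = unity_root M"
    have "(\<lambda>n. 1 / of_nat M * (\<Sum>j<M. a n * w j ^ n * (\<Sum>k<M. (x * cnj (w j)) ^ k)))
        sums (1 / of_nat M * (\<Sum>j<M. F (w j) * (\<Sum>k<M. (x * cnj (w j)) ^ k)))"
      by (intro sums_mult sums_sum sums_mult2 Fs) (simp add: w_def)
    moreover have "1 / of_nat M * (\<Sum>j<M. a n * w j ^ n * (\<Sum>k<M. (x * cnj (w j)) ^ k)) = a n * x ^ (n mod M)" for n
    proof -
      have "(\<Sum>j<M. a n * w j ^ n * (\<Sum>k<M. (x * cnj (w j)) ^ k)) =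
          (\<Sum>j<M. \<Sum>k<M. a n * x ^ k * (w j ^ (n mod M) * cnj (w j) ^ k))"
        using M(2) unity_root_power[of M _ n] by (simp add: w_def sum_distrib_left power_mult_distrib mult_ac)
      also have "\<dots> = (\<Sum>k<M. a n * x ^ k * (\<Sum>j<M. w j ^ (n mod M) * cnj (w j) ^ k))"
        by (subst sum.swap) (simp add: sum_distrib_left)
      also have "\<dots> = (\<Sum>k<M. a n * x ^ k * (if n mod M = k then of_nat M else 0))"
        using M(2) by (intro sum.cong) (auto simp: w_def unity_root_orthogonal)
      also have "\<dots> = a n * x ^ (n mod M) * of_nat M"
        using M(2) by (simp add: if_distrib cong: if_cong)
      finally show ?thesis using M(2) by simp
    qed
    ultimately have "(\<lambda>n. a n * x ^ (n mod M)) sums (1 / of_nat M * (\<Sum>j<M. F (w j) * (\<Sum>k<M. (x * cnj (w j)) ^ k)))"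
      by simp
    from sums_diff[OF Fs[OF x] this]
    have err: "(\<lambda>n. a n * (x ^ n - x ^ (n mod M))) sums
        (F x - 1 / of_nat M * (\<Sum>j<M. F (w j) * (\<Sum>k<M. (x * cnj (w j)) ^ k)))"
      by (simp add: right_diff_distrib)
    \<comment> \<open>The first \<open>M\<close> terms vanish since there
      \<open>n mod M = n\<close>.\<close>
    then have err': "(\<lambda>n. a (n + M) * (x ^ (n + M) - x ^ ((n + M) mod M))) sums
        (F x - 1 / of_nat M * (\<Sum>j<M. F (w j) * (\<Sum>k<M. (x * cnj (w j)) ^ k)))"
      using sums_iff_shift[of "\<lambda>n. a n * (x ^ n - x ^ (n mod M))" M] by simp
    have geo: "(\<lambda>n. 2 * B * t ^ M * t ^ n) sums (2 * B * t ^ M * (1 / (1 - t)))"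
      using t by (intro sums_mult geometric_sums) auto
    have "cmod (F x - 1 / of_nat M * (\<Sum>j<M. F (w j) * (\<Sum>k<M. (x * cnj (w j)) ^ k))) \<le> 2 * B * t ^ M * (1 / (1 - t))"
      unfolding sums_unique[OF err'] sums_unique[OF geo]
    proof (rule norm_suminf_le[OF _ sums_summable[OF geo]])
      fix n
      have "cmod (x ^ (n + M) - x ^ ((n + M) mod M)) \<le> 1 + 1"
        using x by (intro order.trans[OF norm_triangle_ineq4] add_mono) (simp_all add: norm_power power_le_one)
      then have "cmod (a (n + M)) * cmod (x ^ (n + M) - x ^ ((n + M) mod M)) \<le> B * t ^ (n + M) * 2"
        using \<open>0 \<le> B\<close> t by (intro mult_mono a_le) auto
      then show "cmod (a (n + M) * (x ^ (n + M) - x ^ ((n + M) mod M))) \<le> 2 * B * t ^ M * t ^ n"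
        by (simp add: norm_mult power_add mult_ac)
    qed
    with M(1) show "cmod (F x - 1 / of_nat M * (\<Sum>j<M. F (unity_root M j) * (\<Sum>k<M. (x * cnj (unity_root M j)) ^ k))) \<le> \<epsilon>"
      by (simp add: w_def)
  qed
qed

section \<open>The algebra of uniformly continuous holomorphic functions\<close>

lemma Au_c0_restrictI:
  assumes hol: "\<And>x. norm x < 1 \<Longrightarrow> \<exists>L. (F has_derivative L) (at x) \<and> (\<forall>c h. L (c0_scaleC c h) = c * L h)"
    and uc: "\<And>e. 0 < e \<Longrightarrow> \<exists>d>0. \<forall>x y. norm x < 1 \<longrightarrow> norm y < 1 \<longrightarrow> norm (x - y) < d \<longrightarrow> cmod (F x - F y) < e"
  shows "restrict F (ball 0 1) \<in> Au_c0"
proof -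
  have "holomorphic_c0 (restrict F (ball 0 1)) (ball 0 1)"
    unfolding holomorphic_c0_def
  proof (intro ballI)
    fix x :: c0 assume x: "x \<in> ball 0 1"
    then have "norm x < 1" by simp
    from hol[OF this] obtain L where L: "(F has_derivative L) (at x)" "\<forall>c h. L (c0_scaleC c h) = c * L h"
      by blast
    have "(restrict F (ball 0 1) has_derivative L) (at x)"
      by (rule has_derivative_transform_within_open[OF L(1) open_ball x]) simp
    with L(2) show "\<exists>L. (restrict F (ball 0 1) has_derivative L) (at x) \<and> (\<forall>c h. L (c0_scaleC c h) = c * L h)"
      by blast
  qed
  moreover have "uniformly_continuous_on (ball 0 1) (restrict F (ball 0 1))"
    unfolding uniformly_continuous_on_def
  proof (intro allI impI)
    fix e :: real assume "0 < e"
    from uc[OF this] obtain d where "d > 0"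
      "\<forall>x y. norm x < 1 \<longrightarrow> norm y < 1 \<longrightarrow> norm (x - y) < d \<longrightarrow> cmod (F x - F y) < e" by blast
    then show "\<exists>d>0. \<forall>x\<in>ball 0 1. \<forall>y\<in>ball 0 1. dist y x < d \<longrightarrow>
        dist (restrict F (ball 0 1) y) (restrict F (ball 0 1) x) < e"
      by (intro exI[of _ d]) (simp add: dist_norm)
  qed
  ultimately show ?thesis by (simp add: Au_c0_def)
qed

lemma Au_c0_derivative:
  assumes "f \<in> Au_c0" "norm x < 1"
  obtains L where "(f has_derivative L) (at x)" "\<And>c h. L (c0_scaleC c h) = c * L h"
  using assms unfolding Au_c0_def holomorphic_c0_def by (auto simp: ball_def)

lemma Au_c0_const: "(\<lambda>x\<in>ball 0 1. c) \<in> Au_c0"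
proof (rule Au_c0_restrictI)
  show "\<exists>L. ((\<lambda>x. c) has_derivative L) (at x) \<and> (\<forall>c h. L (c0_scaleC c h) = c * L h)" for x
    by (intro exI[of _ "\<lambda>_. 0"]) simp
qed (auto intro: exI[of _ 1])

lemma Au_c0_add:
  assumes f: "f \<in> Au_c0" and g: "g \<in> Au_c0"
  shows "(\<lambda>x\<in>ball 0 1. f x + g x) \<in> Au_c0"
proof (rule Au_c0_restrictI)
  fix x :: c0 assume x: "norm x < 1"
  obtain L K where L: "(f has_derivative L) (at x)" "\<And>c h. L (c0_scaleC c h) = c * L h"
    and K: "(g has_derivative K) (at x)" "\<And>c h. K (c0_scaleC c h) = c * K h"
    using Au_c0_derivative[OF f x] Au_c0_derivative[OF g x] by metis
  show "\<exists>L. ((\<lambda>x. f x + g x) has_derivative L) (at x) \<and> (\<forall>c h. L (c0_scaleC c h) = c * L h)"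
    by (intro exI[of _ "\<lambda>h. L h + K h"] conjI has_derivative_add L(1) K(1))
      (simp add: L(2) K(2) distrib_left)
next
  fix e :: real assume "0 < e"
  then have e2: "0 < e / 2" by simp
  obtain d1 where d1: "0 < d1" "\<And>x y. norm x < 1 \<Longrightarrow> norm y < 1 \<Longrightarrow> norm (x - y) < d1 \<Longrightarrow> cmod (f x - f y) < e / 2"
    using Au_c0_uniformly_continuousD[OF f e2] by metis
  obtain d2 where d2: "0 < d2" "\<And>x y. norm x < 1 \<Longrightarrow> norm y < 1 \<Longrightarrow> norm (x - y) < d2 \<Longrightarrow> cmod (g x - g y) < e / 2"
    using Au_c0_uniformly_continuousD[OF g e2] by metis
  have "cmod (f x + g x - (f y + g y)) < e" if "norm x < 1" "norm y < 1" "norm (x - y) < min d1 d2" for x y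
    using d1(2)[of x y] d2(2)[of x y] that norm_triangle_ineq[of "f x - f y" "g x - g y"]
    by (simp add: algebra_simps)
  then show "\<exists>d>0. \<forall>x y. norm x < 1 \<longrightarrow> norm y < 1 \<longrightarrow> norm (x - y) < d \<longrightarrow> cmod (f x + g x - (f y + g y)) < e"
    using d1(1) d2(1) by (intro exI[of _ "min d1 d2"]) auto
qed

lemma Au_c0_mult:
  assumes f: "f \<in> Au_c0" and g: "g \<in> Au_c0"
  shows "(\<lambda>x\<in>ball 0 1. f x * g x) \<in> Au_c0"
proof (rule Au_c0_restrictI)
  fix x :: c0 assume x: "norm x < 1"
  obtain L K where L: "(f has_derivative L) (at x)" "\<And>c h. L (c0_scaleC c h) = c * L h"
    and K: "(g has_derivative K) (at x)" "\<And>c h. K (c0_scaleC c h) = c * K h"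
    using Au_c0_derivative[OF f x] Au_c0_derivative[OF g x] by metis
  show "\<exists>L. ((\<lambda>x. f x * g x) has_derivative L) (at x) \<and> (\<forall>c h. L (c0_scaleC c h) = c * L h)"
    by (intro exI[of _ "\<lambda>h. f x * K h + L h * g x"] conjI has_derivative_mult L(1) K(1))
      (simp add: L(2) K(2) algebra_simps)
next
  fix e :: real assume e: "0 < e"
  obtain A where A: "0 < A" "\<And>x. norm x < 1 \<Longrightarrow> cmod (f x) \<le> A" using Au_c0_bounded[OF f] by blast
  obtain B where B: "0 < B" "\<And>x. norm x < 1 \<Longrightarrow> cmod (g x) \<le> B" using Au_c0_bounded[OF g] by blast
  have eA: "0 < e / (2 * A)" and eB: "0 < e / (2 * B)" using e A B by auto
  obtain d1 where d1: "0 < d1" "\<And>x y. norm x < 1 \<Longrightarrow> norm y < 1 \<Longrightarrow> norm (x - y) < d1 \<Longrightarrow> cmod (f x - f y) < e / (2 * B)"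
    using Au_c0_uniformly_continuousD[OF f eB] by metis
  obtain d2 where d2: "0 < d2" "\<And>x y. norm x < 1 \<Longrightarrow> norm y < 1 \<Longrightarrow> norm (x - y) < d2 \<Longrightarrow> cmod (g x - g y) < e / (2 * A)"
    using Au_c0_uniformly_continuousD[OF g eA] by metis
  have "cmod (f x * g x - f y * g y) < e" if xy: "norm x < 1" "norm y < 1" "norm (x - y) < min d1 d2" for x y
  proof -
    have 1: "cmod (f x - f y) * cmod (g x) \<le> e / (2 * B) * B"
      using d1(2)[of x y] xy B eB by (intro mult_mono) (auto intro: less_imp_le)
    have 2: "cmod (f y) * cmod (g x - g y) < A * (e / (2 * A))"
      using d2(2)[of x y] xy A e
      by (intro le_less_trans[OF mult_right_mono mult_strict_left_mono]) auto
    have "f x * g x - f y * g y = (f x - f y) * g x + f y * (g x - g y)" by (simp add: algebra_simps)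
    then have "cmod (f x * g x - f y * g y) \<le> cmod (f x - f y) * cmod (g x) + cmod (f y) * cmod (g x - g y)"
      using norm_triangle_ineq[of "(f x - f y) * g x" "f y * (g x - g y)"] by (simp add: norm_mult)
    moreover have "e / (2 * B) * B = e / 2" "A * (e / (2 * A)) = e / 2" using A B by auto
    ultimately show ?thesis using 1 2 by linarith
  qed
  then show "\<exists>d>0. \<forall>x y. norm x < 1 \<longrightarrow> norm y < 1 \<longrightarrow> norm (x - y) < d \<longrightarrow> cmod (f x * g x - f y * g y) < e"
    using d1(1) d2(1) by (intro exI[of _ "min d1 d2"]) auto
qed

lemma Au_c0_scale:
  assumes "f \<in> Au_c0"
  shows "(\<lambda>x\<in>ball 0 1. c * f x) \<in> Au_c0"
proof -
  have "(\<lambda>x\<in>ball 0 1. (\<lambda>x\<in>ball 0 1. c) x * f x) = (\<lambda>x\<in>ball 0 1. c * f x)"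
    by (rule restrict_ext) simp
  with Au_c0_mult[OF Au_c0_const[of c] assms] show ?thesis by simp
qed

text \<open>Supplies the inverse for the spectral argument in \<open>character_le\<close>.\<close>

lemma Au_c0_inverse:
  assumes f: "f \<in> Au_c0" and m: "0 < m" "\<And>x. norm x < 1 \<Longrightarrow> m \<le> cmod (f x)"
  shows "(\<lambda>x\<in>ball 0 1. inverse (f x)) \<in> Au_c0"
proof (rule Au_c0_restrictI)
  fix x :: c0 assume x: "norm x < 1"
  obtain L where L: "(f has_derivative L) (at x)" "\<And>c h. L (c0_scaleC c h) = c * L h"
    using Au_c0_derivative[OF f x] by metis
  have "f x \<noteq> 0" using m(1) m(2)[OF x] by auto
  then show "\<exists>L. ((\<lambda>x. inverse (f x)) has_derivative L) (at x) \<and> (\<forall>c h. L (c0_scaleC c h) = c * L h)"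
    by (intro exI[of _ "\<lambda>h. - (inverse (f x) * L h * inverse (f x))"] conjI Deriv.has_derivative_inverse L(1))
      (simp_all add: L(2))
next
  fix e :: real assume e: "0 < e"
  then have "0 < e * (m * m)" using m(1) by simp
  from Au_c0_uniformly_continuousD[OF f this] obtain d where d: "0 < d"
    "\<And>x y. norm x < 1 \<Longrightarrow> norm y < 1 \<Longrightarrow> norm (x - y) < d \<Longrightarrow> cmod (f x - f y) < e * (m * m)" by metis
  have "cmod (inverse (f x) - inverse (f y)) < e" if xy: "norm x < 1" "norm y < 1" "norm (x - y) < d" for x y
  proof -
    have nz: "f x \<noteq> 0" "f y \<noteq> 0" using m(1) m(2)[OF xy(1)] m(2)[OF xy(2)] by auto
    have "cmod (inverse (f x) - inverse (f y)) = cmod (f x - f y) / (cmod (f x) * cmod (f y))"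
      using nz by (simp add: inverse_diff_inverse norm_mult norm_inverse norm_minus_commute divide_inverse mult_ac)
    also have "\<dots> \<le> cmod (f x - f y) / (m * m)"
      using m xy nz by (intro divide_left_mono mult_mono mult_pos_pos) auto
    also have "\<dots> < e"
      using d(2)[OF xy] m(1) by (simp add: pos_divide_less_eq)
    finally show ?thesis .
  qed
  with d(1) show "\<exists>d>0. \<forall>x y. norm x < 1 \<longrightarrow> norm y < 1 \<longrightarrow> norm (x - y) < d \<longrightarrow> cmod (inverse (f x) - inverse (f y)) < e"
    by blast
qed

lemma Au_c0_compose_affine:
  assumes f: "f \<in> Au_c0" and T: "bounded_linear T" "\<And>c h. T (c0_scaleC c h) = c0_scaleC c (T h)"
    and lt1: "\<And>x. norm x < 1 \<Longrightarrow> norm (T x + a) < 1"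
  shows "(\<lambda>x\<in>ball 0 1. f (T x + a)) \<in> Au_c0"
proof (rule Au_c0_restrictI)
  fix x :: c0 assume x: "norm x < 1"
  obtain L where L: "(f has_derivative L) (at (T x + a))" "\<And>c h. L (c0_scaleC c h) = c * L h"
    using Au_c0_derivative[OF f lt1[OF x]] by metis
  have "((\<lambda>x. T x + a) has_derivative T) (at x)"
    using bounded_linear_imp_has_derivative[OF T(1)] by (auto intro!: derivative_eq_intros)
  from has_derivative_compose[OF this L(1)]
  show "\<exists>L. ((\<lambda>x. f (T x + a)) has_derivative L) (at x) \<and> (\<forall>c h. L (c0_scaleC c h) = c * L h)"
    by (intro exI[of _ "\<lambda>h. L (T h)"]) (simp add: L(2) T(2))
next
  fix e :: real assume e: "0 < e"
  from Au_c0_uniformly_continuousD[OF f this] obtain d where d: "0 < d"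
    "\<And>x y. norm x < 1 \<Longrightarrow> norm y < 1 \<Longrightarrow> norm (x - y) < d \<Longrightarrow> cmod (f x - f y) < e" by metis
  obtain K where K: "0 < K" "\<And>x. norm (T x) \<le> norm x * K"
    using bounded_linear.pos_bounded[OF T(1)] by blast
  have "cmod (f (T x + a) - f (T y + a)) < e" if xy: "norm x < 1" "norm y < 1" "norm (x - y) < d / K" for x y
  proof -
    have "norm (T x + a - (T y + a)) \<le> norm (x - y) * K"
      using K(2)[of "x - y"] linear_diff[OF bounded_linear.linear[OF T(1)]] by simp
    also have "\<dots> < d" using xy(3) K(1) by (simp add: pos_less_divide_eq)
    finally show ?thesis using lt1 xy by (intro d(2))
  qed
  moreover have "0 < d / K" using d(1) K(1) by simp
  ultimately show "\<exists>d>0. \<forall>x y. norm x < 1 \<longrightarrow> norm y < 1 \<longrightarrow> norm (x - y) < d \<longrightarrow> cmod (f (T x + a) - f (T y + a)) < e"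
    by blast
qed

section \<open>Characters\<close>

lemma charactersD:
  assumes "\<phi> \<in> characters (ball 0 1) Au_c0"
  shows "\<And>f g. f \<in> Au_c0 \<Longrightarrow> g \<in> Au_c0 \<Longrightarrow> \<phi> (\<lambda>x\<in>ball 0 1. f x + g x) = \<phi> f + \<phi> g"
    and "\<And>c f. f \<in> Au_c0 \<Longrightarrow> \<phi> (\<lambda>x\<in>ball 0 1. c * f x) = c * \<phi> f"
    and "\<And>f g. f \<in> Au_c0 \<Longrightarrow> g \<in> Au_c0 \<Longrightarrow> \<phi> (\<lambda>x\<in>ball 0 1. f x * g x) = \<phi> f * \<phi> g"
    and "\<phi> \<in> extensional Au_c0"
  using assms by (auto simp: characters_def)

lemma Au_c0_restrict [simp]: "f \<in> Au_c0 \<Longrightarrow> restrict f (ball 0 1) = f"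
  by (simp add: Au_c0_def extensional_restrict)

lemma character_const:
  assumes \<phi>: "\<phi> \<in> characters (ball 0 1) Au_c0"
  shows "\<phi> (\<lambda>x\<in>ball 0 1. c) = c"
proof -
  obtain f where f: "f \<in> Au_c0" "\<phi> f \<noteq> 0"
    using \<phi> by (auto simp: characters_def)
  have "(\<lambda>x\<in>ball 0 1. (\<lambda>x\<in>ball 0 1. c) x * f x) = (\<lambda>x\<in>ball 0 1. c * f x)"
    by (rule restrict_ext) simp
  then have "\<phi> (\<lambda>x\<in>ball 0 1. c) * \<phi> f = c * \<phi> f"
    by (simp only: charactersD(3)[OF \<phi> Au_c0_const f(1), symmetric] charactersD(2)[OF \<phi> f(1)])
  with f(2) show ?thesis by simp
qed

text \<open>Otherwise \<open>f\<close> minus the constant \<open>\<phi> f\<close> would be bounded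
  away from 0, hence invertible in the algebra, and yet be annihilated by \<open>\<phi>\<close>.
  Continuity of characters is thus automatic.\<close>

lemma character_le:
  assumes \<phi>: "\<phi> \<in> characters (ball 0 1) Au_c0" and f: "f \<in> Au_c0"
    and B: "\<And>x. norm x < 1 \<Longrightarrow> cmod (f x) \<le> B"
  shows "cmod (\<phi> f) \<le> B"
proof (rule ccontr)
  assume "\<not> ?thesis"
  then have lt: "B < cmod (\<phi> f)" by simp
  define g where "g = (\<lambda>x\<in>ball 0 1. (\<lambda>x\<in>ball 0 1. - \<phi> f) x + f x)"
  have g: "g \<in> Au_c0" unfolding g_def by (intro Au_c0_add Au_c0_const f)
  have g_low: "cmod (\<phi> f) - B \<le> cmod (g x)" if "norm x < 1" for x
    using B[OF that] norm_triangle_ineq2[of "\<phi> f" "f x"] that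
    by (simp add: g_def norm_minus_commute)
  have inv: "(\<lambda>x\<in>ball 0 1. inverse (g x)) \<in> Au_c0"
    using lt g_low by (intro Au_c0_inverse[OF g, of "cmod (\<phi> f) - B"]) auto
  have "\<phi> g = - \<phi> f + \<phi> f"
    unfolding g_def by (simp only: charactersD(1)[OF \<phi> Au_c0_const f] character_const[OF \<phi>])
  then have "\<phi> g = 0" by simp
  have "g x \<noteq> 0" if "norm x < 1" for x using g_low[OF that] lt by auto
  then have "(\<lambda>x\<in>ball 0 1. g x * (\<lambda>x\<in>ball 0 1. inverse (g x)) x) = (\<lambda>x\<in>ball 0 1. 1)"
    by (intro restrict_ext) simp
  then have "\<phi> g * \<phi> (\<lambda>x\<in>ball 0 1. inverse (g x)) = 1"
    using charactersD(3)[OF \<phi> g inv] character_const[OF \<phi>, of 1] by simp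
  with \<open>\<phi> g = 0\<close> show False by simp
qed

lemma character_diff_le:
  assumes \<phi>: "\<phi> \<in> characters (ball 0 1) Au_c0" and f: "f \<in> Au_c0" and g: "g \<in> Au_c0"
    and B: "\<And>x. norm x < 1 \<Longrightarrow> cmod (f x - g x) \<le> B"
  shows "cmod (\<phi> f - \<phi> g) \<le> B"
proof -
  let ?h = "\<lambda>x\<in>ball 0 1. f x + (\<lambda>x\<in>ball 0 1. - 1 * g x) x"
  have g': "(\<lambda>x\<in>ball 0 1. - 1 * g x) \<in> Au_c0" by (rule Au_c0_scale[OF g])
  have "\<phi> ?h = \<phi> f + - 1 * \<phi> g"
    by (simp only: charactersD(1)[OF \<phi> f g'] charactersD(2)[OF \<phi> g])
  moreover have "cmod (\<phi> ?h) \<le> B"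
    using B by (intro character_le[OF \<phi> Au_c0_add[OF f g']]) simp
  ultimately show ?thesis by simp
qed

text \<open>Functions are identified with their restriction to the ball, the form in which they belong
  to the algebra.\<close>

definition chars_agree ::
  "((c0 \<Rightarrow> complex) \<Rightarrow> complex) \<Rightarrow> ((c0 \<Rightarrow> complex) \<Rightarrow> complex) \<Rightarrow> (c0 \<Rightarrow> complex) \<Rightarrow> bool" where
  "chars_agree \<phi> \<psi> F \<longleftrightarrow>
     restrict F (ball 0 1) \<in> Au_c0 \<and> \<phi> (restrict F (ball 0 1)) = \<psi> (restrict F (ball 0 1))"

lemma coord_Au_c0: "(\<lambda>x\<in>ball 0 1. coord x n) \<in> Au_c0"
  and delta_c0_coord: "z \<in> cball 0 1 \<Longrightarrow> delta_c0 z (\<lambda>x\<in>ball 0 1. coord x n) = apply_bcontfun z n"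
proof -
  let ?id = "\<lambda>x\<in>ball 0 1. x :: complex"
  have eq: "(\<lambda>x\<in>ball 0 1. ?id (coord x n)) = (\<lambda>x\<in>ball 0 1. coord x n)"
  proof (rule restrict_ext)
    fix x :: c0 assume "x \<in> ball 0 1"
    then have "cmod (coord x n) < 1" using coord_le_norm[of x n] by simp
    then show "?id (coord x n) = coord x n" by simp
  qed
  have id: "continuous_on (cball 0 1) (\<lambda>x::complex. x)" "(\<lambda>x::complex. x) holomorphic_on ball 0 1"
    by (auto intro: continuous_intros holomorphic_intros)
  show "(\<lambda>x\<in>ball 0 1. coord x n) \<in> Au_c0"
    using coord_compose_Au_c0(1)[OF disc_algebraI(1)[OF id], of n] unfolding eq .
  assume z: "z \<in> cball 0 1"
  then have "cmod (apply_bcontfun z n) \<le> 1" using linf_cball_iff by blast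
  then show "delta_c0 z (\<lambda>x\<in>ball 0 1. coord x n) = apply_bcontfun z n"
    using coord_compose_Au_c0(2)[OF disc_algebraI(1)[OF id] z, of n] disc_algebraI(2)[OF id]
    unfolding eq by simp
qed

section \<open>Characters that agree on the coordinates\<close>

context
  fixes \<phi> \<psi> :: "(c0 \<Rightarrow> complex) \<Rightarrow> complex"
  assumes \<phi>: "\<phi> \<in> characters (ball 0 1) Au_c0" and \<psi>: "\<psi> \<in> characters (ball 0 1) Au_c0"
    and coord_eq: "\<And>n. \<phi> (\<lambda>x\<in>ball 0 1. coord x n) = \<psi> (\<lambda>x\<in>ball 0 1. coord x n)"
begin

lemma chars_agree_const: "chars_agree \<phi> \<psi> (\<lambda>x. c)"
  by (simp only: chars_agree_def Au_c0_const character_const[OF \<phi>] character_const[OF \<psi>] simp_thms)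

lemma chars_agree_coord: "chars_agree \<phi> \<psi> (\<lambda>x. coord x n)"
  by (simp only: chars_agree_def coord_Au_c0 coord_eq simp_thms)

lemma chars_agree_add:
  assumes F: "chars_agree \<phi> \<psi> F" and G: "chars_agree \<phi> \<psi> G"
  shows "chars_agree \<phi> \<psi> (\<lambda>x. F x + G x)"
proof -
  let ?F = "restrict F (ball 0 1)" and ?G = "restrict G (ball 0 1)"
  have eq: "(\<lambda>x\<in>ball 0 1. F x + G x) = (\<lambda>x\<in>ball 0 1. ?F x + ?G x)" by (rule restrict_ext) simp
  have F': "?F \<in> Au_c0" "\<phi> ?F = \<psi> ?F" and G': "?G \<in> Au_c0" "\<phi> ?G = \<psi> ?G"
    using F G by (simp_all only: chars_agree_def)
  show ?thesis
    using charactersD(1)[OF \<phi> F'(1) G'(1)] charactersD(1)[OF \<psi> F'(1) G'(1)] Au_c0_add[OF F'(1) G'(1)]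
    unfolding chars_agree_def eq F'(2) G'(2) by simp
qed

lemma chars_agree_mult:
  assumes F: "chars_agree \<phi> \<psi> F" and G: "chars_agree \<phi> \<psi> G"
  shows "chars_agree \<phi> \<psi> (\<lambda>x. F x * G x)"
proof -
  let ?F = "restrict F (ball 0 1)" and ?G = "restrict G (ball 0 1)"
  have eq: "(\<lambda>x\<in>ball 0 1. F x * G x) = (\<lambda>x\<in>ball 0 1. ?F x * ?G x)" by (rule restrict_ext) simp
  have F': "?F \<in> Au_c0" "\<phi> ?F = \<psi> ?F" and G': "?G \<in> Au_c0" "\<phi> ?G = \<psi> ?G"
    using F G by (simp_all only: chars_agree_def)
  show ?thesis
    using charactersD(3)[OF \<phi> F'(1) G'(1)] charactersD(3)[OF \<psi> F'(1) G'(1)] Au_c0_mult[OF F'(1) G'(1)]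
    unfolding chars_agree_def eq F'(2) G'(2) by simp
qed

lemma chars_agree_sum:
  "(\<And>i. i \<in> I \<Longrightarrow> chars_agree \<phi> \<psi> (F i)) \<Longrightarrow> chars_agree \<phi> \<psi> (\<lambda>x. \<Sum>i\<in>I. F i x)"
proof (induction I rule: infinite_finite_induct)
  case (insert i I)
  then have "chars_agree \<phi> \<psi> (\<lambda>x. F i x + (\<Sum>i\<in>I. F i x))"
    by (intro chars_agree_add) auto
  with insert show ?case by simp
qed (use chars_agree_const[of 0] in simp_all)

lemma chars_agree_power: "chars_agree \<phi> \<psi> F \<Longrightarrow> chars_agree \<phi> \<psi> (\<lambda>x. F x ^ k)"
  by (induction k) (use chars_agree_const[of 1] in \<open>simp_all add: chars_agree_mult\<close>)

text \<open>Characters are contractive by \<open>character_diff_le\<close>, so agreement survives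
  uniform limits.\<close>

lemma chars_agree_limit:
  assumes F: "restrict F (ball 0 1) \<in> Au_c0"
    and approx: "\<And>\<epsilon>. 0 < \<epsilon> \<Longrightarrow> \<exists>G. chars_agree \<phi> \<psi> G \<and> (\<forall>x. norm x < 1 \<longrightarrow> cmod (F x - G x) \<le> \<epsilon>)"
  shows "chars_agree \<phi> \<psi> F"
proof -
  let ?F = "restrict F (ball 0 1)"
  have "cmod (\<phi> ?F - \<psi> ?F) \<le> 0 + e" if e: "0 < e" for e
  proof -
    have "0 < e / 2" using e by simp
    from approx[OF this] obtain G where G: "chars_agree \<phi> \<psi> G" "\<And>x. norm x < 1 \<Longrightarrow> cmod (F x - G x) \<le> e / 2"
      by blast
    let ?G = "restrict G (ball 0 1)"
    have G': "?G \<in> Au_c0" "\<phi> ?G = \<psi> ?G" using G(1) by (auto simp: chars_agree_def)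
    have le: "cmod (?F x - ?G x) \<le> e / 2" if "norm x < 1" for x
      using G(2)[OF that] that by simp
    have "cmod (\<phi> ?F - \<phi> ?G) \<le> e / 2" "cmod (\<psi> ?F - \<psi> ?G) \<le> e / 2"
      by (rule character_diff_le[OF \<phi> F G'(1) le] character_diff_le[OF \<psi> F G'(1) le]; assumption)+
    then show ?thesis
      using norm_triangle_ineq4[of "\<phi> ?F - \<phi> ?G" "\<psi> ?F - \<psi> ?G"] G'(2) by simp
  qed
  then have "cmod (\<phi> ?F - \<psi> ?F) \<le> 0" by (rule field_le_epsilon)
  with F show ?thesis by (simp add: chars_agree_def)
qed

text \<open>Interpolating at roots of unity in one coordinate after the other reduces a function of
  finitely many coordinates to polynomials in the coordinates.\<close>

lemma chars_agree_trunc: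
  assumes f: "f \<in> Au_c0" and r: "0 < r" "r < 1"
  shows "(\<And>n. n < K \<Longrightarrow> coord c n = 0) \<Longrightarrow> norm c \<le> 1 \<Longrightarrow>
    chars_agree \<phi> \<psi> (\<lambda>x. f (r *\<^sub>R trunc K (coord x) + r *\<^sub>R c))"
proof (induction K arbitrary: c)
  case 0
  have "trunc 0 (coord x) = 0" for x by (rule c0_eqI) simp
  then show ?case using chars_agree_const by simp
next
  case (Suc K)
  have le1: "norm (trunc k (coord x) + c) \<le> 1" if "k \<le> Suc K" "norm x < 1" for k x
    using Suc.prems that norm_trunc_coord_le[of k x] by (intro norm_add_disjoint_le) auto
  have lt1: "norm (r *\<^sub>R trunc k (coord x) + r *\<^sub>R c) < 1" if "k \<le> Suc K" "norm x < 1" for k x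
  proof -
    have "norm (r *\<^sub>R (trunc k (coord x) + c)) \<le> r"
      using le1[OF that] r by (simp add: mult_left_le)
    then show ?thesis using r by (simp add: scaleR_right_distrib)
  qed
  show ?case
  proof (rule chars_agree_limit)
    have "bounded_linear (\<lambda>x. r *\<^sub>R trunc (Suc K) (coord x))"
    proof (rule bounded_linear_intro[where K = 1])
      show "norm (r *\<^sub>R trunc (Suc K) (coord x)) \<le> norm x * 1" for x
        using norm_trunc_coord_le[of "Suc K" x] r mult_left_le_one_le[of "norm (trunc (Suc K) (coord x))" r]
        by simp
    qed (auto intro!: c0_eqI simp: algebra_simps)
    then show "(\<lambda>x\<in>ball 0 1. f (r *\<^sub>R trunc (Suc K) (coord x) + r *\<^sub>R c)) \<in> Au_c0"
      using lt1 by (intro Au_c0_compose_affine[OF f]) (auto intro!: c0_eqI)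
  next
    fix \<epsilon> :: real assume \<epsilon>: "0 < \<epsilon>"
    obtain B where B: "\<And>x. norm x < 1 \<Longrightarrow> cmod (f x) \<le> B" using Au_c0_bounded[OF f] by blast
    obtain M where M: "0 < M"
      "\<And>F x. F holomorphic_on ball 0 (1 / r) \<Longrightarrow> (\<And>y. cmod y < 1 / r \<Longrightarrow> cmod (F y) \<le> B) \<Longrightarrow> cmod x \<le> 1 \<Longrightarrow>
        cmod (F x - 1 / of_nat M * (\<Sum>j<M. F (unity_root M j) * (\<Sum>k<M. (x * cnj (unity_root M j)) ^ k))) \<le> \<epsilon>"
      using roots_of_unity_interpolation[OF r \<epsilon>, of B] by blast
    define w where "w = unity_root M"
    \<comment> \<open>Freezing coordinate \<open>K\<close> at a node moves it into the fixed vector,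
      leaving \<open>K\<close> variable coordinates for the induction hypothesis; hence the
      induction generalises \<open>c\<close>.\<close>
    define c' where "c' j = c0_scaleC (w j) (unit_c0 K) + c" for j
    define G where "G x = 1 / of_nat M * (\<Sum>j<M. f (r *\<^sub>R trunc K (coord x) + r *\<^sub>R c' j) *
      (\<Sum>k<M. (coord x K * cnj (w j)) ^ k))" for x
    have "chars_agree \<phi> \<psi> G"
    proof -
      have "coord (c' j) n = 0" if "n < K" for j n
        using Suc.prems(1)[of n] that by (simp add: c'_def)
      moreover have "norm (c' j) \<le> 1" for j
      proof -
        have "norm (c0_scaleC (w j) (unit_c0 K)) \<le> 1"
          by (rule c0_norm_le) (simp add: w_def)
        then show ?thesis
          unfolding c'_def using Suc.prems by (intro norm_add_disjoint_le) auto
      qed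
      ultimately show ?thesis
        unfolding G_def
        by (intro chars_agree_mult chars_agree_sum chars_agree_power chars_agree_const chars_agree_coord Suc.IH)
    qed
    moreover have "cmod (f (r *\<^sub>R trunc (Suc K) (coord x) + r *\<^sub>R c) - G x) \<le> \<epsilon>" if x: "norm x < 1" for x
    proof -
      \<comment> \<open>The factor \<open>r\<close> lets coordinate \<open>K\<close> range over the
        disc of radius \<open>1 / r\<close>, larger than the unit disc, as the interpolation
        requires.\<close>
      define F where "F t = f ((r *\<^sub>R trunc K (coord x) + r *\<^sub>R c) + c0_scaleC t (r *\<^sub>R unit_c0 K))" for t
      have F_lt1: "norm ((r *\<^sub>R trunc K (coord x) + r *\<^sub>R c) + c0_scaleC t (r *\<^sub>R unit_c0 K)) < 1"
        if t: "cmod t < 1 / r" for t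
      proof -
        define m where "m = max (norm (r *\<^sub>R trunc K (coord x) + r *\<^sub>R c)) (r * cmod t)"
        have "norm ((r *\<^sub>R trunc K (coord x) + r *\<^sub>R c) + c0_scaleC t (r *\<^sub>R unit_c0 K)) \<le> m"
        proof (rule norm_add_disjoint_le)
          show "coord (r *\<^sub>R trunc K (coord x) + r *\<^sub>R c) n = 0 \<or> coord (c0_scaleC t (r *\<^sub>R unit_c0 K)) n = 0" for n
            using Suc.prems(1)[of n] by (cases "n = K") simp_all
          have "norm (c0_scaleC t (r *\<^sub>R unit_c0 K)) \<le> r * cmod t"
            using r by (intro c0_norm_le) (simp add: norm_mult)
          then show "norm (c0_scaleC t (r *\<^sub>R unit_c0 K)) \<le> m" by (simp add: m_def)
        qed (simp add: m_def)
        moreover have "m < 1" using lt1[of K x] x t r by (simp add: m_def field_simps)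
        ultimately show ?thesis by simp
      qed
      have "cmod (coord x K) \<le> 1" using coord_le_norm[of x K] x by simp
      moreover have "F holomorphic_on ball 0 (1 / r)"
        unfolding F_def by (rule Au_c0_slice_holomorphic[OF f]) (use F_lt1 in auto)
      moreover have "cmod (F y) \<le> B" if "cmod y < 1 / r" for y
        unfolding F_def by (rule B[OF F_lt1[OF that]])
      ultimately have "cmod (F (coord x K) - 1 / of_nat M * (\<Sum>j<M. F (w j) * (\<Sum>k<M. (coord x K * cnj (w j)) ^ k))) \<le> \<epsilon>"
        unfolding w_def by (intro M(2))
      moreover have "F (coord x K) = f (r *\<^sub>R trunc (Suc K) (coord x) + r *\<^sub>R c)"
        unfolding F_def by (rule arg_cong[of _ _ f], rule c0_eqI) (auto simp: less_Suc_eq)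
      moreover have "F (w j) = f (r *\<^sub>R trunc K (coord x) + r *\<^sub>R c' j)" for j
        unfolding F_def c'_def by (rule arg_cong[of _ _ f], rule c0_eqI) (simp add: algebra_simps)
      ultimately show ?thesis by (simp add: G_def)
    qed
    ultimately show "\<exists>G. chars_agree \<phi> \<psi> G \<and>
        (\<forall>x. norm x < 1 \<longrightarrow> cmod (f (r *\<^sub>R trunc (Suc K) (coord x) + r *\<^sub>R c) - G x) \<le> \<epsilon>)"
      by blast
  qed
qed

text \<open>Truncation followed by dilation approximates \<open>f\<close> uniformly by functions
  covered by \<open>chars_agree_trunc\<close> with \<open>c = 0\<close>.\<close>

lemma characters_eqI: "\<phi> = \<psi>"
proof (rule extensionalityI[of _ Au_c0])
  fix f assume f: "f \<in> Au_c0"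
  have "chars_agree \<phi> \<psi> f"
  proof (rule chars_agree_limit)
    fix \<epsilon> :: real assume "0 < \<epsilon>"
    then have e2: "0 < \<epsilon> / 2" by simp
    obtain N where N: "\<And>x. norm x < 1 \<Longrightarrow> cmod (f x - f (trunc N (coord x))) \<le> \<epsilon> / 2"
      using Au_c0_trunc_uniform[OF f e2] by blast
    obtain d where d: "0 < d"
      "\<And>x y. norm x < 1 \<Longrightarrow> norm y < 1 \<Longrightarrow> norm (x - y) < d \<Longrightarrow> cmod (f x - f y) < \<epsilon> / 2"
      using Au_c0_uniformly_continuousD[OF f e2] by metis
    define r where "r = 1 - min d 1 / 2"
    have r: "0 < r" "r < 1" "1 - r < d" using d(1) by (auto simp: r_def)
    have "cmod (f x - f (r *\<^sub>R trunc N (coord x) + r *\<^sub>R 0)) \<le> \<epsilon>" if x: "norm x < 1" for x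
    proof -
      let ?y = "trunc N (coord x)"
      have y: "norm ?y < 1" using norm_trunc_coord_le[of N x] x by simp
      have "?y - r *\<^sub>R ?y = (1 - r) *\<^sub>R ?y" by (simp add: scaleR_left_diff_distrib)
      then have "norm (?y - r *\<^sub>R ?y) = (1 - r) * norm ?y" using r by simp
      also have "\<dots> \<le> 1 - r" using r y by (intro mult_left_le) auto
      finally have "norm (?y - r *\<^sub>R ?y) < d" using r by simp
      moreover have "norm (r *\<^sub>R ?y) < 1"
        using y r mult_left_le_one_le[of "norm ?y" r] by simp
      ultimately have "cmod (f ?y - f (r *\<^sub>R ?y)) < \<epsilon> / 2" using y by (intro d(2))
      then show ?thesis
        using N[OF x] norm_triangle_ineq[of "f x - f ?y" "f ?y - f (r *\<^sub>R ?y)"] by simp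
    qed
    moreover have "chars_agree \<phi> \<psi> (\<lambda>x. f (r *\<^sub>R trunc N (coord x) + r *\<^sub>R 0))"
      by (rule chars_agree_trunc[OF f r(1,2)]) auto
    ultimately show "\<exists>G. chars_agree \<phi> \<psi> G \<and> (\<forall>x. norm x < 1 \<longrightarrow> cmod (f x - G x) \<le> \<epsilon>)" by blast
  qed (simp add: f)
  then show "\<phi> f = \<psi> f" by (simp add: chars_agree_def f)
qed (rule charactersD(4)[OF \<phi>] charactersD(4)[OF \<psi>])+

end

lemma delta_c0_character:
  assumes z: "z \<in> cball 0 1"
  shows "delta_c0 z \<in> characters (ball 0 1) Au_c0"
  unfolding characters_def
proof (intro CollectI conjI ballI allI)
  show "delta_c0 z \<in> extensional Au_c0" by (simp add: delta_c0_def)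
  have lt1: "norm (inner_pt k (apply_bcontfun z)) < 1" for k
    using norm_inner_pt z linf_cball_iff by blast
  have lim: "delta_c0 z f = l"
    if "f \<in> Au_c0" "(\<lambda>k. f (inner_pt k (apply_bcontfun z))) \<longlonglongrightarrow> l" for f l
    using delta_c0_tendsto[OF that(1) z] that(2) LIMSEQ_unique by blast
  have "delta_c0 z (\<lambda>x\<in>ball 0 1. 1) = 1"
    by (rule lim[OF Au_c0_const]) (simp add: lt1)
  then show "\<exists>f\<in>Au_c0. delta_c0 z f \<noteq> 0"
    by (intro bexI[of _ "\<lambda>x\<in>ball 0 1. 1"] Au_c0_const) simp
  fix f assume f: "f \<in> Au_c0"
  show "delta_c0 z (\<lambda>x\<in>ball 0 1. c * f x) = c * delta_c0 z f" for c
    by (rule lim[OF Au_c0_scale[OF f]]) (simp add: lt1, intro tendsto_intros delta_c0_tendsto f z)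
  fix g assume g: "g \<in> Au_c0"
  show "delta_c0 z (\<lambda>x\<in>ball 0 1. f x + g x) = delta_c0 z f + delta_c0 z g"
    by (rule lim[OF Au_c0_add[OF f g]]) (simp add: lt1, intro tendsto_intros delta_c0_tendsto f g z)
  show "delta_c0 z (\<lambda>x\<in>ball 0 1. f x * g x) = delta_c0 z f * delta_c0 z g"
    by (rule lim[OF Au_c0_mult[OF f g]]) (simp add: lt1, intro tendsto_intros delta_c0_tendsto f g z)
qed

text \<open>The values on the coordinates are bounded by 1 and determine the character, so they are
  the coordinates of the desired point. This excludes elements of a Gleason part that are not
  evaluations.\<close>

lemma character_eq_delta_c0:
  assumes \<phi>: "\<phi> \<in> characters (ball 0 1) Au_c0"
  obtains v where "v \<in> cball 0 1" "\<phi> = delta_c0 v"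
proof -
  define a where "a n = \<phi> (\<lambda>x\<in>ball 0 1. coord x n)" for n
  have a: "cmod (a n) \<le> 1" for n
  proof -
    have "cmod ((\<lambda>x\<in>ball 0 1. coord x n) x) \<le> 1" if "norm x < 1" for x
      using coord_le_norm[of x n] that by simp
    then show ?thesis unfolding a_def by (rule character_le[OF \<phi> coord_Au_c0])
  qed
  then have "a \<in> bcontfun" by (intro bcontfun_normI[where b = 1]) auto
  then have va: "apply_bcontfun (Bcontfun a) = a" by (simp add: Bcontfun_inverse)
  then have v: "Bcontfun a \<in> cball 0 1" using a linf_cball_iff by metis
  have "\<phi> = delta_c0 (Bcontfun a)"
    by (rule characters_eqI[OF \<phi> delta_c0_character[OF v]])
      (simp only: delta_c0_coord[OF v] va a_def)
  with v show thesis by (rule that)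
qed

section \<open>The quotient formula and Gleason parts\<close>

text \<open>Equal coordinates contribute 0, which the nonnegative quotients dominate, so dropping
  them leaves the supremum unchanged. The empty index set is treated apart because its real supremum
  has no prescribed value.\<close>

lemma SUP_pseudohyp_dist_disc:
  fixes z w :: linf
  assumes z: "z \<in> cball 0 1" and w: "w \<in> cball 0 1"
  shows "(SUP n. pseudohyp_dist_disc (apply_bcontfun z n) (apply_bcontfun w n)) =
    (if {n. apply_bcontfun z n \<noteq> apply_bcontfun w n} = {} then 0
     else (SUP n\<in>{n. apply_bcontfun z n \<noteq> apply_bcontfun w n}. pdisc (apply_bcontfun z n) (apply_bcontfun w n)))"
    (is "(SUP n. ?g n) = (if ?N = {} then 0 else (SUP n\<in>?N. ?p n))")
proof -
  have zw: "cmod (apply_bcontfun z n) \<le> 1" "cmod (apply_bcontfun w n) \<le> 1" for n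
    using z w linf_cball_iff by blast+
  have g: "?g n = (if n \<in> ?N then ?p n else 0)" for n
    using pseudohyp_dist_disc_eq[OF zw] by simp
  show ?thesis
  proof (cases "?N = {}")
    case True
    then have "?g n = 0" for n using g[of n] by simp
    with True show ?thesis by (simp only: if_True cSUP_const[OF UNIV_not_empty] refl)
  next
    case False
    have p1: "?p n \<le> 1" for n by (rule pdisc_le_1[OF zw])
    have bdd: "bdd_above (range ?g)" "bdd_above (?p ` ?N)"
      using pseudohyp_dist_disc_le_1[OF zw] p1 by (auto intro!: bdd_aboveI2)
    have ub: "?p n \<le> (SUP n\<in>?N. ?p n)" if "n \<in> ?N" for n
      using that bdd(2) by (rule cSUP_upper)
    have "0 \<le> (SUP n\<in>?N. ?p n)"
      using False ub order.trans[OF pdisc_nonneg] by blast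
    then have "(SUP n. ?g n) \<le> (SUP n\<in>?N. ?p n)"
      using ub by (intro cSUP_least) (auto simp: g)
    moreover have "(SUP n\<in>?N. ?p n) \<le> (SUP n. ?g n)"
    proof (rule cSUP_least[OF False])
      fix n assume "n \<in> ?N"
      then have "?p n = ?g n" by (simp add: g)
      also have "\<dots> \<le> (SUP n. ?g n)" using bdd(1) by (intro cSUP_upper) auto
      finally show "?p n \<le> (SUP n. ?g n)" .
    qed
    ultimately show ?thesis by (simp only: False if_False order.antisym)
  qed
qed

lemma gleason_part_delta_c0:
  fixes z :: linf
  assumes z: "z \<in> cball 0 1"
  shows "gleason_part (ball 0 1) Au_c0 (delta_c0 z) =
    (\<Union>r\<in>{0<..<1}. {delta_c0 v | v. v \<in> cball 0 1 \<and>
      (\<forall>n. (cmod (z n) = 1 \<longrightarrow> v n = z n) \<and> (cmod (z n) < 1 \<longrightarrow> v n \<in> pseudohyp_disc r (z n)))})"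
    (is "_ = (\<Union>r\<in>{0<..<1}. ?P r)")
proof (intro set_eqI iffI)
  have z1: "cmod (z n) \<le> 1" for n using z linf_cball_iff by blast
  fix \<psi>
  {
    assume "\<psi> \<in> gleason_part (ball 0 1) Au_c0 (delta_c0 z)"
    then have \<psi>: "\<psi> \<in> characters (ball 0 1) Au_c0" "pseudohyp_dist (ball 0 1) Au_c0 (delta_c0 z) \<psi> < 1"
      by (auto simp: gleason_part_def)
    obtain v where v: "v \<in> cball 0 1" "\<psi> = delta_c0 v" by (rule character_eq_delta_c0[OF \<psi>(1)])
    have v1: "cmod (v n) \<le> 1" for n using v linf_cball_iff by blast
    define S where "S = (SUP n. pseudohyp_dist_disc (z n) (v n))"
    have "S < 1" using \<psi>(2) pseudohyp_dist_c0_eq[OF z v(1)] by (simp add: S_def v(2))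
    have "bdd_above (range (\<lambda>n. pseudohyp_dist_disc (z n) (v n)))"
      using pseudohyp_dist_disc_le_1[OF z1 v1] by (intro bdd_aboveI2) auto
    then have S: "pseudohyp_dist_disc (z n) (v n) \<le> S" for n
      unfolding S_def by (intro cSUP_upper) auto
    have "0 \<le> S" using order.trans[OF pseudohyp_dist_disc_nonneg[OF z1 v1] S] .
    \<comment> \<open>Strictly between \<open>S\<close> and 1, and positive even if
      \<open>S = 0\<close>; the inequality in \<open>pseudohyp_disc\<close> is strict.\<close>
    define r where "r = (1 + S) / 2"
    have r: "0 < r" "r < 1" "S < r" using \<open>0 \<le> S\<close> \<open>S < 1\<close> by (auto simp: r_def)
    \<comment> \<open>Distinct points with one on the circle have distance 1, which exceeds
      \<open>S\<close>. This also keeps \<open>v n\<close> off the circle where \<open>z n\<close>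
      is inside.\<close>
    have eq: "v n = z n" if "cmod (z n) = 1 \<or> cmod (v n) = 1" for n
    proof (rule ccontr)
      assume "v n \<noteq> z n"
      then have "pseudohyp_dist_disc (z n) (v n) = 1"
        using pseudohyp_dist_disc_eq[OF z1 v1] pdisc_boundary[OF z1 v1 _ that] by auto
      then show False using S[of n] \<open>S < 1\<close> by simp
    qed
    have "v n \<in> pseudohyp_disc r (z n)" if "cmod (z n) < 1" for n
    proof -
      have "cmod (v n) \<noteq> 1" using eq[of n] that by auto
      then have "cmod (v n) < 1" using v1[of n] by linarith
      moreover have "pdisc (z n) (v n) < r"
      proof (cases "v n = z n")
        case True
        then show ?thesis using r by (simp add: pdisc_def)
      next
        case False
        then show ?thesis using S[of n] r pseudohyp_dist_disc_eq[OF z1 v1, of n n] by auto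
      qed
      ultimately show ?thesis by (simp add: pseudohyp_disc_def pdisc_def)
    qed
    then have "\<psi> \<in> ?P r" using v eq by blast
    then show "\<psi> \<in> (\<Union>r\<in>{0<..<1}. ?P r)" by (rule UN_I[rotated]) (use r in simp)
  next
    assume "\<psi> \<in> (\<Union>r\<in>{0<..<1}. ?P r)"
    then obtain r where "r \<in> {0<..<1}" and P: "\<psi> \<in> ?P r"
      by (rule UN_E)
    then have r: "0 < r" "r < 1" by simp_all
    from P obtain v where v: "v \<in> cball 0 1" "\<psi> = delta_c0 v"
      and vz: "\<And>n. cmod (z n) = 1 \<Longrightarrow> v n = z n" "\<And>n. cmod (z n) < 1 \<Longrightarrow> v n \<in> pseudohyp_disc r (z n)"
      by blast
    have v1: "cmod (v n) \<le> 1" for n using v linf_cball_iff by blast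
    \<comment> \<open>One \<open>r\<close> for all coordinates keeps the supremum below 1; distances
      that are merely below 1 in each coordinate would not.\<close>
    have "pseudohyp_dist_disc (z n) (v n) \<le> r" for n
    proof (cases "v n = z n")
      case True
      then show ?thesis using r pseudohyp_dist_disc_eq[OF z1 v1, of n n] by simp
    next
      case False
      then have "cmod (z n) < 1" using vz(1)[of n] z1[of n] by fastforce
      then have "pdisc (z n) (v n) < r" using vz(2)[of n] by (simp add: pseudohyp_disc_def pdisc_def)
      then show ?thesis using False pseudohyp_dist_disc_eq[OF z1 v1, of n n] by simp
    qed
    then have "pseudohyp_dist_c0 z v \<le> r"
      unfolding pseudohyp_dist_c0_eq[OF z v(1)] by (intro cSUP_least) auto
    then show "\<psi> \<in> gleason_part (ball 0 1) Au_c0 (delta_c0 z)"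
      using r delta_c0_character[OF v(1)] by (simp add: gleason_part_def v(2))
  }
qed

theorem theorem2p4:
  fixes z w :: "nat \<Rightarrow>\<^sub>C complex"
  assumes "z \<in> cball 0 1" and "w \<in> cball 0 1"
  shows "gleason_dist_c0 z w = (SUP n. gleason_dist_disc (z n) (w n)) \<and>
    (let N0 = {n. z n \<noteq> w n} in
      pseudohyp_dist_c0 z w = (SUP n. pseudohyp_dist_disc (z n) (w n)) \<and>
      (SUP n. pseudohyp_dist_disc (z n) (w n)) =
        (if N0 = {} then 0 else (SUP n\<in>N0. cmod ((z n - w n) / (1 - cnj (z n) * w n))))) \<and>
    gleason_part (ball 0 1) Au_c0 (delta_c0 z) =
      (\<Union>r\<in>{0<..<1}. {delta_c0 v | v. v \<in> cball 0 1 \<and>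
        (\<forall>n. (cmod (z n) = 1 \<longrightarrow> v n = z n) \<and>
             (cmod (z n) < 1 \<longrightarrow> v n \<in> pseudohyp_disc r (z n)))})"
  using gleason_dist_c0_eq[OF assms] pseudohyp_dist_c0_eq[OF assms]
    SUP_pseudohyp_dist_disc[OF assms, unfolded pdisc_def] gleason_part_delta_c0[OF assms(1)]
  unfolding Let_def by blast

end
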